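(* Let $f:[0,1]\to\mathbb{R}^+$ be $C^2$ with $f(0)=f(1)$, $f'(0)=f'(1)$ and $\inf f>0$, and assume that, as $n\to\infty$, (i) $n^{-1}k_n\log(n)\to0$, (ii) $n^{-1}k_n^2\to\infty$, (iii) $(b_n\log(b_n))^{-1}k_n\to\infty$ and (iv) $nk_n^{-1/2}b_n^{-3/2}\to0$. Then, for all $(x_1,\dots,x_p)\subset[0,1]$, $$\left\{v_nc\left(\widehat f_n(x_j)-f(x_j)\right):1\le j\le p\right\}\underset{\mathcal D}{\to}N(0,I_p),$$ where $v_n=n(b_nk_n)^{-1/2}$, $I_p$ is the identity matrix of $\mathbb{R}^p$ and $\underset{\mathcal D}{\to}$ denotes convergence in distribution to the indicated centered Gaussian law. The choice $b_n=n^{1/2}$ and $k_n=n^{1/2}\log(n)u_n^2$ leads to $v_n=n^{1/2}\log(n)^{-1/2}u_n^{-1}$, where $u_n\to\infty$ arbitrarily slowly.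
   Context: $E=[0,1]$, $\nu$ is Lebesgue measure on $E$, $S=\{(x,y)\in E\times\mathbb{R}:0\le y\le f(x)\}$, $c>0$ is a constant and $\lambda$ is Lebesgue measure on $\mathbb{R}^+$. For each $n\ge1$, $N_n$ is a Poisson point process on $E\times\mathbb{R}^+$ with intensity measure $nc(\nu\otimes\lambda)\mathbf{1}_S$, with points $\{(X_{n,i},Y_{n,i}):1\le i\le N_n(S)\}$. $(k_n)$ is a sequence of positive integers with $k_n\uparrow\infty$, and $\{I_{n,r}:1\le r\le k_n\}$ is the equidistant partition of $[0,1]$ into $k_n$ intervals of length $1/k_n$. Put $D_{n,r}=\{(x,y):x\in I_{n,r},\,0\le y\le f(x)\}$, $N_{n,r}=N_n(D_{n,r})$, $Y^*_{n,r}=\max\{Y_{n,i}:(X_{n,i},Y_{n,i})\in D_{n,r}\}$ if $N_{n,r}\ne0$ and $Y^*_{n,r}=0$ otherwise, with the convention $0\times\infty=0$, so that $(1+1/N_{n,r})Y^*_{n,r}=0$ when $N_{n,r}=0$. $(b_n)$ is a sequence of integers tending to infinity. The trigonometric basis of $L^2([0,1])$ is $e_0(x)=1$, $e_{2k-1}(x)=\sqrt2\cos(2k\pi x)$, $e_{2k}(x)=\sqrt2\sin(2k\pi x)$, $k\ge1$. The Dirichlet kernel is $K_n^D(x,t)=\sum_{j=0}^{b_n}e_j(x)e_j(t)$, and $$\widehat f_n(x)=\sum_{r=1}^{k_n}\left(\int_{I_{n,r}}K_n^D(x,t)\,dt\right)\left(1+\frac1{N_{n,r}}\right)Y^*_{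n,r}.$$
   Formalization: The points x_1,…,x_p are taken pairwise distinct and not containing both 0 and 1 (otherwise two components coincide and the limit cannot be N(0,I_p)); "arbitrarily slowly" means u_n→∞ with (log n)^2 u_n^2 n^{-1/2}→0, which is (i). *)

theory Defs
  imports "HOL-Probability.Probability" "HOL-Library.Landau_Symbols"
begin

text \<open>
  A point process with finitely many points is represented by a random finite multiset of points;
  the number of points in \<open>A\<close> is counted with multiplicity.
\<close>

definition num_points :: "('w \<Rightarrow> 'a multiset) \<Rightarrow> 'a set \<Rightarrow> 'w \<Rightarrow> nat" where
  "num_points N A \<omega> = size (filter_mset (\<lambda>z. z \<in> A) (N \<omega>))"

text \<open>
  The Poisson probabilities are written out because \<open>poisson_pmf\<close> requires a positive rate, while
  sets of intensity 0 must be covered, too (there \<open>0 ^ 0 = 1\<close> gives a count that is almost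
  surely 0).
\<close>

definition poisson_point_process ::
    "'w measure \<Rightarrow> ('w \<Rightarrow> 'a multiset) \<Rightarrow> 'a measure \<Rightarrow> bool" where
  "poisson_point_process M N \<mu> \<longleftrightarrow>
     finite_measure \<mu> \<and>
     (\<forall>\<omega>\<in>space M. set_mset (N \<omega>) \<subseteq> space \<mu>) \<and>
     (\<forall>A\<in>sets \<mu>. num_points N A \<in> measurable M (count_space UNIV)) \<and>
     (\<forall>A\<in>sets \<mu>. \<forall>j. measure M {\<omega>\<in>space M. num_points N A \<omega> = j}
        = measure \<mu> A ^ j / fact j * exp (- measure \<mu> A)) \<and>
     (\<forall>m::nat. \<forall>A. (\<forall>i<m. A i \<in> sets \<mu>) \<and> disjoint_family_on A {..<m} \<longrightarrow>
        prob_space.indep_vars M (\<lambda>_. count_space UNIV) (\<lambda>i. num_points N (A i)) {..<m})"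

definition support_set :: "(real \<Rightarrow> real) \<Rightarrow> (real \<times> real) set" where
  "support_set f = {(x, y). x \<in> {0..1} \<and> 0 \<le> y \<and> y \<le> f x}"

definition intensity :: "(real \<Rightarrow> real) \<Rightarrow> real \<Rightarrow> nat \<Rightarrow> (real \<times> real) measure" where
  "intensity f c n =
     density (restrict_space lborel {0..1} \<Otimes>\<^sub>M restrict_space lborel {0..})
       (\<lambda>z. ennreal (real n * c) * indicator (support_set f) z)"

text \<open>
  The cells are half-open except for the last one, which contains the end point 1, so that they
  form a partition of \<open>[0,1]\<close>; here \<open>1 \<le> r \<le> k\<close>.
\<close>

definition cell :: "nat \<Rightarrow> nat \<Rightarrow> real set" where
  "cell k r =
     (if r = k then {(real r - 1) / real k .. 1} else {(real r - 1) / real k ..< real r / real k})"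

definition strip :: "(real \<Rightarrow> real) \<Rightarrow> nat \<Rightarrow> nat \<Rightarrow> (real \<times> real) set" where
  "strip f k r = {(x, y). x \<in> cell k r \<and> 0 \<le> y \<and> y \<le> f x}"

definition strip_max :: "('w \<Rightarrow> (real \<times> real) multiset) \<Rightarrow> (real \<times> real) set \<Rightarrow> 'w \<Rightarrow> real" where
  "strip_max N D \<omega> =
     (if num_points N D \<omega> \<noteq> 0 then Max {y. \<exists>x. (x, y) \<in># N \<omega> \<and> (x, y) \<in> D} else 0)"

definition trig_basis :: "nat \<Rightarrow> real \<Rightarrow> real" where
  "trig_basis j x =
     (if j = 0 then 1
      else if odd j then sqrt 2 * cos (2 * real ((j + 1) div 2) * pi * x)
      else sqrt 2 * sin (2 * real (j div 2) * pi * x))"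

lemma trig_basis_simps:
  "trig_basis 0 x = 1"
  "k \<ge> 1 \<Longrightarrow> trig_basis (2 * k - 1) x = sqrt 2 * cos (2 * real k * pi * x)"
  "k \<ge> 1 \<Longrightarrow> trig_basis (2 * k) x = sqrt 2 * sin (2 * real k * pi * x)"
  by (auto simp: trig_basis_def)

definition dirichlet_kernel :: "nat \<Rightarrow> real \<Rightarrow> real \<Rightarrow> real" where
  "dirichlet_kernel b x t = (\<Sum>j=0..b. trig_basis j x * trig_basis j t)"

text \<open>
  On an empty strip the summand vanishes because \<open>1 / 0 = 0\<close> and the maximum is set to 0.
\<close>

definition estimator ::
    "(real \<Rightarrow> real) \<Rightarrow> ('w \<Rightarrow> (real \<times> real) multiset) \<Rightarrow> nat \<Rightarrow> nat \<Rightarrow> real \<Rightarrow> 'w \<Rightarrow> real" where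
  "estimator f N k b x \<omega> =
     (\<Sum>r=1..k. (LBINT t:cell k r. dirichlet_kernel b x t)
        * (1 + 1 / real (num_points N (strip f k r) \<omega>)) * strip_max N (strip f k r) \<omega>)"

definition rate :: "nat \<Rightarrow> real \<Rightarrow> real \<Rightarrow> real" where
  "rate n b k = real n * (b * k) powr (- 1 / 2)"

definition growth_conditions :: "(nat \<Rightarrow> nat) \<Rightarrow> (nat \<Rightarrow> nat) \<Rightarrow> bool" where
  "growth_conditions k b \<longleftrightarrow>
     (\<lambda>n. real (k n) * ln (real n) / real n) \<longlonglongrightarrow> 0 \<and>
     filterlim (\<lambda>n. real (k n) ^ 2 / real n) at_top sequentially \<and>
     filterlim (\<lambda>n. real (k n) / (real (b n) * ln (real (b n)))) at_top sequentially \<and>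
     (\<lambda>n. real n * real (k n) powr (- 1 / 2) * real (b n) powr (- 3 / 2)) \<longlonglongrightarrow> 0"

definition std_gaussian :: "(real ^ 'p) measure" where
  "std_gaussian = density lborel (\<lambda>x. ennreal (\<Prod>i\<in>UNIV. std_normal_density (x $ i)))"

definition converges_in_distribution ::
    "'w measure \<Rightarrow> (nat \<Rightarrow> 'w \<Rightarrow> 'a::topological_space) \<Rightarrow> 'a measure \<Rightarrow> bool" where
  "converges_in_distribution M V \<nu> \<longleftrightarrow>
     (\<forall>\<^sub>F n in sequentially. V n \<in> borel_measurable M) \<and>
     (\<forall>g :: 'a \<Rightarrow> real. continuous_on UNIV g \<and> bounded (range g) \<longrightarrow>
        (\<lambda>n. \<integral>\<omega>. g (V n \<omega>) \<partial>M) \<longlonglongrightarrow> (\<integral>z. g z \<partial>\<nu>))"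

end

theory Submission
  imports Defs "HOL-Real_Asymp.Real_Asymp"
begin

text \<open>
  Let \<open>G\<close> be the mean number of points of a strip below a given height, \<open>\<Lambda>\<close> the mean number of
  all its points, \<open>N\<close> the number of points and \<open>Y\<close> the largest height. The joint law of \<open>N\<close> and
  \<open>T = G Y\<close> does not depend on the shape of the strip: \<open>P(N = j, T \<le> \<tau>) = exp (-\<Lambda>) \<tau>^j / j!\<close>.
  Hence the noise \<open>\<xi> = (1 + 1/N) T - \<Lambda>\<close> (\<open>0\<close> on an empty strip) has mean exactly 0, variance
  tending to 1 and bounded fourth moment as \<open>\<Lambda>\<close> grows. Up to a remainder that vanishes in
  \<open>L\<^sup>1\<close>, the normalized estimation error is the weighted sum of the independent \<open>\<xi>\<close>'s of the cells,
  with the integrals of the Dirichlet kernel over the cells as weights. The remainder has four sources: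
  \<open>Y\<close> differs from the rescaled \<open>T\<close> only if a point falls into the slanted top of the strip;
  a strip may be empty; \<open>f\<close> is replaced by its cell averages; and the Fourier series is truncated. The
  first three are multiplied by the Lebesgue constant \<open>O(ln b)\<close>, the last one is \<open>O(1/b)\<close> for
  periodic \<open>f\<close> of class \<open>C\<^sup>2\<close>.
  The weighted sum has an asymptotically Gaussian characteristic function by a third-moment bound, and
  orthonormality of the trigonometric basis gives the limit covariance
  \<open>K(x\<^sub>i, x\<^sub>j) / b \<longlonglongrightarrow> \<delta>\<^sub>i\<^sub>j\<close>.
\<close>

section \<open>The Dirichlet kernel\<close>

text \<open>Given \<open>N = j\<close>, \<open>T / \<Lambda>\<close> is the largest of
  \<open>j\<close> independent uniform variables and has mean \<open>j / (j + 1)\<close>; hence the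
  factor \<open>1 + 1/N\<close> centres the noise exactly, and no bias enters the central limit
  argument. With \<open>v\<close> the rate, condition (iv) says that \<open>v / b\<close> tends to
  0, which removes the truncation of the Fourier series. Multiplied by \<open>b ln b / k\<close>,
  which vanishes by (iii), it shows that \<open>v ln b / k\<close> vanishes. This is the size of the
  other three remainders: (ii) makes the slanted-top error \<open>O(1/k)\<close> per cell, (i) makes
  the probability of an empty strip \<open>O(1/k)\<close>, and cell averaging costs
  \<open>L / k\<close>. Condition (i) also sends the mean counts to infinity, (iii) makes every
  single weight small and the Riemann sum for the covariance converge. An even cutoff
  \<open>b\<close> gives a convolution kernel with a closed form; an odd one leaves an unpaired
  cosine, which is handled as a perturbation. The basis has period 1, so the estimators at 0 and 1
  coincide. The limit covariance is the identity only for points that are distinct modulo 1.\<close>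

lemma abs_trig_basis_le: "\<bar>trig_basis j x\<bar> \<le> sqrt 2"
  by (auto simp: trig_basis_def abs_mult)

lemma continuous_on_trig_basis [continuous_intros]: "continuous_on S (trig_basis j)"
proof (cases "j = 0")
  case False
  then show ?thesis
    by (cases "odd j") (auto simp: trig_basis_def intro!: continuous_intros)
qed (simp add: trig_basis_def)

text \<open>A mode has amplitude at most \<open>sqrt 2\<close> and angular frequency at most
  \<open>(j + 1) * pi\<close>, attained for odd \<open>j\<close>. The Lipschitz bounds for sine and
  cosine come from the sum-to-product formulas.\<close>

lemma trig_basis_lipschitz: "\<bar>trig_basis j s - trig_basis j t\<bar> \<le> sqrt 2 * (real j + 1) * pi * \<bar>s - t\<bar>"
proof -
  have cs: "\<bar>cos u - cos v\<bar> \<le> \<bar>u - v\<bar>" for u v :: real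
  proof -
    have "\<bar>cos u - cos v\<bar> = 2 * (\<bar>sin ((u + v) / 2)\<bar> * \<bar>sin ((v - u) / 2)\<bar>)"
      by (simp add: cos_diff_cos abs_mult)
    also have "\<dots> \<le> 2 * (1 * \<bar>(v - u) / 2\<bar>)"
      by (intro mult_left_mono mult_mono abs_sin_x_le_abs_x) auto
    finally show ?thesis by simp
  qed
  have sn: "\<bar>sin u - sin v\<bar> \<le> \<bar>u - v\<bar>" for u v :: real
  proof -
    have "\<bar>sin u - sin v\<bar> = 2 * (\<bar>sin ((u - v) / 2)\<bar> * \<bar>cos ((u + v) / 2)\<bar>)"
      by (simp add: sin_diff_sin abs_mult)
    also have "\<dots> \<le> 2 * (\<bar>(u - v) / 2\<bar> * 1)"
      by (intro mult_left_mono mult_mono abs_sin_x_le_abs_x) auto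
    finally show ?thesis by simp
  qed
  have lin: "\<bar>2 * real m * pi * s - 2 * real m * pi * t\<bar> \<le> (real j + 1) * pi * \<bar>s - t\<bar>"
    if "2 * m \<le> j + 1" for m
  proof -
    have "\<bar>2 * real m * pi * s - 2 * real m * pi * t\<bar> = (2 * real m) * (pi * \<bar>s - t\<bar>)"
      by (simp add: abs_mult flip: right_diff_distrib)
    also have "2 * real m \<le> real j + 1"
      using that by linarith
    hence "(2 * real m) * (pi * \<bar>s - t\<bar>) \<le> (real j + 1) * (pi * \<bar>s - t\<bar>)"
      by (intro mult_right_mono) auto
    finally show ?thesis by simp
  qed
  consider "j = 0" | "odd j" | "j \<noteq> 0" "even j" by blast
  then show ?thesis
  proof cases
    case 2
    have "\<bar>trig_basis j s - trig_basis j t\<bar> =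
        sqrt 2 * \<bar>cos (2 * real ((j + 1) div 2) * pi * s) - cos (2 * real ((j + 1) div 2) * pi * t)\<bar>"
      using 2 by (auto simp: trig_basis_def abs_mult simp flip: right_diff_distrib)
    also have "\<dots> \<le> sqrt 2 * ((real j + 1) * pi * \<bar>s - t\<bar>)"
      by (intro mult_left_mono order.trans[OF cs lin]) auto
    finally show ?thesis by simp
  next
    case 3
    have "\<bar>trig_basis j s - trig_basis j t\<bar> =
        sqrt 2 * \<bar>sin (2 * real (j div 2) * pi * s) - sin (2 * real (j div 2) * pi * t)\<bar>"
      using 3 by (auto simp: trig_basis_def abs_mult simp flip: right_diff_distrib)
    also have "\<dots> \<le> sqrt 2 * ((real j + 1) * pi * \<bar>s - t\<bar>)"
      by (intro mult_left_mono order.trans[OF sn lin]) auto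
    finally show ?thesis by simp
  qed (auto simp: trig_basis_def)
qed

lemma continuous_on_dirichlet_kernel [continuous_intros]: "continuous_on S (dirichlet_kernel b x)"
  unfolding dirichlet_kernel_def by (intro continuous_intros)

lemma abs_dirichlet_kernel_le: "\<bar>dirichlet_kernel b x t\<bar> \<le> 2 * (real b + 1)"
proof -
  have "\<bar>dirichlet_kernel b x t\<bar> \<le> (\<Sum>j=0..b. \<bar>trig_basis j x\<bar> * \<bar>trig_basis j t\<bar>)"
    unfolding dirichlet_kernel_def by (rule order.trans[OF sum_abs]) (simp add: abs_mult)
  also have "\<dots> \<le> (\<Sum>j=0..b. sqrt 2 * sqrt 2)"
    by (intro sum_mono mult_mono abs_trig_basis_le) auto
  finally show ?thesis by (simp add: algebra_simps)
qed

text \<open>Of the two factors \<open>b + 1\<close>, one counts the modes and the other bounds their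
  frequency. The bound serves to compare squared cell integrals of kernels with the integral of the
  square.\<close>

lemma dirichlet_kernel_lipschitz:
  "\<bar>dirichlet_kernel b x s - dirichlet_kernel b x t\<bar> \<le> 2 * pi * (real b + 1)\<^sup>2 * \<bar>s - t\<bar>"
proof -
  have "\<bar>dirichlet_kernel b x s - dirichlet_kernel b x t\<bar>
      \<le> (\<Sum>j=0..b. \<bar>trig_basis j x\<bar> * \<bar>trig_basis j s - trig_basis j t\<bar>)"
    unfolding dirichlet_kernel_def sum_subtractf[symmetric]
    by (rule order.trans[OF sum_abs]) (simp add: abs_mult flip: right_diff_distrib)
  also have "\<dots> \<le> (\<Sum>j=0..b. sqrt 2 * (sqrt 2 * (real b + 1) * pi * \<bar>s - t\<bar>))"
  proof (intro sum_mono mult_mono abs_trig_basis_le)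
    fix j assume "j \<in> {0..b}"
    then have "sqrt 2 * (real j + 1) * pi * \<bar>s - t\<bar> \<le> sqrt 2 * (real b + 1) * pi * \<bar>s - t\<bar>"
      by (intro mult_right_mono mult_left_mono) auto
    with trig_basis_lipschitz[of j s t]
    show "\<bar>trig_basis j s - trig_basis j t\<bar> \<le> sqrt 2 * (real b + 1) * pi * \<bar>s - t\<bar>"
      by linarith
  qed auto
  also have "\<dots> = 2 * pi * (real b + 1)\<^sup>2 * \<bar>s - t\<bar>"
    by (simp add: power2_eq_square algebra_simps)
  finally show ?thesis .
qed

text \<open>By the addition theorem, a cosine-sine pair of equal frequency depends on
  \<open>x - t\<close> only, and with an even cutoff all pairs are complete.\<close>

lemma dirichlet_kernel_even:
  "dirichlet_kernel (2 * m) x t = 1 + 2 * (\<Sum>i=1..m. cos (2 * real i * pi * (x - t)))"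
proof (induction m)
  case (Suc m)
  have "dirichlet_kernel (2 * Suc m) x t = dirichlet_kernel (2 * m) x t
      + trig_basis (2 * Suc m - 1) x * trig_basis (2 * Suc m - 1) t
      + trig_basis (2 * Suc m) x * trig_basis (2 * Suc m) t"
    by (simp add: dirichlet_kernel_def)
  moreover have sq: "sqrt 2 * u * (sqrt 2 * v) = 2 * (u * v)" for u v :: real
    by (simp add: algebra_simps flip: mult.assoc)
  moreover have "trig_basis (2 * Suc m - 1) s = sqrt 2 * cos (2 * real (Suc m) * pi * s)"
    "trig_basis (2 * Suc m) s = sqrt 2 * sin (2 * real (Suc m) * pi * s)" for s
    by (rule trig_basis_simps; simp)+
  moreover have "cos (2 * real (Suc m) * pi * (x - t)) =
      cos (2 * real (Suc m) * pi * x) * cos (2 * real (Suc m) * pi * t) +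
      sin (2 * real (Suc m) * pi * x) * sin (2 * real (Suc m) * pi * t)"
    by (simp only: right_diff_distrib cos_diff)
  ultimately have "dirichlet_kernel (2 * Suc m) x t =
      dirichlet_kernel (2 * m) x t + 2 * cos (2 * real (Suc m) * pi * (x - t))"
    by (simp only: sq distrib_left add.assoc)
  then show ?case using Suc by simp
qed (simp add: dirichlet_kernel_def trig_basis_def)

text \<open>An odd cutoff leaves the last cosine without its sine, so translation invariance is
  lost; the extra term is at most 2 in absolute value and is treated separately wherever the closed
  form is used.\<close>

lemma dirichlet_kernel_odd:
  "dirichlet_kernel (2 * m + 1) x t = dirichlet_kernel (2 * m) x t
     + 2 * cos (2 * real (m + 1) * pi * x) * cos (2 * real (m + 1) * pi * t)"
proof -
  have "trig_basis (2 * m + 1) s = sqrt 2 * cos (2 * real (m + 1) * pi * s)" for s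
    using trig_basis_simps(2)[of "m + 1" s] by simp
  then show ?thesis by (simp add: dirichlet_kernel_def)
qed

text \<open>Telescoping: twice \<open>sin (pi * s)\<close> times the \<open>i\<close>-th cosine is
  the difference of the sines with the odd multiples \<open>2 * i + 1\<close> and
  \<open>2 * i - 1\<close> of \<open>pi * s\<close>.\<close>

lemma sin_mult_dirichlet_kernel_even:
  "sin (pi * (x - t)) * dirichlet_kernel (2 * m) x t = sin ((2 * real m + 1) * pi * (x - t))"
  unfolding dirichlet_kernel_even
proof (induction m)
  case (Suc m)
  define s where "s = x - t"
  have "2 * (sin p * cos q) = sin (q + p) - sin (q - p)" for p q :: real
    by (simp add: sin_add sin_diff)
  from this[of "pi * s" "2 * real (Suc m) * pi * s"]
  have "2 * (sin (pi * s) * cos (2 * real (Suc m) * pi * s))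
      = sin ((2 * real (Suc m) + 1) * pi * s) - sin ((2 * real m + 1) * pi * s)"
    by (simp add: algebra_simps)
  then show ?case using Suc unfolding s_def[symmetric]
    by (simp add: algebra_simps)
qed simp

text \<open>The closed form contributes 1, an unpaired cosine 2. The product form avoids a case
  distinction at the zeros of the sine.\<close>

lemma dirichlet_kernel_decay: "\<bar>sin (pi * (x - t))\<bar> * \<bar>dirichlet_kernel b x t\<bar> \<le> 3"
proof -
  have ev: "\<bar>sin (pi * (x - t)) * dirichlet_kernel (2 * m) x t\<bar> \<le> 1" for m
    by (simp add: sin_mult_dirichlet_kernel_even)
  show ?thesis
  proof (cases b rule: parity_cases)
    case even
    then obtain m where 1: "b = 2 * m" by (elim evenE)
    from 1 show ?thesis using ev[of m] by (simp add: abs_mult)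
  next
    case odd
    then obtain m where 2: "b = 2 * m + 1" by (elim oddE)
    let ?C = "2 * cos (2 * real (m + 1) * pi * x) * cos (2 * real (m + 1) * pi * t)"
    have "\<bar>?C\<bar> = 2 * (\<bar>cos (2 * real (m + 1) * pi * x)\<bar> * \<bar>cos (2 * real (m + 1) * pi * t)\<bar>)"
      by (simp add: abs_mult)
    also have "\<dots> \<le> 2 * (1 * 1)"
      by (intro mult_left_mono mult_mono) auto
    finally have "\<bar>sin (pi * (x - t)) * ?C\<bar> \<le> 1 * 2"
      unfolding abs_mult[of "sin _"] by (intro mult_mono) auto
    with ev[of m] have "\<bar>sin (pi * (x - t)) * dirichlet_kernel b x t\<bar> \<le> 3"
      unfolding 2 dirichlet_kernel_odd distrib_left by linarith
    then show ?thesis by (simp add: abs_mult)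
  qed
qed

text \<open>For even \<open>b\<close> the value is \<open>b + 1\<close>; for odd \<open>b\<close> it
  is \<open>b\<close> plus twice the squared unpaired cosine.\<close>

lemma dirichlet_kernel_diagonal: "\<bar>dirichlet_kernel b x x - real b\<bar> \<le> 2"
proof (cases b rule: parity_cases)
  case even
  then obtain m where 1: "b = 2 * m" by (elim evenE)
  from 1 show ?thesis by (simp add: dirichlet_kernel_even)
next
  case odd
  then obtain m where 2: "b = 2 * m + 1" by (elim oddE)
  have "dirichlet_kernel b x x = real b + 2 * (cos (2 * real (m + 1) * pi * x))\<^sup>2"
    unfolding 2 dirichlet_kernel_odd by (simp add: dirichlet_kernel_even power2_eq_square)
  moreover have "(cos (2 * real (m + 1) * pi * x))\<^sup>2 \<le> 1"
    by (simp add: abs_square_le_1)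
  ultimately show ?thesis by simp
qed

section \<open>Orthonormality and the reproducing property\<close>

lemma integral_cos_2pi: "integral {0..1} (\<lambda>t. cos (2 * of_int k * pi * t)) = (if k = 0 then 1 else 0)"
proof (cases "k = 0")
  case False
  have "((\<lambda>t. cos (2 * of_int k * pi * t)) has_integral
      sin (2 * of_int k * pi * 1) / (2 * of_int k * pi) - sin (2 * of_int k * pi * 0) / (2 * of_int k * pi)) {0..1}"
    by (rule fundamental_theorem_of_calculus)
       (use False in \<open>auto intro!: derivative_eq_intros simp flip: has_real_derivative_iff_has_vector_derivative\<close>)
  moreover have "sin (2 * of_int k * pi) = 0"
    using sin_integer_2pi[of "of_int k"] by (simp add: mult_ac)
  ultimately show ?thesis using False by (simp add: integral_unique)
qed simp

lemma integral_sin_2pi: "integral {0..1} (\<lambda>t. sin (2 * of_int k * pi * t)) = 0"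
proof (cases "k = 0")
  case False
  have "((\<lambda>t. sin (2 * of_int k * pi * t)) has_integral
      - cos (2 * of_int k * pi * 1) / (2 * of_int k * pi) - - cos (2 * of_int k * pi * 0) / (2 * of_int k * pi)) {0..1}"
    by (rule fundamental_theorem_of_calculus)
       (use False in \<open>auto intro!: derivative_eq_intros simp flip: has_real_derivative_iff_has_vector_derivative\<close>)
  moreover have "cos (2 * of_int k * pi) = 1"
    using cos_integer_2pi[of "of_int k"] by (simp add: mult_ac)
  ultimately show ?thesis by (simp add: integral_unique)
qed simp

lemma trig_basis_orthonormal:
  "integral {0..1} (\<lambda>t. trig_basis i t * trig_basis j t) = (if i = j then 1 else 0)"
proof -
  let ?c = "\<lambda>(m::int) t. cos (2 * of_int m * pi * t)" and ?s = "\<lambda>(m::int) t. sin (2 * of_int m * pi * t)"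
  have ci [simp]: "?c m integrable_on {0..1}" and si [simp]: "?s m integrable_on {0..1}" for m
    by (intro integrable_continuous_interval continuous_intros)+
  define cb where "cb = (\<lambda>n t. sqrt 2 * cos (2 * real n * pi * t))"
  define sb where "sb = (\<lambda>n t. sqrt 2 * sin (2 * real n * pi * t))"
  have sq: "sqrt 2 * (sqrt 2 * z) = 2 * z" for z by (simp flip: mult.assoc)
  have cc: "integral {0..1} (\<lambda>t. cb m t * cb n t) = (if m = n then 1 else 0)" if "m \<ge> 1" for m n
  proof -
    have "(\<lambda>t. cb m t * cb n t) = (\<lambda>t. ?c (int m - int n) t + ?c (int m + int n) t)"
      by (rule ext) (simp add: cb_def algebra_simps cos_add cos_diff sq)
    then show ?thesis using that
      by (simp only: integral_add[OF ci ci] integral_cos_2pi) auto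
  qed
  have ss: "integral {0..1} (\<lambda>t. sb m t * sb n t) = (if m = n then 1 else 0)" if "m \<ge> 1" for m n
  proof -
    have "(\<lambda>t. sb m t * sb n t) = (\<lambda>t. ?c (int m - int n) t - ?c (int m + int n) t)"
      by (rule ext) (simp add: sb_def algebra_simps cos_add cos_diff sq)
    then show ?thesis using that
      by (simp only: integral_diff[OF ci ci] integral_cos_2pi) auto
  qed
  have sc: "integral {0..1} (\<lambda>t. sb m t * cb n t) = 0" for m n
  proof -
    have "(\<lambda>t. sb m t * cb n t) = (\<lambda>t. ?s (int m + int n) t + ?s (int m - int n) t)"
      by (rule ext) (simp add: sb_def cb_def algebra_simps sin_add sin_diff sq)
    then show ?thesis
      by (simp only: integral_add[OF si si] integral_sin_2pi add_0_left)
  qed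
  have cs: "integral {0..1} (\<lambda>t. cb n t * sb m t) = 0" for m n
    using sc[of m n] by (simp add: mult.commute)
  have c1: "integral {0..1} (cb n) = 0" if "n \<ge> 1" for n
    using integral_cos_2pi[of "int n"] that by (simp add: cb_def)
  have s1: "integral {0..1} (sb n) = 0" for n
    using integral_sin_2pi[of "int n"] by (simp add: sb_def)
  \<comment> \<open>The half index \<open>m\<close> with the type (cosine or sine) encodes the
    index; modes of different type have indices of different parity.\<close>
  have rep: "j = 0 \<and> trig_basis j = (\<lambda>_. 1) \<or>
      (\<exists>m\<ge>1. j = 2 * m - 1 \<and> trig_basis j = cb m) \<or> (\<exists>m\<ge>1. j = 2 * m \<and> trig_basis j = sb m)" for j
  proof (cases "j = 0")
    case False
    show ?thesis
    proof (cases "odd j")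
      case True
      with False have "(j + 1) div 2 \<ge> 1" "j = 2 * ((j + 1) div 2) - 1" "trig_basis j = cb ((j + 1) div 2)"
        by (auto simp: trig_basis_def cb_def fun_eq_iff elim!: oddE)
      then show ?thesis by blast
    next
      case ev: False
      with False have "j div 2 \<ge> 1" "j = 2 * (j div 2)" "trig_basis j = sb (j div 2)"
        by (auto simp: trig_basis_def sb_def fun_eq_iff elim!: evenE)
      then show ?thesis by blast
    qed
  qed (auto simp: trig_basis_def)
  show ?thesis
    using rep[of i] rep[of j]
  proof (elim disjE exE conjE)
    fix m n assume "m \<ge> 1" "n \<ge> 1" "i = 2 * m - 1" "j = 2 * n" "trig_basis i = cb m" "trig_basis j = sb n"
    then show ?thesis using cs[of m n] by simp presburger
  next
    fix m n assume "m \<ge> 1" "n \<ge> 1" "i = 2 * m" "j = 2 * n - 1" "trig_basis i = sb m" "trig_basis j = cb n"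
    then show ?thesis using sc[of m n] by simp presburger
  next
    fix m n assume "m \<ge> 1" "n \<ge> 1" "i = 2 * m - 1" "j = 2 * n - 1" "trig_basis i = cb m" "trig_basis j = cb n"
    moreover from this have "m = n \<longleftrightarrow> i = j" by linarith
    ultimately show ?thesis using cc[of m n] by simp
  next
    fix m n assume "m \<ge> 1" "n \<ge> 1" "i = 2 * m" "j = 2 * n" "trig_basis i = sb m" "trig_basis j = sb n"
    then show ?thesis using ss[of m n] by simp
  qed (simp_all add: c1 s1)
qed

text \<open>Orthonormality makes the kernel reproducing. This turns the integral of a squared
  combination of kernels into a quadratic form in kernel values, from which the limit covariance is
  read off.\<close>

lemma integral_dirichlet_kernel_mult:
  "integral {0..1} (\<lambda>t. dirichlet_kernel b x t * dirichlet_kernel b y t) = dirichlet_kernel b x y"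
proof -
  have "integral {0..1} (\<lambda>t. dirichlet_kernel b x t * dirichlet_kernel b y t)
     = integral {0..1} (\<lambda>t. \<Sum>i=0..b. \<Sum>j=0..b. trig_basis i x * trig_basis j y * (trig_basis i t * trig_basis j t))"
    by (simp add: dirichlet_kernel_def sum_product mult_ac)
  also have "\<dots> = (\<Sum>i=0..b. \<Sum>j=0..b. trig_basis i x * trig_basis j y * (if i = j then 1 else 0))"
    by (subst integral_sum integral_mult_right trig_basis_orthonormal
          | simp only: finite_atLeastAtMost
          | intro sum.cong refl integrable_continuous_interval continuous_intros)+
  also have "\<dots> = dirichlet_kernel b x y"
    by (simp add: dirichlet_kernel_def if_distrib cong: if_cong)
  finally show ?thesis .
qed

section \<open>Logarithmic bound for the Lebesgue constant\<close>

lemma integral_inverse_abs_le: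
  fixes a \<epsilon> :: real
  assumes "\<epsilon> > 0" "a \<in> {-1..2}"
  shows "integral {0..1} (\<lambda>t. 1 / (\<epsilon> + \<bar>t - a\<bar>)) \<le> 2 * ln (1 + 2 / \<epsilon>)"
proof -
  \<comment> \<open>The primitives on either side of the kink \<open>a\<close>, glued continuously
    with value 0 there; the derivative is checked away from \<open>a\<close> only, which the
    interior form of the fundamental theorem permits. As \<open>a\<close> lies in
    \<open>{-1..2}\<close>, no distance \<open>\<bar>t - a\<bar>\<close> exceeds 2, whence
    \<open>2 / \<epsilon>\<close>.\<close>
  define F where "F = (\<lambda>t. if t \<le> a then - ln (1 + (a - t) / \<epsilon>) else ln (1 + (t - a) / \<epsilon>))"
  have pos: "1 + u / \<epsilon> > 0" if "u \<ge> 0" for u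
    using that assms by (simp add: add_pos_nonneg)
  have pos': "1 + u / \<epsilon> \<noteq> 0" if "u \<ge> 0" for u
    using pos[OF that] by simp
  have cF: "continuous_on {0..1} F"
  proof -
    have "continuous_on ({0..1} \<inter> {..a} \<union> {0..1} \<inter> {a..}) F"
      unfolding F_def
      by (rule continuous_on_If)
         (use assms pos' in \<open>auto intro!: continuous_intros closed_Int\<close>)
    moreover have "{0..1} \<inter> {..a} \<union> {0..1} \<inter> {a..} = {0..1}" by auto
    ultimately show ?thesis by simp
  qed
  have dF: "(F has_vector_derivative 1 / (\<epsilon> + \<bar>t - a\<bar>)) (at t)" if "t \<noteq> a" for t
  proof (cases "t < a")
    case True
    have "((\<lambda>t. - ln (1 + (a - t) / \<epsilon>)) has_real_derivative 1 / (\<epsilon> + \<bar>t - a\<bar>)) (at t)"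
      using True pos[of "a - t"] assms by (auto intro!: derivative_eq_intros simp: field_simps)
    moreover have "eventually (\<lambda>t. - ln (1 + (a - t) / \<epsilon>) = F t) (nhds t)"
      using eventually_nhds_in_open[of "{..<a}" t] True by (auto simp: F_def elim!: eventually_mono)
    ultimately have "(F has_real_derivative 1 / (\<epsilon> + \<bar>t - a\<bar>)) (at t)"
      by (subst (asm) DERIV_cong_ev) auto
    then show ?thesis by (simp add: has_real_derivative_iff_has_vector_derivative)
  next
    case False
    with that have "t > a" by simp
    then have "((\<lambda>t. ln (1 + (t - a) / \<epsilon>)) has_real_derivative 1 / (\<epsilon> + \<bar>t - a\<bar>)) (at t)"
      using pos[of "t - a"] assms by (auto intro!: derivative_eq_intros simp: field_simps)
    moreover have "eventually (\<lambda>t. ln (1 + (t - a) / \<epsilon>) = F t) (nhds t)"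
      using eventually_nhds_in_open[of "{a<..}" t] \<open>t > a\<close> by (auto simp: F_def elim!: eventually_mono)
    ultimately have "(F has_real_derivative 1 / (\<epsilon> + \<bar>t - a\<bar>)) (at t)"
      by (subst (asm) DERIV_cong_ev) auto
    then show ?thesis by (simp add: has_real_derivative_iff_has_vector_derivative)
  qed
  have "((\<lambda>t. 1 / (\<epsilon> + \<bar>t - a\<bar>)) has_integral F 1 - F 0) {0..1}"
    by (rule fundamental_theorem_of_calculus_interior_strong[of "{a}"]) (use cF dF in auto)
  then have "integral {0..1} (\<lambda>t. 1 / (\<epsilon> + \<bar>t - a\<bar>)) = F 1 - F 0"
    by (rule integral_unique)
  moreover have "F 1 \<le> ln (1 + 2 / \<epsilon>)"
  proof -
    have "- ln (1 + (a - 1) / \<epsilon>) \<le> 0" if "1 \<le> a" using that assms by simp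
    moreover have "0 \<le> ln (1 + 2 / \<epsilon>)" using assms by simp
    moreover have "ln (1 + (1 - a) / \<epsilon>) \<le> ln (1 + 2 / \<epsilon>)" if "a < 1"
      using that assms pos[of "1 - a"] by (intro ln_mono) (auto simp: divide_right_mono)
    ultimately show ?thesis by (auto simp: F_def)
  qed
  moreover have "- F 0 \<le> ln (1 + 2 / \<epsilon>)"
  proof -
    have "- ln (1 + (0 - a) / \<epsilon>) \<le> 0" if "a < 0" using that assms by (simp add: field_simps)
    moreover have "0 \<le> ln (1 + 2 / \<epsilon>)" using assms by simp
    moreover have "ln (1 + (a - 0) / \<epsilon>) \<le> ln (1 + 2 / \<epsilon>)" if "0 \<le> a"
      using that assms pos[of "a"] by (intro ln_mono) (auto simp: divide_right_mono)
    ultimately show ?thesis by (auto simp: F_def)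
  qed
  ultimately show ?thesis by simp
qed

text \<open>Jordan's inequality: the sine is concave on \<open>{0..pi/2}\<close> and lies above its
  chord.\<close>

lemma abs_sin_pi_ge: "\<bar>s\<bar> \<le> 1 / 2 \<Longrightarrow> 2 * \<bar>s\<bar> \<le> \<bar>sin (pi * s)\<bar>"
proof -
  assume s: "\<bar>s\<bar> \<le> 1 / 2"
  have "convex_on {0..pi/2} (\<lambda>x. - sin x)"
    by (rule convex_on_realI[where f' = "\<lambda>x. - cos x"])
       (auto intro!: derivative_eq_intros cos_monotone_0_pi_le)
  then have "- sin ((1 - 2 * \<bar>s\<bar>) *\<^sub>R 0 + (2 * \<bar>s\<bar>) *\<^sub>R (pi / 2))
      \<le> (1 - 2 * \<bar>s\<bar>) * - sin 0 + (2 * \<bar>s\<bar>) * - sin (pi / 2)"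
    by (rule convex_onD) (use s in auto)
  then have "2 * \<bar>s\<bar> \<le> sin (pi * \<bar>s\<bar>)" by (simp add: mult.commute)
  also have "\<dots> \<le> \<bar>sin (pi * s)\<bar>"
    by (cases "s \<ge> 0") auto
  finally show ?thesis .
qed

text \<open>\<open>s\<close> is the offset \<open>x - t\<close> reduced modulo 1. For
  \<open>\<bar>s\<bar>\<close> up to \<open>1 / (b + 1)\<close> the trivial bound
  \<open>2 * (b + 1)\<close> is used, beyond it the decay estimate with Jordan's inequality; the
  constant 4 puts both under one function that is easy to integrate.\<close>

lemma dirichlet_kernel_le_near:
  assumes "\<bar>s\<bar> \<le> 1 / 2" and "\<bar>sin (pi * (x - t))\<bar> = \<bar>sin (pi * s)\<bar>"
  shows "\<bar>dirichlet_kernel b x t\<bar> \<le> 4 / (1 / (real b + 1) + \<bar>s\<bar>)"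
proof (cases "\<bar>s\<bar> \<le> 1 / (real b + 1)")
  case True
  have "2 * (real b + 1) * (1 / (real b + 1) + \<bar>s\<bar>) \<le> 2 * (real b + 1) * (1 / (real b + 1) + 1 / (real b + 1))"
    using True by (intro mult_left_mono) auto
  also have "\<dots> = 4" by (simp add: field_simps)
  finally have "2 * (real b + 1) * (1 / (real b + 1) + \<bar>s\<bar>) \<le> 4" .
  moreover have "\<bar>dirichlet_kernel b x t\<bar> * (1 / (real b + 1) + \<bar>s\<bar>)
      \<le> 2 * (real b + 1) * (1 / (real b + 1) + \<bar>s\<bar>)"
    by (intro mult_right_mono abs_dirichlet_kernel_le) auto
  ultimately show ?thesis
    by (subst pos_le_divide_eq) (auto intro!: add_pos_nonneg)
next
  case False
  define K where "K = \<bar>dirichlet_kernel b x t\<bar>"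
  have "2 * \<bar>s\<bar> * K \<le> \<bar>sin (pi * s)\<bar> * K"
    using abs_sin_pi_ge[OF assms(1)] by (intro mult_right_mono) (auto simp: K_def)
  also have "\<dots> \<le> 3" using dirichlet_kernel_decay[of x t b] by (simp add: K_def assms(2))
  finally have 1: "2 * \<bar>s\<bar> * K \<le> 3" .
  have "K * (1 / (real b + 1)) \<le> K * \<bar>s\<bar>"
    using False by (intro mult_left_mono) (auto simp: K_def)
  with 1 have "K * (1 / (real b + 1) + \<bar>s\<bar>) \<le> 4" by (simp add: distrib_left mult_ac)
  then show ?thesis unfolding K_def[symmetric]
    by (subst pos_le_divide_eq) (auto intro!: add_pos_nonneg)
qed

text \<open>The translates \<open>x\<close>, \<open>x - 1\<close> and \<open>x + 1\<close> cover the
  offset modulo 1. The constant 72 is 4 from the pointwise bound, times 3 translates, times 2 from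
  each integral, times 3 from \<open>ln (2 * b + 3) \<le> 3 * ln b\<close>.\<close>

lemma integral_abs_dirichlet_kernel:
  assumes "b \<ge> 2" "x \<in> {0..1}"
  shows "integral {0..1} (\<lambda>t. \<bar>dirichlet_kernel b x t\<bar>) \<le> 72 * ln (real b)"
proof -
  define \<epsilon> where "\<epsilon> = 1 / (real b + 1)"
  have \<epsilon>: "\<epsilon> > 0" by (simp add: \<epsilon>_def)
  define h where "h = (\<lambda>a t. 1 / (\<epsilon> + \<bar>t - a\<bar>))"
  have hi: "h a integrable_on {0..1}" for a
    unfolding h_def using \<epsilon>
    by (intro integrable_continuous_interval continuous_intros) (smt (verit) abs_ge_zero)
  have h0: "h a t \<ge> 0" for a t using \<epsilon> by (simp add: h_def)
  have "\<bar>dirichlet_kernel b x t\<bar> \<le> 4 * (h x t + h (x - 1) t + h (x + 1) t)" if t: "t \<in> {0..1}" for t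
  proof -
    consider "\<bar>x - t\<bar> \<le> 1 / 2" | "x - t > 1 / 2" | "x - t < - 1 / 2" by linarith
    then have "\<bar>dirichlet_kernel b x t\<bar> \<le> 4 * h x t \<or> \<bar>dirichlet_kernel b x t\<bar> \<le> 4 * h (x - 1) t
        \<or> \<bar>dirichlet_kernel b x t\<bar> \<le> 4 * h (x + 1) t"
    proof cases
      case 1
      then show ?thesis using dirichlet_kernel_le_near[of "x - t" x t b]
        by (simp add: h_def \<epsilon>_def abs_minus_commute)
    next
      case 2
      have "sin (pi * (x - t - 1)) = - sin (pi * (x - t))"
        by (simp add: right_diff_distrib sin_diff cos_diff)
      then have "\<bar>dirichlet_kernel b x t\<bar> \<le> 4 / (1 / (real b + 1) + \<bar>x - t - 1\<bar>)"
        using 2 assms(2) t by (intro dirichlet_kernel_le_near) auto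
      also have "\<bar>x - t - 1\<bar> = \<bar>t - (x - 1)\<bar>" by linarith
      finally show ?thesis by (simp add: h_def \<epsilon>_def)
    next
      case 3
      have "sin (pi * (x - t + 1)) = - sin (pi * (x - t))"
        by (simp add: right_diff_distrib distrib_left sin_diff cos_diff sin_add)
      then have "\<bar>dirichlet_kernel b x t\<bar> \<le> 4 / (1 / (real b + 1) + \<bar>x - t + 1\<bar>)"
        using 3 assms(2) t by (intro dirichlet_kernel_le_near) auto
      also have "\<bar>x - t + 1\<bar> = \<bar>t - (x + 1)\<bar>" by linarith
      finally show ?thesis by (simp add: h_def \<epsilon>_def)
    qed
    then show ?thesis using h0[of x t] h0[of "x-1" t] h0[of "x+1" t] unfolding distrib_left by linarith
  qed
  moreover have "(\<lambda>t. \<bar>dirichlet_kernel b x t\<bar>) integrable_on {0..1}"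
    by (intro integrable_continuous_interval continuous_intros)
  ultimately have "integral {0..1} (\<lambda>t. \<bar>dirichlet_kernel b x t\<bar>)
      \<le> integral {0..1} (\<lambda>t. 4 * (h x t + h (x - 1) t + h (x + 1) t))"
    by (intro integral_le) (auto intro!: integrable_add hi simp: distrib_left)
  also have "\<dots> = 4 * (integral {0..1} (h x) + integral {0..1} (h (x - 1)) + integral {0..1} (h (x + 1)))"
    using hi by (simp add: integral_add integrable_add)
  also have "\<dots> \<le> 4 * (2 * ln (1 + 2 / \<epsilon>) + 2 * ln (1 + 2 / \<epsilon>) + 2 * ln (1 + 2 / \<epsilon>))"
    unfolding h_def using assms(2) \<epsilon> by (intro mult_left_mono add_mono integral_inverse_abs_le) auto
  also have "\<dots> = 24 * ln (2 * real b + 3)"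
    by (simp add: \<epsilon>_def algebra_simps)
  also have "ln (2 * real b + 3) \<le> ln (real b ^ 3)"
  proof (rule ln_mono)
    have "real b * 4 \<le> real b * (real b)\<^sup>2"
      using assms(1) power_mono[of 2 "real b" 2] by (intro mult_left_mono) auto
    then have "real b * 4 \<le> real b ^ 3" by (simp add: power2_eq_square power3_eq_cube)
    \<comment> \<open>For \<open>b = 2\<close> this reads \<open>7 \<le> 8\<close>; from 3 on,
      \<open>4 * b\<close> is already at least the left side.\<close>
    show "2 * real b + 3 \<le> real b ^ 3"
    proof (cases "b = 2")
      case False
      with assms(1) have "real b \<ge> 3" by linarith
      with \<open>real b * 4 \<le> real b ^ 3\<close> show ?thesis by linarith
    qed simp
  qed auto
  also have "ln (real b ^ 3) = 3 * ln (real b)"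
    using assms(1) by (simp add: ln_realpow)
  finally show ?thesis by simp
qed

section \<open>Fourier approximation of periodic functions of class C^2\<close>

lemma abs_integral_unit_interval_le:
  fixes g :: "real \<Rightarrow> real"
  assumes "continuous_on {0..1} g" "\<And>t. t \<in> {0..1} \<Longrightarrow> \<bar>g t\<bar> \<le> B"
  shows "\<bar>integral {0..1} g\<bar> \<le> B"
  using integral_bound[of 0 1 g B] assms by simp

text \<open>For a polynomial one integration by parts gains a factor \<open>1 / w\<close>; a
  continuous function is uniformly close to a polynomial, and the sine is bounded by 1.\<close>

lemma Riemann_Lebesgue_sin:
  fixes \<psi> :: "real \<Rightarrow> real"
  assumes "continuous_on {0..1} \<psi>" and \<omega>: "filterlim \<omega> at_top F"
  shows "((\<lambda>n. integral {0..1} (\<lambda>t. \<psi> t * sin (\<omega> n * (x - t)))) \<longlongrightarrow> 0) F"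
proof (rule tendstoI)
  fix e :: real assume e: "e > 0"
  obtain p where p: "real_polynomial_function p" "\<And>t. t \<in> {0..1} \<Longrightarrow> \<bar>\<psi> t - p t\<bar> < e / 2"
    using Stone_Weierstrass_real_polynomial_function[of "{0..1}" \<psi> "e / 2"] assms(1) e by auto
  obtain p' where p': "real_polynomial_function p'" "\<And>t. (p has_real_derivative p' t) (at t)"
    using has_real_derivative_polynomial_function[OF p(1)] by blast
  have cp: "continuous_on S p" and cp': "continuous_on S p'" for S
    using p(1) p'(1) continuous_on_polymonial_function real_polynomial_function_eq by metis+
  obtain B where B: "\<And>t. t \<in> {0..1} \<Longrightarrow> \<bar>p' t\<bar> \<le> B"
    using compact_continuous_image[OF cp', of "{0..1}"] compact_imp_bounded bounded_real
    by (metis compact_Icc imageI)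
  define C where "C = \<bar>p 0\<bar> + \<bar>p 1\<bar> + B"
  have "B \<ge> 0" using B[of 0] by auto
  then have C: "C \<ge> 0" by (simp add: C_def)
  have bound: "\<bar>integral {0..1} (\<lambda>t. \<psi> t * sin (w * (x - t)))\<bar> \<le> e / 2 + C / w" if w: "w > 0" for w
  proof -
    have cont: "continuous_on {0..1} (\<lambda>t. \<psi> t * sin (w * (x - t)))"
      "continuous_on {0..1} (\<lambda>t. p t * sin (w * (x - t)))"
      "continuous_on {0..1} (\<lambda>t. p' t * cos (w * (x - t)) / w)"
      using assms(1) cp cp' w by (auto intro!: continuous_intros)
    note int = cont[THEN integrable_continuous_interval]
    have "((\<lambda>t. p t * sin (w * (x - t)) + p' t * cos (w * (x - t)) / w) has_integral
        p 1 * cos (w * (x - 1)) / w - p 0 * cos (w * (x - 0)) / w) {0..1}"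
      by (rule fundamental_theorem_of_calculus)
         (use w in \<open>auto intro!: derivative_eq_intros DERIV_subset[OF p'(2)]
           simp: add_divide_distrib simp flip: has_real_derivative_iff_has_vector_derivative\<close>)
    then have "integral {0..1} (\<lambda>t. p t * sin (w * (x - t))) + integral {0..1} (\<lambda>t. p' t * cos (w * (x - t)) / w)
        = p 1 * cos (w * (x - 1)) / w - p 0 * cos (w * (x - 0)) / w"
      using has_integral_unique has_integral_add[OF int(2,3)[THEN integrable_integral]] by blast
    moreover have "\<bar>integral {0..1} (\<lambda>t. p' t * cos (w * (x - t)) / w)\<bar> \<le> B / w"
    proof (rule abs_integral_unit_interval_le)
      fix t :: real assume "t \<in> {0..1}"
      then have "\<bar>p' t\<bar> * \<bar>cos (w * (x - t))\<bar> \<le> B * 1"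
        by (intro mult_mono B \<open>B \<ge> 0\<close>) auto
      then show "\<bar>p' t * cos (w * (x - t)) / w\<bar> \<le> B / w"
        using w by (simp add: abs_mult divide_right_mono)
    qed (use cont in auto)
    moreover have "\<bar>p 1 * cos (w * (x - 1)) / w\<bar> \<le> \<bar>p 1\<bar> / w" "\<bar>p 0 * cos (w * (x - 0)) / w\<bar> \<le> \<bar>p 0\<bar> / w"
      using w by (auto simp: abs_mult intro!: divide_right_mono mult_left_le)
    ultimately have 1: "\<bar>integral {0..1} (\<lambda>t. p t * sin (w * (x - t)))\<bar> \<le> C / w"
      unfolding C_def add_divide_distrib by linarith
    have "\<bar>integral {0..1} (\<lambda>t. \<psi> t * sin (w * (x - t)) - p t * sin (w * (x - t)))\<bar> \<le> e / 2"
    proof (rule abs_integral_unit_interval_le)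
      fix t :: real assume t: "t \<in> {0..1}"
      have "\<bar>\<psi> t - p t\<bar> * \<bar>sin (w * (x - t))\<bar> \<le> e / 2 * 1"
        using p(2)[OF t] e by (intro mult_mono) auto
      then show "\<bar>\<psi> t * sin (w * (x - t)) - p t * sin (w * (x - t))\<bar> \<le> e / 2"
        by (simp add: abs_mult flip: left_diff_distrib)
    qed (use cont in \<open>auto intro!: continuous_intros\<close>)
    with 1 integral_diff[OF int(1,2)] show ?thesis by linarith
  qed
  have "((\<lambda>n. C / \<omega> n) \<longlongrightarrow> 0) F"
    by (rule real_tendsto_divide_at_top[OF tendsto_const \<omega>])
  then have "\<forall>\<^sub>F n in F. C / \<omega> n < e / 2"
    using e by (intro order_tendstoD) auto
  moreover have "\<forall>\<^sub>F n in F. \<omega> n > 0"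
    using \<omega> by (simp add: filterlim_at_top_dense)
  ultimately show "\<forall>\<^sub>F n in F. dist (integral {0..1} (\<lambda>t. \<psi> t * sin (\<omega> n * (x - t)))) 0 < e"
  proof eventually_elim
    case (elim n)
    then show ?case using bound[of "\<omega> n"] unfolding dist_real_def diff_0_right by linarith
  qed
qed

text \<open>These are the zeros of the denominator in the closed form of the kernel. The corner
  cases stem from the period 1: in the convergence proof \<open>f 0 = f 1\<close> absorbs them, in
  the covariance limit the hypothesis on the points excludes them.\<close>

lemma sin_pi_zero_cases:
  assumes "x \<in> {0..1}" "t \<in> {0..1}" "sin (pi * (x - t)) = 0"
  shows "t = x \<or> x = 0 \<and> t = 1 \<or> x = 1 \<and> t = (0::real)"
proof -
  obtain i :: int where "x - t = of_int i"
    using assms(3) by (auto simp: sin_zero_iff_int2)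
  moreover have "\<bar>x - t\<bar> \<le> 1" using assms by auto
  ultimately have "\<bar>i\<bar> \<le> 1" by linarith
  then have "i \<in> {-1, 0, 1}" by auto
  then show ?thesis using assms \<open>x - t = of_int i\<close> by auto
qed

text \<open>The difference quotients of \<open>g\<close> and \<open>h\<close> share the denominator
  \<open>t - z\<close>, which cancels. The filter is restricted to \<open>S\<close> because
  \<open>z\<close> may be an end point of the interval.\<close>

lemma tendsto_divide_by_derivative:
  fixes g h :: "real \<Rightarrow> real"
  assumes "(g has_real_derivative a) (at z within S)" "(h has_real_derivative c) (at z within S)"
    "g z = 0" "h z = 0" "c \<noteq> 0"
  shows "((\<lambda>t. g t / h t) \<longlongrightarrow> a / c) (at z within S)"
proof -
  have "((\<lambda>t. ((g t - g z) / (t - z)) / ((h t - h z) / (t - z))) \<longlongrightarrow> a / c) (at z within S)"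
    using assms by (intro tendsto_divide) (auto simp: has_field_derivative_iff)
  moreover have "\<forall>\<^sub>F t in at z within S. ((g t - g z) / (t - z)) / ((h t - h z) / (t - z)) = g t / h t"
    using assms(3,4) by (auto simp: eventually_at_filter)
  ultimately show ?thesis by (rule Lim_transform_eventually)
qed

text \<open>Only the convergence is claimed here; the rate comes from the decay of the coefficients.\<close>

lemma dirichlet_kernel_convergence:
  assumes x: "x \<in> {0..1}"
    and f': "\<And>t. t \<in> {0..1} \<Longrightarrow> (f has_real_derivative f' t) (at t within {0..1})"
    and f01: "f 0 = f 1"
  shows "(\<lambda>m. integral {0..1} (\<lambda>t. dirichlet_kernel (2 * m) x t * f t)) \<longlonglongrightarrow> f x"
proof -
  define h where "h = (\<lambda>t. sin (pi * (x - t)))"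
  \<comment> \<open>The quotient \<open>(f t - f x) / h t\<close>, extended through the zeros of
    \<open>h\<close> by its limit. At these zeros \<open>f t = f x\<close> by periodicity, so the
    extension is continuous and the Riemann-Lebesgue lemma applies.\<close>
  define \<psi> where "\<psi> = (\<lambda>t. if h t = 0 then f' t / (- pi * cos (pi * (x - t))) else (f t - f x) / h t)"
  have cf: "continuous_on {0..1} f"
    unfolding continuous_on_eq_continuous_within using f' DERIV_continuous by blast
  have ch: "isCont h t" for t
    unfolding h_def by (intro continuous_intros)
  have fz: "f t = f x" if "t \<in> {0..1}" "h t = 0" for t
    using sin_pi_zero_cases[OF x that(1)] that(2) f01 by (auto simp: h_def)
  have dh: "(h has_real_derivative - pi * cos (pi * (x - t))) (at t within S)" for t S
    unfolding h_def by (auto intro!: derivative_eq_intros)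
  have "((\<lambda>t. \<psi> t) \<longlongrightarrow> \<psi> z) (at z within {0..1})" if z: "z \<in> {0..1}" for z
  proof (cases "h z = 0")
    case False
    have "((\<lambda>t. (f t - f x) / h t) \<longlongrightarrow> (f z - f x) / h z) (at z within {0..1})"
      using cf z False continuous_at_imp_continuous_at_within[OF ch]
      by (intro tendsto_intros) (auto simp: continuous_on_def continuous_within)
    moreover have "\<forall>\<^sub>F t in at z within {0..1}. h t \<noteq> 0"
      using continuous_at_imp_continuous_at_within[OF ch] False
      unfolding continuous_within by (rule tendsto_imp_eventually_ne)
    ultimately show ?thesis
      using False by (auto simp: \<psi>_def elim!: Lim_transform_eventually eventually_mono)
  next
    case True
    let ?c = "- pi * cos (pi * (x - z))"
    have c: "?c \<noteq> 0"
      using True sin_zero_abs_cos_one[of "pi * (x - z)"] by (auto simp: h_def)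
    have "((\<lambda>t. (f t - f x) / h t) \<longlongrightarrow> f' z / ?c) (at z within {0..1})"
      by (rule tendsto_divide_by_derivative) (use f'[OF z] dh True c fz[OF z] in \<open>auto intro!: derivative_eq_intros\<close>)
    moreover have "\<forall>\<^sub>F t in at z within {0..1}. h t \<noteq> 0"
    proof -
      have "((\<lambda>t. (h t - h z) / (t - z)) \<longlongrightarrow> ?c) (at z within {0..1})"
        using dh[of z] by (simp add: has_field_derivative_iff)
      from tendsto_imp_eventually_ne[OF this c] show ?thesis
        by eventually_elim (use True in auto)
    qed
    ultimately show ?thesis
      using True by (auto simp: \<psi>_def elim!: Lim_transform_eventually eventually_mono)
  qed
  then have c\<psi>: "continuous_on {0..1} \<psi>"
    by (simp add: continuous_on_def)
  have int1: "integral {0..1} (dirichlet_kernel b x) = 1" for b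
  proof -
    have "integral {0..1} (dirichlet_kernel b x)
        = integral {0..1} (\<lambda>t. \<Sum>j=0..b. trig_basis j x * (trig_basis 0 t * trig_basis j t))"
      by (intro Henstock_Kurzweil_Integration.integral_cong)
        (simp add: dirichlet_kernel_def trig_basis_def[of 0])
    also have "\<dots> = (\<Sum>j=0..b. trig_basis j x * (if 0 = j then 1 else 0))"
      by (subst integral_sum integral_mult_right trig_basis_orthonormal
          | simp only: finite_atLeastAtMost
          | intro sum.cong refl integrable_continuous_interval continuous_intros)+
    also have "\<dots> = (\<Sum>j=0..b. if 0 = j then trig_basis j x else 0)"
      by (intro sum.cong) auto
    also have "\<dots> = 1"
      unfolding sum.delta'[OF finite_atLeastAtMost] by (simp add: trig_basis_def)
    finally show ?thesis .
  qed
  \<comment> \<open>The kernel integrates to 1, which splits off \<open>f x\<close>. What remains is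
    \<open>\<psi>\<close> times \<open>h\<close> times the kernel, and the last two multiply to a
    pure sine.\<close>
  have eq: "integral {0..1} (\<lambda>t. dirichlet_kernel (2 * m) x t * f t)
      = f x + integral {0..1} (\<lambda>t. \<psi> t * sin ((2 * real m + 1) * pi * (x - t)))" for m
  proof -
    have "integral {0..1} (\<lambda>t. dirichlet_kernel (2 * m) x t * f t)
        = integral {0..1} (\<lambda>t. dirichlet_kernel (2 * m) x t * f x + \<psi> t * sin ((2 * real m + 1) * pi * (x - t)))"
    proof (rule Henstock_Kurzweil_Integration.integral_cong)
      fix t :: real assume t: "t \<in> {0..1}"
      have s: "sin ((2 * real m + 1) * pi * (x - t)) = h t * dirichlet_kernel (2 * m) x t"
        by (simp add: h_def sin_mult_dirichlet_kernel_even)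
      show "dirichlet_kernel (2 * m) x t * f t =
          dirichlet_kernel (2 * m) x t * f x + \<psi> t * sin ((2 * real m + 1) * pi * (x - t))"
        unfolding s by (cases "h t = 0") (auto simp: fz[OF t] \<psi>_def field_simps)
    qed
    also have "\<dots> = integral {0..1} (\<lambda>t. dirichlet_kernel (2 * m) x t * f x)
        + integral {0..1} (\<lambda>t. \<psi> t * sin ((2 * real m + 1) * pi * (x - t)))"
      by (intro integral_add integrable_continuous_interval continuous_intros c\<psi>)
    finally show ?thesis by (simp add: int1)
  qed
  have "filterlim (\<lambda>m. (2 * real m + 1) * pi) at_top sequentially"
    by real_asymp
  from Riemann_Lebesgue_sin[OF c\<psi> this, of x] show ?thesis
    unfolding eq by (auto intro!: tendsto_eq_intros)
qed

text \<open>Two integrations by parts. The boundary terms cancel because \<open>f\<close> and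
  \<open>f'\<close> take equal values at 0 and 1 and the frequency is a multiple of
  \<open>2 * pi\<close>.\<close>

lemma cos_coefficient_bound:
  fixes f f' f'' :: "real \<Rightarrow> real"
  assumes f': "\<And>t. t \<in> {0..1} \<Longrightarrow> (f has_real_derivative f' t) (at t within {0..1})"
    and f'': "\<And>t. t \<in> {0..1} \<Longrightarrow> (f' has_real_derivative f'' t) (at t within {0..1})"
    and cont: "continuous_on {0..1} f''" and B: "\<And>t. t \<in> {0..1} \<Longrightarrow> \<bar>f'' t\<bar> \<le> B"
    and per: "f 0 = f 1" "f' 0 = f' 1" and i: "i \<ge> 1"
  shows "\<bar>integral {0..1} (\<lambda>t. cos (2 * real i * pi * (x - t)) * f t)\<bar> \<le> B / (2 * real i * pi)\<^sup>2"
proof -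
  define w where "w = 2 * real i * pi"
  have w: "w > 0" using i by (simp add: w_def)
  have cf: "continuous_on {0..1} f"
    unfolding continuous_on_eq_continuous_within using f' DERIV_continuous by blast
  have "cos w = 1" "sin w = 0"
    using cos_int_2pin[of "int i"] sin_int_2pin[of "int i"] by (simp_all add: w_def mult_ac)
  then have w1: "sin (w * (x - 1)) = sin (w * (x - 0))" "cos (w * (x - 1)) = cos (w * (x - 0))"
    by (simp_all add: right_diff_distrib sin_diff cos_diff)
  \<comment> \<open>A primitive that performs both integrations by parts at once: the two terms
    containing \<open>f'\<close> cancel.\<close>
  let ?G = "\<lambda>t. - sin (w * (x - t)) * f t / w + cos (w * (x - t)) * f' t / w\<^sup>2"
  have "((\<lambda>t. cos (w * (x - t)) * f t + cos (w * (x - t)) * f'' t / w\<^sup>2) has_integral ?G 1 - ?G 0) {0..1}"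
    by (rule fundamental_theorem_of_calculus)
       (use w f' f'' in \<open>auto intro!: derivative_eq_intros simp: field_simps power2_eq_square
           simp flip: has_real_derivative_iff_has_vector_derivative\<close>)
  also have "?G 1 - ?G 0 = 0" using per by (simp only: w1)
  finally have G: "((\<lambda>t. cos (w * (x - t)) * f t + cos (w * (x - t)) * f'' t / w\<^sup>2) has_integral 0) {0..1}" .
  have c2: "continuous_on {0..1} (\<lambda>t. cos (w * (x - t)) * f t)"
    "continuous_on {0..1} (\<lambda>t. cos (w * (x - t)) * f'' t / w\<^sup>2)"
    using cf cont w by (auto intro!: continuous_intros)
  have "integral {0..1} (\<lambda>t. cos (w * (x - t)) * f t)
      = - integral {0..1} (\<lambda>t. cos (w * (x - t)) * f'' t / w\<^sup>2)"
    using integral_unique[OF G] integral_add[OF c2[THEN integrable_continuous_interval]] by linarith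
  moreover have "\<bar>integral {0..1} (\<lambda>t. cos (w * (x - t)) * f'' t / w\<^sup>2)\<bar> \<le> B / w\<^sup>2"
  proof (rule abs_integral_unit_interval_le)
    fix t :: real assume "t \<in> {0..1}"
    then have "\<bar>cos (w * (x - t))\<bar> * \<bar>f'' t\<bar> \<le> 1 * B"
      by (intro mult_mono B) auto
    then show "\<bar>cos (w * (x - t)) * f'' t / w\<^sup>2\<bar> \<le> B / w\<^sup>2"
      using w by (simp add: abs_mult divide_right_mono)
  qed (use c2 in auto)
  ultimately show ?thesis by (simp add: w_def)
qed

text \<open>At even cutoffs \<open>2 * m\<close> consecutive values differ by
  \<open>O(1 / m^2)\<close>, so the distance to the limit is \<open>O(1 / m)\<close>; the limit
  itself is \<open>dirichlet_kernel_convergence\<close>. An unpaired cosine costs one more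
  coefficient.\<close>

lemma dirichlet_kernel_approximation:
  fixes f f' f'' :: "real \<Rightarrow> real"
  assumes f': "\<And>t. t \<in> {0..1} \<Longrightarrow> (f has_real_derivative f' t) (at t within {0..1})"
    and f'': "\<And>t. t \<in> {0..1} \<Longrightarrow> (f' has_real_derivative f'' t) (at t within {0..1})"
    and cont: "continuous_on {0..1} f''" and B: "\<And>t. t \<in> {0..1} \<Longrightarrow> \<bar>f'' t\<bar> \<le> B"
    and per: "f 0 = f 1" "f' 0 = f' 1" and x: "x \<in> {0..1}" and b: "b \<ge> 2"
  shows "\<bar>integral {0..1} (\<lambda>t. dirichlet_kernel b x t * f t) - f x\<bar> \<le> 6 * B / real b"
proof -
  define S where "S = (\<lambda>m. integral {0..1} (\<lambda>t. dirichlet_kernel (2 * m) x t * f t))"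
  have B0: "B \<ge> 0" using B[of 0] by auto
  have cf: "continuous_on {0..1} f"
    unfolding continuous_on_eq_continuous_within using f' DERIV_continuous by blast
  have int_ker: "(\<lambda>t. dirichlet_kernel k x t * f t) integrable_on {0..1}" for k
    by (intro integrable_continuous_interval continuous_on_mult continuous_on_dirichlet_kernel cf)
  have int_cos: "(\<lambda>t. a * (cos (2 * real (m + 1) * pi * (y - t)) * f t)) integrable_on {0..1}" for a y m
    by (intro integrable_continuous_interval continuous_on_mult continuous_on_cos continuous_on_diff continuous_on_id continuous_on_const cf)
  have half: "z / 2 \<le> z" if "z \<ge> 0" for z :: real
    using that by simp
  note coeff = cos_coefficient_bound[OF f' f'' cont B per]
  have small: "2 * \<bar>integral {0..1} (\<lambda>t. cos (2 * real (m + 1) * pi * (y - t)) * f t)\<bar> \<le> B / real (m + 1) ^ 2" for m y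
  proof -
    have "2 * \<bar>integral {0..1} (\<lambda>t. cos (2 * real (m + 1) * pi * (y - t)) * f t)\<bar>
        \<le> 2 * (B / (2 * real (m + 1) * pi)\<^sup>2)"
      by (intro mult_left_mono coeff) auto
    also have "\<dots> \<le> 2 * (B / (2 * real (m + 1) * 1)\<^sup>2)"
      using pi_gt3 B0 by (intro mult_left_mono divide_left_mono power_mono) auto
    also have "\<dots> = B / real (m + 1) ^ 2 / 2"
      by (simp only: power_mult_distrib) simp
    also have "\<dots> \<le> B / real (m + 1) ^ 2"
      using half[OF divide_nonneg_nonneg[OF B0 zero_le_power2]] .
    finally show ?thesis .
  qed
  have step: "\<bar>S (m + 1) - S m\<bar> \<le> B / real (m + 1) ^ 2" for m
  proof -
    have "S (m + 1) = integral {0..1} (\<lambda>t. dirichlet_kernel (2 * m) x t * f t + 2 * (cos (2 * real (m + 1) * pi * (x - t)) * f t))"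
      unfolding S_def dirichlet_kernel_even by (simp add: distrib_left distrib_right add.assoc mult.assoc)
    also have "\<dots> = S m + 2 * integral {0..1} (\<lambda>t. cos (2 * real (m + 1) * pi * (x - t)) * f t)"
      unfolding S_def integral_add[OF int_ker int_cos] by (simp only: integral_mult_right)
    finally have "\<bar>S (m + 1) - S m\<bar> = 2 * \<bar>integral {0..1} (\<lambda>t. cos (2 * real (m + 1) * pi * (x - t)) * f t)\<bar>"
      by (simp only: add_diff_cancel_left' abs_mult abs_numeral)
    with small[of m x] show ?thesis by (simp only:)
  qed
  have tail: "\<bar>S (m + k) - S m\<bar> \<le> B * (1 / real m - 1 / real (m + k))" if "m \<ge> 1" for m k
  proof (induction k)
    case (Suc k)
    \<comment> \<open>Replacing the square by the product of consecutive integers makes the sum of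
      the bounds telescope.\<close>
    have "B / real (m + k + 1) ^ 2 \<le> B / (real (m + k) * real (m + k + 1))"
      using B0 that by (intro divide_left_mono) (auto simp: power2_eq_square)
    also have "\<dots> = B * (1 / real (m + k) - 1 / real (m + k + 1))"
      using that by (simp add: field_simps)
    finally have "\<bar>S (m + k + 1) - S (m + k)\<bar> \<le> B * (1 / real (m + k) - 1 / real (m + k + 1))"
      using step[of "m + k"] by linarith
    with Suc.IH have "\<bar>S (m + k + 1) - S m\<bar> \<le> B * (1 / real m - 1 / real (m + k)) + B * (1 / real (m + k) - 1 / real (m + k + 1))"
      by linarith
    then show ?case by (simp add: algebra_simps)
  qed simp
  have even: "\<bar>S m - f x\<bar> \<le> B / real m" if "m \<ge> 1" for m
  proof -
    have "(\<lambda>k. \<bar>S (k + m) - S m\<bar>) \<longlonglongrightarrow> \<bar>f x - S m\<bar>"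
      using dirichlet_kernel_convergence[OF x f' per(1), THEN LIMSEQ_ignore_initial_segment, of m]
      unfolding S_def by (intro tendsto_intros) auto
    moreover have "\<bar>S (k + m) - S m\<bar> \<le> B / real m" for k
    proof -
      have "B * (1 / real m - 1 / real (m + k)) \<le> B * (1 / real m)"
        using B0 by (intro mult_left_mono) auto
      with tail[OF that, of k] show ?thesis by (simp add: add.commute)
    qed
    ultimately have "\<bar>f x - S m\<bar> \<le> B / real m"
      by (intro LIMSEQ_le_const2) auto
    then show ?thesis by (simp add: abs_minus_commute)
  qed
  \<comment> \<open>Here \<open>b \<le> 3 * m\<close>, with equality at \<open>b = 3\<close>. Each
    of the two contributions \<open>B / m\<close> becomes \<open>3 * B / b\<close>, hence the
    constant 6.\<close>
  define m where "m = b div 2"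
  have "b \<le> 3 * m" "m \<ge> 1" using b by (simp_all add: m_def)
  then have m: "m \<ge> 1" "real b \<le> 3 * real m" by linarith+
  have "3 * B / (3 * real m) \<le> 3 * B / real b"
    using m B0 b by (intro divide_left_mono) auto
  then have "B / real m \<le> 3 * B / real b" by simp
  moreover have "B / real (m + 1) ^ 2 \<le> B / real m"
  proof (rule divide_left_mono)
    have "real m * 1 \<le> (real m + 1) * (real m + 1)" by (intro mult_mono) auto
    then show "real m \<le> real (m + 1) ^ 2" by (simp add: power2_eq_square add.commute)
  qed (use m B0 in auto)
  moreover have "\<bar>integral {0..1} (\<lambda>t. dirichlet_kernel b x t * f t) - S m\<bar> \<le> B / real (m + 1) ^ 2"
  proof (cases "even b")
    case True
    then show ?thesis using B0 by (simp add: S_def m_def)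
  next
    case False
    \<comment> \<open>The unpaired cosine is read as a cosine of \<open>0 - t\<close>, so that the
      bound \<open>small\<close> for shifted cosines applies at the shift 0.\<close>
    let ?c = "\<lambda>t. cos (2 * real (m + 1) * pi * t)"
    have c0: "?c (0 - t) = ?c t" for t
      by (simp only: diff_0 mult_minus_right cos_minus)
    have b: "b = 2 * m + 1" using False by (simp add: m_def)
    have "integral {0..1} (\<lambda>t. dirichlet_kernel b x t * f t)
        = integral {0..1} (\<lambda>t. dirichlet_kernel (2 * m) x t * f t + 2 * ?c x * (?c (0 - t) * f t))"
      unfolding b dirichlet_kernel_odd c0 by (simp only: distrib_right mult.assoc)
    also have "\<dots> = S m + 2 * ?c x * integral {0..1} (\<lambda>t. ?c (0 - t) * f t)"
      unfolding S_def integral_add[OF int_ker int_cos] by (simp only: integral_mult_right)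
    finally have "\<bar>integral {0..1} (\<lambda>t. dirichlet_kernel b x t * f t) - S m\<bar>
        = \<bar>?c x\<bar> * (2 * \<bar>integral {0..1} (\<lambda>t. ?c (0 - t) * f t)\<bar>)"
      by (simp only: add_diff_cancel_left' abs_mult abs_numeral mult_ac)
    also have "\<dots> \<le> 1 * (B / real (m + 1) ^ 2)"
      by (intro mult_mono small abs_cos_le_one) simp_all
    finally show ?thesis by (simp only: mult_1)
  qed
  moreover note even[OF m(1)]
  ultimately show ?thesis by linarith
qed

section \<open>Multivariate continuity theorem for characteristic functions\<close>

text \<open>Lebesgue measure on \<open>real^'p\<close> is the image of a product measure over
  \<open>Basis\<close> under \<open>T\<close>, which assembles a vector from its coordinates;
  \<open>\<psi>\<close> relabels the factors from \<open>'p\<close> to \<open>Basis\<close>. The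
  general codomain serves real densities and complex exponentials alike.\<close>

lemma integral_prod_vec:
  fixes \<phi> :: "'p::finite \<Rightarrow> real \<Rightarrow> 'c::{real_normed_field,banach,second_countable_topology}"
  assumes int: "\<And>i. integrable lborel (\<phi> i)"
  shows integrable_prod_vec: "integrable lborel (\<lambda>z::real^'p. \<Prod>i\<in>UNIV. \<phi> i (z $ i))" (is ?I)
    and "(\<integral>z. (\<Prod>i\<in>UNIV. \<phi> i (z $ i)) \<partial>(lborel :: (real^'p) measure)) = (\<Prod>i\<in>UNIV. \<integral>s. \<phi> i s \<partial>lborel)" (is ?E)
proof -
  interpret P: product_sigma_finite "\<lambda>_::real^'p. lborel :: real measure" by standard
  let ?ax = "\<lambda>i::'p. axis i (1::real)"
  let ?P = "PiM (Basis :: (real^'p) set) (\<lambda>_. lborel :: real measure)"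
  define T where "T = (\<lambda>f::real^'p \<Rightarrow> real. \<Sum>b\<in>Basis. f b *\<^sub>R b)"
  define \<psi> where "\<psi> = (\<lambda>b. \<phi> (inv ?ax b))"
  have inj: "inj ?ax" by (auto simp: inj_on_def axis_eq_axis)
  have Basis: "Basis = range ?ax" by (auto simp: Basis_vec_def)
  have L: "lborel = distr ?P borel T"
    unfolding T_def lborel_eq_real by (rule lborel_def)
  have T: "T \<in> measurable ?P lborel"
    unfolding T_def by measurable
  have \<phi>m [measurable]: "\<phi> i \<in> borel_measurable borel" for i
    using borel_measurable_integrable[OF int[of i]] by simp
  have nth [measurable]: "(\<lambda>z::real^'p. z $ i) \<in> borel_measurable borel" for i
    by (intro borel_measurable_continuous_onI continuous_intros)
  have m: "(\<lambda>z::real^'p. \<Prod>i\<in>UNIV. \<phi> i (z $ i)) \<in> borel_measurable borel"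
    by measurable
  have comp: "T f $ i = f (?ax i)" for f i
  proof -
    have "T f $ i = (\<Sum>b\<in>Basis. f b * (b $ i))" by (simp add: T_def)
    also have "\<dots> = (\<Sum>j\<in>UNIV. f (?ax j) * (?ax j $ i))"
      unfolding Basis by (subst sum.reindex[OF inj]) simp
    also have "\<dots> = (\<Sum>j\<in>UNIV. if i = j then f (?ax j) else 0)"
      by (intro sum.cong) (auto simp: axis_def)
    finally show ?thesis by simp
  qed
  have eq: "(\<lambda>f. \<Prod>i\<in>UNIV. \<phi> i (T f $ i)) = (\<lambda>f. \<Prod>b\<in>Basis. \<psi> b (f b))"
    unfolding comp Basis \<psi>_def by (subst prod.reindex[OF inj]) (simp add: inv_f_f[OF inj])
  have int\<psi>: "integrable lborel (\<psi> b)" for b using int by (simp add: \<psi>_def)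
  have "integrable ?P (\<lambda>f. \<Prod>b\<in>Basis. \<psi> b (f b))"
    by (rule P.product_integrable_prod) (auto intro: int\<psi>)
  with T m show ?I unfolding L by (subst integrable_distr_eq) (auto simp: eq)
  have "(\<integral>z. (\<Prod>i\<in>UNIV. \<phi> i (z $ i)) \<partial>(lborel :: (real^'p) measure)) = (\<integral>f. (\<Prod>b\<in>Basis. \<psi> b (f b)) \<partial>?P)"
    using T m unfolding L by (subst integral_distr) (auto simp: eq)
  also have "\<dots> = (\<Prod>b\<in>Basis. \<integral>s. \<psi> b s \<partial>lborel)"
    by (rule P.product_integral_prod) (auto intro: int\<psi>)
  also have "\<dots> = (\<Prod>i\<in>UNIV. \<integral>s. \<phi> i s \<partial>lborel)"
    unfolding Basis \<psi>_def by (subst prod.reindex[OF inj]) (simp add: inv_f_f[OF inj])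
  finally show ?E .
qed

section \<open>The standard Gaussian measure and its characteristic function\<close>

lemma sets_std_gaussian [measurable_cong, simp]: "sets std_gaussian = sets borel"
  by (simp add: std_gaussian_def)

lemma space_std_gaussian [simp]: "space std_gaussian = UNIV"
  by (simp add: std_gaussian_def)

lemma measurable_vec_component [measurable]: "(\<lambda>z::real^'p. z $ i) \<in> borel_measurable borel"
  by (intro borel_measurable_continuous_onI continuous_intros)

lemma prob_space_std_gaussian: "prob_space (std_gaussian :: (real^'p) measure)"
proof
  have i: "integrable lborel (\<lambda>z::real^'p. \<Prod>i\<in>UNIV. std_normal_density (z $ i))"
    by (rule integrable_prod_vec) simp
  have "(\<integral>z. (\<Prod>i\<in>UNIV. std_normal_density (z $ i)) \<partial>(lborel :: (real^'p) measure)) = 1"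
    by (subst integral_prod_vec) simp_all
  with i show "emeasure (std_gaussian :: (real^'p) measure) (space std_gaussian) = 1"
    unfolding std_gaussian_def
    by (subst emeasure_density) (auto simp: nn_integral_eq_integral prod_nonneg)
qed

lemma integral_std_gaussian:
  fixes g :: "real^'p \<Rightarrow> 'b::{banach,second_countable_topology}"
  assumes "g \<in> borel_measurable borel"
  shows "(\<integral>z. g z \<partial>std_gaussian) = (\<integral>z. (\<Prod>i\<in>UNIV. std_normal_density (z $ i)) *\<^sub>R g z \<partial>lborel)"
  unfolding std_gaussian_def using assms
  by (subst integral_density) (auto simp: prod_nonneg)

lemma char_std_gaussian:
  "(\<integral>z. iexp (t \<bullet> z) \<partial>(std_gaussian :: (real^'p) measure)) = of_real (exp (- (norm t)\<^sup>2 / 2))"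
proof -
  have int: "integrable lborel (\<lambda>s. std_normal_density s *\<^sub>R iexp (a * s))" for a
  proof (rule Bochner_Integration.integrable_bound)
    show "integrable lborel std_normal_density" by simp
  qed auto
  have one: "(\<integral>s. std_normal_density s *\<^sub>R iexp (a * s) \<partial>lborel) = of_real (exp (- a\<^sup>2 / 2))" for a
  proof -
    have "(\<integral>s. std_normal_density s *\<^sub>R iexp (a * s) \<partial>lborel) = char std_normal_distribution a"
      unfolding char_def by (subst integral_density) auto
    then show ?thesis by (simp add: char_std_normal_distribution)
  qed
  have iexp_inner: "iexp (t \<bullet> z) = (\<Prod>i\<in>UNIV. iexp (t $ i * z $ i))" for z
    by (simp add: inner_vec_def sum_distrib_left exp_sum)
  have "(\<integral>z. iexp (t \<bullet> z) \<partial>(std_gaussian :: (real^'p) measure))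
      = (\<integral>z. (\<Prod>i\<in>UNIV. std_normal_density (z $ i) *\<^sub>R iexp (t $ i * z $ i)) \<partial>lborel)"
    by (subst integral_std_gaussian)
       (simp_all add: iexp_inner prod.distrib scaleR_conv_of_real)
  also have "\<dots> = (\<Prod>i\<in>UNIV. of_real (exp (- (t $ i)\<^sup>2 / 2)))"
    by (subst integral_prod_vec[OF int]) (simp only: one)
  also have "\<dots> = of_real (exp (\<Sum>i\<in>UNIV. - (t $ i)\<^sup>2 / 2))"
    by (simp add: exp_sum)
  also have "(\<Sum>i\<in>UNIV. - (t $ i)\<^sup>2 / 2) = - (norm t)\<^sup>2 / 2"
    by (simp add: norm_vec_def L2_set_def sum_nonneg sum_negf sum_divide_distrib)
  finally show ?thesis .
qed

lemma std_gaussian_density_eq: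
  "(\<Prod>i\<in>UNIV. std_normal_density ((z::real^'p) $ i)) = (1 / sqrt (2 * pi)) ^ CARD('p) * exp (- (norm z)\<^sup>2 / 2)"
proof -
  have "(\<Sum>i\<in>UNIV. - (z $ i)\<^sup>2 / 2) = - (norm z)\<^sup>2 / 2"
    by (simp add: norm_vec_def L2_set_def sum_nonneg sum_negf sum_divide_distrib)
  then have "(\<Prod>i\<in>UNIV. exp (- (z $ i)\<^sup>2 / 2)) = exp (- (norm z)\<^sup>2 / 2)"
    by (simp only: exp_sum[symmetric] finite)
  then show ?thesis
    unfolding std_normal_density_def prod.distrib prod_constant by simp
qed

section \<open>Gaussian smoothing and weak convergence\<close>

definition mchar :: "(real^'p) measure \<Rightarrow> real^'p \<Rightarrow> complex" where
  "mchar \<mu> t = (\<integral>z. iexp (t \<bullet> z) \<partial>\<mu>)"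

lemma norm_mchar_le: "prob_space \<mu> \<Longrightarrow> norm (mchar \<mu> t) \<le> 1"
proof -
  assume "prob_space \<mu>"
  then interpret prob_space \<mu> .
  have "norm (mchar \<mu> t) \<le> (\<integral>z. norm (iexp (t \<bullet> z)) \<partial>\<mu>)"
    unfolding mchar_def by (rule integral_norm_bound)
  then show ?thesis by (simp add: prob_space)
qed

lemma measurable_mchar [measurable]:
  fixes \<mu> :: "(real^'p) measure"
  assumes "prob_space \<mu>" "sets \<mu> = sets borel"
  shows "mchar \<mu> \<in> borel_measurable borel"
proof -
  interpret prob_space \<mu> by fact
  note [measurable_cong] = assms(2)
  have "(\<lambda>(t, z). iexp (t \<bullet> z)) \<in> borel_measurable (borel \<Otimes>\<^sub>M \<mu>)"
    by measurable
  then show ?thesis unfolding mchar_def[abs_def]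
    by (rule borel_measurable_lebesgue_integral)
qed

text \<open>The Gaussian kernel is itself the characteristic function of a Gaussian vector; by Fubini, the
  integral of a smoothed function therefore depends on \<open>\<mu>\<close> only through its characteristic function.\<close>

lemma gaussian_smoothing_identity:
  fixes \<mu> :: "(real^'p) measure" and g :: "real^'p \<Rightarrow> real"
  assumes \<mu>: "prob_space \<mu>" "sets \<mu> = sets borel" and g: "integrable lborel g" and \<sigma>: "\<sigma> > 0"
  shows "(\<integral>y. (\<integral>\<zeta>. g (y + \<sigma> *\<^sub>R \<zeta>) \<partial>std_gaussian) \<partial>\<mu>) =
    (1 / (\<sigma> * sqrt (2 * pi))) ^ CARD('p) *
    (\<integral>z. g z * Re (\<integral>\<zeta>. iexp (\<zeta> \<bullet> z / \<sigma>) * mchar \<mu> (- (1 / \<sigma>) *\<^sub>R \<zeta>) \<partial>std_gaussian) \<partial>lborel)"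
proof -
  interpret \<mu>: prob_space \<mu> by fact
  note [measurable_cong] = assms(2)
  interpret \<gamma>: prob_space "std_gaussian :: (real^'p) measure" by (rule prob_space_std_gaussian)
  interpret \<mu>\<gamma>: pair_sigma_finite \<mu> "std_gaussian :: (real^'p) measure" by unfold_locales
  interpret \<mu>l: pair_sigma_finite "lborel :: (real^'p) measure" \<mu> by unfold_locales
  interpret prod_prob: pair_prob_space \<mu> "std_gaussian :: (real^'p) measure" by unfold_locales
  have gm [measurable]: "g \<in> borel_measurable borel"
    using borel_measurable_integrable[OF g] by simp
  define q where "q = (\<lambda>u::real^'p. exp (- (norm u)\<^sup>2 / 2))"
  have qm [measurable]: "q \<in> borel_measurable borel" unfolding q_def by measurable
  have q01: "0 \<le> q u" "q u \<le> 1" for u by (auto simp: q_def)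
  define C where "C = (1 / sqrt (2 * pi)) ^ CARD('p)"
  \<comment> \<open>The substitution \<open>z = y + \<sigma> *\<^sub>R \<zeta>\<close> moves the
    dependence on \<open>y\<close> from \<open>g\<close> to the Gaussian kernel
    \<open>q\<close>.\<close>
  have shift: "(\<integral>\<zeta>. g (y + \<sigma> *\<^sub>R \<zeta>) \<partial>std_gaussian) = (1 / \<sigma>) ^ CARD('p) * C * (\<integral>z. g z * q ((1 / \<sigma>) *\<^sub>R (z - y)) \<partial>lborel)" for y
  proof -
    have "(\<integral>z. g z * q ((1 / \<sigma>) *\<^sub>R (z - y)) \<partial>lborel) = \<sigma> ^ CARD('p) * (\<integral>z. g (y + \<sigma> *\<^sub>R z) * q z \<partial>lborel)"
      by (subst lborel_affine[of \<sigma> y], use \<sigma> in simp)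
         (subst integral_density, simp, simp, use \<sigma> in simp, subst integral_distr, simp, measurable, use \<sigma> in simp)
    moreover have "(\<integral>\<zeta>. g (y + \<sigma> *\<^sub>R \<zeta>) \<partial>std_gaussian) = (\<integral>z. C * (g (y + \<sigma> *\<^sub>R z) * q z) \<partial>lborel)"
      by (subst integral_std_gaussian) (simp_all add: std_gaussian_density_eq C_def q_def mult_ac)
    then have "(\<integral>\<zeta>. g (y + \<sigma> *\<^sub>R \<zeta>) \<partial>std_gaussian) = C * (\<integral>z. g (y + \<sigma> *\<^sub>R z) * q z \<partial>lborel)"
      by simp
    ultimately show ?thesis using \<sigma> by (simp add: power_divide)
  qed
  \<comment> \<open>\<open>q\<close> is written as the characteristic function of the Gaussian;
    exchanging the two integrals leaves that of \<open>\<mu>\<close>, evaluated at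
    \<open>- (1 / \<sigma>) *\<^sub>R \<zeta>\<close>.\<close>
  have q_char: "(\<integral>y. q ((1 / \<sigma>) *\<^sub>R (z - y)) \<partial>\<mu>)
      = Re (\<integral>\<zeta>. iexp (\<zeta> \<bullet> z / \<sigma>) * mchar \<mu> (- (1 / \<sigma>) *\<^sub>R \<zeta>) \<partial>std_gaussian)" for z
  proof -
    have "complex_of_real (\<integral>y. q ((1 / \<sigma>) *\<^sub>R (z - y)) \<partial>\<mu>) = (\<integral>y. of_real (q ((1 / \<sigma>) *\<^sub>R (z - y))) \<partial>\<mu>)"
      by simp
    also have "\<dots> = (\<integral>y. (\<integral>\<zeta>. iexp (((1 / \<sigma>) *\<^sub>R (z - y)) \<bullet> \<zeta>) \<partial>std_gaussian) \<partial>\<mu>)"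
      by (simp only: char_std_gaussian q_def)
    also have "\<dots> = (\<integral>\<zeta>. (\<integral>y. iexp (((1 / \<sigma>) *\<^sub>R (z - y)) \<bullet> \<zeta>) \<partial>\<mu>) \<partial>std_gaussian)"
      by (rule \<mu>\<gamma>.Fubini_integral[symmetric])
         (rule prod_prob.P.integrable_const_bound[of _ 1], auto)
    also have "\<dots> = (\<integral>\<zeta>. iexp (\<zeta> \<bullet> z / \<sigma>) * mchar \<mu> (- (1 / \<sigma>) *\<^sub>R \<zeta>) \<partial>std_gaussian)"
    proof (intro Bochner_Integration.integral_cong refl)
      fix \<zeta> :: "real^'p"
      have "iexp (((1 / \<sigma>) *\<^sub>R (z - y)) \<bullet> \<zeta>) = iexp (\<zeta> \<bullet> z / \<sigma>) * iexp ((- (1 / \<sigma>) *\<^sub>R \<zeta>) \<bullet> y)" for y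
        unfolding exp_add[symmetric]
        by (simp add: inner_diff_left inner_diff_right inner_commute algebra_simps diff_divide_distrib)
      then show "(\<integral>y. iexp (((1 / \<sigma>) *\<^sub>R (z - y)) \<bullet> \<zeta>) \<partial>\<mu>) = iexp (\<zeta> \<bullet> z / \<sigma>) * mchar \<mu> (- (1 / \<sigma>) *\<^sub>R \<zeta>)"
        by (simp only: mchar_def integral_mult_right_zero)
    qed
    finally have "Re (complex_of_real (\<integral>y. q ((1 / \<sigma>) *\<^sub>R (z - y)) \<partial>\<mu>))
        = Re (\<integral>\<zeta>. iexp (\<zeta> \<bullet> z / \<sigma>) * mchar \<mu> (- (1 / \<sigma>) *\<^sub>R \<zeta>) \<partial>std_gaussian)" by simp
    then show ?thesis by (simp only: Re_complex_of_real)
  qed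
  have "integrable (lborel \<Otimes>\<^sub>M \<mu>) (\<lambda>x. g (fst x))"
  proof -
    have "integrable (distr (lborel \<Otimes>\<^sub>M \<mu>) lborel fst) g"
      unfolding \<mu>.distr_pair_fst using g by simp
    then show ?thesis by (subst (asm) integrable_distr_eq) auto
  qed
  then have "integrable (lborel \<Otimes>\<^sub>M \<mu>) (\<lambda>(z, y). g z * q ((1 / \<sigma>) *\<^sub>R (z - y)))"
    by (rule Bochner_Integration.integrable_bound)
       (auto simp: abs_mult intro!: AE_I2 mult_left_le q01 simp: q01)
  then have "(\<integral>y. (\<integral>z. g z * q ((1 / \<sigma>) *\<^sub>R (z - y)) \<partial>lborel) \<partial>\<mu>)
      = (\<integral>z. (\<integral>y. g z * q ((1 / \<sigma>) *\<^sub>R (z - y)) \<partial>\<mu>) \<partial>lborel)"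
    by (rule \<mu>l.Fubini_integral)
  then have "(\<integral>y. (\<integral>\<zeta>. g (y + \<sigma> *\<^sub>R \<zeta>) \<partial>std_gaussian) \<partial>\<mu>) = (1 / \<sigma>) ^ CARD('p) * C *
      (\<integral>z. g z * Re (\<integral>\<zeta>. iexp (\<zeta> \<bullet> z / \<sigma>) * mchar \<mu> (- (1 / \<sigma>) *\<^sub>R \<zeta>) \<partial>std_gaussian) \<partial>lborel)"
    unfolding shift integral_mult_right_zero q_char by simp
  then show ?thesis by (simp add: C_def power_divide power_mult_distrib)
qed

text \<open>After the smoothing identity, dominated convergence is applied twice: with the bound 1
  under the Gaussian integral and with \<open>\<bar>g z\<bar>\<close> under the Lebesgue
  integral.\<close>

lemma gaussian_smoothing_tendsto:
  fixes \<mu> :: "nat \<Rightarrow> (real^'p) measure" and \<nu> :: "(real^'p) measure" and g :: "real^'p \<Rightarrow> real"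
  assumes \<mu>: "\<And>n. prob_space (\<mu> n)" "\<And>n. sets (\<mu> n) = sets borel"
    and \<nu>: "prob_space \<nu>" "sets \<nu> = sets borel"
    and conv: "\<And>t. (\<lambda>n. mchar (\<mu> n) t) \<longlonglongrightarrow> mchar \<nu> t"
    and g: "integrable lborel g" and \<sigma>: "\<sigma> > 0"
  shows "(\<lambda>n. \<integral>y. (\<integral>\<zeta>. g (y + \<sigma> *\<^sub>R \<zeta>) \<partial>std_gaussian) \<partial>\<mu> n) \<longlonglongrightarrow> (\<integral>y. (\<integral>\<zeta>. g (y + \<sigma> *\<^sub>R \<zeta>) \<partial>std_gaussian) \<partial>\<nu>)"
proof -
  interpret \<gamma>: prob_space "std_gaussian :: (real^'p) measure" by (rule prob_space_std_gaussian)
  have gm [measurable]: "g \<in> borel_measurable borel"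
    using borel_measurable_integrable[OF g] by simp
  note [measurable] = measurable_mchar[OF \<mu>] measurable_mchar[OF \<nu>]
  define A where "A = (\<lambda>\<mu>. \<lambda>z::real^'p. \<integral>\<zeta>. iexp (\<zeta> \<bullet> z / \<sigma>) * mchar \<mu> (- (1 / \<sigma>) *\<^sub>R \<zeta>) \<partial>std_gaussian)"
  have Am: "A \<mu> \<in> borel_measurable borel" if [measurable]: "mchar \<mu> \<in> borel_measurable borel" for \<mu>
    unfolding A_def by measurable
  note [measurable] = Am[OF measurable_mchar[OF \<mu>]] Am[OF measurable_mchar[OF \<nu>]]
  have A1: "norm (A \<mu> z) \<le> 1" if "prob_space \<mu>" for \<mu> z
  proof -
    have "norm (A \<mu> z) \<le> (\<integral>\<zeta>. norm (iexp (\<zeta> \<bullet> z / \<sigma>) * mchar \<mu> (- (1 / \<sigma>) *\<^sub>R \<zeta>)) \<partial>std_gaussian)"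
      unfolding A_def by (rule integral_norm_bound)
    also have "\<dots> \<le> (\<integral>\<zeta>. 1 \<partial>(std_gaussian :: (real^'p) measure))"
      using norm_mchar_le[OF that] by (intro Bochner_Integration.integral_mono') (auto simp: norm_mult)
    finally show ?thesis using \<gamma>.prob_space by simp
  qed
  have A: "(\<lambda>n. A (\<mu> n) z) \<longlonglongrightarrow> A \<nu> z" for z
    unfolding A_def
    by (rule integral_dominated_convergence[where w = "\<lambda>_. 1"])
       (auto intro!: tendsto_intros conv simp: norm_mult norm_mchar_le \<mu>)
  have "(\<lambda>n. \<integral>z. g z * Re (A (\<mu> n) z) \<partial>lborel) \<longlonglongrightarrow> (\<integral>z. g z * Re (A \<nu> z) \<partial>lborel)"
  proof (rule integral_dominated_convergence[where w = "\<lambda>z. \<bar>g z\<bar>"])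
    show "AE z in lborel. norm (g z * Re (A (\<mu> n) z)) \<le> \<bar>g z\<bar>" for n
      using order.trans[OF abs_Re_le_cmod A1[OF \<mu>(1)[of n]]]
      by (auto simp: abs_mult intro!: mult_left_le)
  qed (use g in \<open>auto intro!: tendsto_intros A\<close>)
  then show ?thesis
    unfolding gaussian_smoothing_identity[OF \<mu> g \<sigma>] gaussian_smoothing_identity[OF \<nu> g \<sigma>] A_def
    by (intro tendsto_mult tendsto_const)
qed

lemma gaussian_smoothing_uniform:
  fixes g :: "real^'p \<Rightarrow> real"
  assumes u: "uniformly_continuous_on UNIV g" and B: "\<And>y. \<bar>g y\<bar> \<le> B" and e: "e > 0"
  obtains \<sigma> where "\<sigma> > 0" "\<And>y. \<bar>(\<integral>\<zeta>. g (y + \<sigma> *\<^sub>R \<zeta>) \<partial>std_gaussian) - g y\<bar> \<le> e"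
proof -
  interpret \<gamma>: prob_space "std_gaussian :: (real^'p) measure" by (rule prob_space_std_gaussian)
  have [measurable]: "g \<in> borel_measurable borel"
    using u by (intro borel_measurable_continuous_onI uniformly_continuous_imp_continuous)
  have B0: "B \<ge> 0" using B[of 0] by linarith
  let ?S = "\<lambda>n. {z::real^'p. norm z \<le> real n}"
  have "(\<lambda>n. measure std_gaussian (?S n)) \<longlonglongrightarrow> measure std_gaussian (\<Union>n. ?S n)"
    by (rule \<gamma>.finite_Lim_measure_incseq) (auto simp: incseq_def intro: order.trans)
  moreover have "(\<Union>n. ?S n) = (UNIV :: (real^'p) set)"
    by (auto simp: real_arch_simple)
  ultimately have "(\<lambda>n. measure std_gaussian (?S n)) \<longlonglongrightarrow> 1"
    using \<gamma>.prob_space by simp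
  \<comment> \<open>Outside the ball the integrand can reach \<open>2 * B\<close>; a mass below
    \<open>e / (4 * (B + 1))\<close> keeps this part under \<open>e / 2\<close>. The
    \<open>+ 1\<close> guards against \<open>B = 0\<close>.\<close>
  then have "\<forall>\<^sub>F n in sequentially. measure std_gaussian (?S n) > 1 - e / (4 * (B + 1))"
    using e B0 by (intro order_tendstoD) auto
  then obtain n where n: "measure std_gaussian (?S n) > 1 - e / (4 * (B + 1))"
    by (auto simp: eventually_sequentially)
  obtain d where d: "d > 0" "\<And>y z. dist y z < d \<Longrightarrow> dist (g y) (g z) < e / 2"
    using u e unfolding uniformly_continuous_on_def by (metis UNIV_I half_gt_zero)
  \<comment> \<open>Scales vectors of norm at most \<open>n\<close> to displacements shorter than
    the modulus of continuity \<open>d\<close>.\<close>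
  define \<sigma> where "\<sigma> = d / (real n + 1)"
  have \<sigma>: "\<sigma> > 0" using d by (simp add: \<sigma>_def)
  have "\<bar>(\<integral>\<zeta>. g (y + \<sigma> *\<^sub>R \<zeta>) \<partial>std_gaussian) - g y\<bar> \<le> e" for y
  proof -
    have i1: "integrable std_gaussian (\<lambda>\<zeta>. g (y + \<sigma> *\<^sub>R \<zeta>))"
      by (rule \<gamma>.integrable_const_bound[of _ B]) (auto simp: B)
    have i2: "integrable std_gaussian (\<lambda>\<zeta>. e / 2 + 2 * B * indicator (- ?S n) \<zeta>)"
      by (intro Bochner_Integration.integrable_add integrable_mult_right) (auto simp: integrable_indicator_iff less_top[symmetric])
    have "\<bar>(\<integral>\<zeta>. g (y + \<sigma> *\<^sub>R \<zeta>) \<partial>std_gaussian) - g y\<bar> = \<bar>\<integral>\<zeta>. g (y + \<sigma> *\<^sub>R \<zeta>) - g y \<partial>std_gaussian\<bar>"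
      using i1 \<gamma>.prob_space by simp
    also have "\<dots> \<le> (\<integral>\<zeta>. e / 2 + 2 * B * indicator (- ?S n) \<zeta> \<partial>std_gaussian)"
    proof (rule Bochner_Integration.integral_abs_bound_integral[OF _ i2])
      show "\<bar>g (y + \<sigma> *\<^sub>R \<zeta>) - g y\<bar> \<le> e / 2 + 2 * B * indicator (- ?S n) \<zeta>" for \<zeta>
        proof (cases "norm \<zeta> \<le> real n")
          case True
          have "\<sigma> * norm \<zeta> \<le> \<sigma> * real n" using True \<sigma> by simp
          also have "\<dots> < d" using d by (simp add: \<sigma>_def field_simps)
          finally have "dist (g (y + \<sigma> *\<^sub>R \<zeta>)) (g y) < e / 2"
            using \<sigma> by (intro d) (simp add: dist_norm)
          then show ?thesis using True by (simp add: dist_real_def)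
        next
          case False
          then show ?thesis using B[of "y + \<sigma> *\<^sub>R \<zeta>"] B[of y] e by simp
        qed
    qed (use i1 in auto)
    also have "\<dots> = e / 2 + 2 * B * measure std_gaussian (- ?S n)"
    proof -
      have "integrable std_gaussian (\<lambda>\<zeta>. 2 * B * indicator (- ?S n) \<zeta>)"
        by (intro integrable_mult_right) (auto simp: integrable_indicator_iff less_top[symmetric])
      then show ?thesis using \<gamma>.prob_space by simp
    qed
    also have "measure std_gaussian (- ?S n) = 1 - measure std_gaussian (?S n)"
      using \<gamma>.prob_compl[of "?S n"] by (simp add: Compl_eq_Diff_UNIV)
    also have "e / 2 + 2 * B * (1 - measure std_gaussian (?S n)) \<le> e / 2 + 2 * B * (e / (4 * (B + 1)))"
      using n B0 by (intro add_left_mono mult_left_mono) auto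
    also have "\<dots> \<le> e" using e B0 by (simp add: field_simps)
    finally show ?thesis .
  qed
  with \<sigma> show ?thesis by (rule that)
qed

text \<open>Of two points at distance below 1, either both lie outside the ball of radius
  \<open>R\<close>, where \<open>g\<close> vanishes, or both lie in the ball of radius
  \<open>R + 1\<close>, where Heine-Cantor applies.\<close>

lemma compact_support_uniformly_continuous:
  fixes g :: "'a::{real_normed_vector,heine_borel} \<Rightarrow> real"
  assumes c: "continuous_on UNIV g" and z: "\<And>y. norm y > R \<Longrightarrow> g y = 0"
  shows "uniformly_continuous_on UNIV g"
  unfolding uniformly_continuous_on_def
proof (intro allI impI)
  fix e :: real assume e: "e > 0"
  have "uniformly_continuous_on (cball 0 (R + 1)) g"
    using c by (intro compact_uniformly_continuous) (auto intro: continuous_on_subset)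
  then obtain d where d: "d > 0" "\<And>y y'. y \<in> cball 0 (R + 1) \<Longrightarrow> y' \<in> cball 0 (R + 1) \<Longrightarrow> dist y' y < d \<Longrightarrow> dist (g y') (g y) < e"
    using e unfolding uniformly_continuous_on_def by metis
  have "dist (g y') (g y) < e" if "dist y' y < min d 1" for y y'
  proof (cases "norm y > R \<and> norm y' > R")
    case True
    then show ?thesis using z e by simp
  next
    case False
    moreover have "norm y' \<le> norm y + dist y' y" "norm y \<le> norm y' + dist y' y"
      using norm_triangle_ineq2[of y' y] norm_triangle_ineq2[of y y'] by (auto simp: dist_norm norm_minus_commute)
    ultimately have "norm y \<le> R + 1" "norm y' \<le> R + 1" using that by linarith+
    then show ?thesis using that by (intro d) auto
  qed
  then show "\<exists>d>0. \<forall>x\<in>UNIV. \<forall>x'\<in>UNIV. dist x' x < d \<longrightarrow> dist (g x') (g x) < e"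
    using d(1) by (intro exI[of _ "min d 1"]) auto
qed

text \<open>Smoothing moves \<open>g\<close> uniformly by at most \<open>r / 4\<close>, hence each
  integral against a probability measure by at most as much, whatever \<open>n\<close>; the
  integrals of the smoothed function converge.\<close>

lemma char_tendsto_imp_compact_support:
  fixes \<mu> :: "nat \<Rightarrow> (real^'p) measure" and \<nu> :: "(real^'p) measure" and g :: "real^'p \<Rightarrow> real"
  assumes \<mu>: "\<And>n. prob_space (\<mu> n)" "\<And>n. sets (\<mu> n) = sets borel"
    and \<nu>: "prob_space \<nu>" "sets \<nu> = sets borel"
    and conv: "\<And>t. (\<lambda>n. mchar (\<mu> n) t) \<longlonglongrightarrow> mchar \<nu> t"
    and g: "continuous_on UNIV g" "\<And>y. \<bar>g y\<bar> \<le> B" "\<And>y. norm y > R \<Longrightarrow> g y = 0"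
  shows "(\<lambda>n. \<integral>y. g y \<partial>\<mu> n) \<longlonglongrightarrow> (\<integral>y. g y \<partial>\<nu>)"
proof (rule LIMSEQ_I)
  fix r :: real assume r: "r > 0"
  interpret \<gamma>: prob_space "std_gaussian :: (real^'p) measure" by (rule prob_space_std_gaussian)
  have gm [measurable]: "g \<in> borel_measurable borel"
    using g(1) by (rule borel_measurable_continuous_onI)
  have "integrable lborel (\<lambda>x. indicator (cball 0 R) x *\<^sub>R g x)"
    using g(1) by (intro borel_integrable_compact) (auto intro: continuous_on_subset)
  also have "(\<lambda>x. indicator (cball 0 R) x *\<^sub>R g x) = g"
    using g(3) by (auto simp: fun_eq_iff indicator_def)
  finally have gi: "integrable lborel g" .
  have r4: "r / 4 > 0" using r by simp
  obtain \<sigma> where \<sigma>: "\<sigma> > 0" "\<And>y. \<bar>(\<integral>\<zeta>. g (y + \<sigma> *\<^sub>R \<zeta>) \<partial>std_gaussian) - g y\<bar> \<le> r / 4"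
    using gaussian_smoothing_uniform[OF compact_support_uniformly_continuous[OF g(1) g(3)] g(2) r4] by blast
  define G where "G = (\<lambda>y. \<integral>\<zeta>. g (y + \<sigma> *\<^sub>R \<zeta>) \<partial>std_gaussian)"
  have Gm [measurable]: "G \<in> borel_measurable borel"
    unfolding G_def by measurable
  have close: "\<bar>(\<integral>y. G y \<partial>\<mu>) - (\<integral>y. g y \<partial>\<mu>)\<bar> \<le> r / 4" if p: "prob_space \<mu>" and s: "sets \<mu> = sets borel" for \<mu>
  proof -
    interpret prob_space \<mu> by fact
    note [measurable_cong] = s
    have ig: "integrable \<mu> g" by (rule integrable_const_bound[of _ B]) (auto simp: g)
    have "\<bar>G y\<bar> \<le> B + r / 4" for y using \<sigma>(2)[of y] g(2)[of y] unfolding G_def by linarith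
    then have iG: "integrable \<mu> G" by (intro integrable_const_bound[of _ "B + r / 4"]) auto
    have "\<bar>\<integral>y. G y - g y \<partial>\<mu>\<bar> \<le> (\<integral>y. r / 4 \<partial>\<mu>)"
      using \<sigma>(2) ig iG unfolding G_def
      by (intro Bochner_Integration.integral_abs_bound_integral) auto
    then show ?thesis using ig iG by (simp add: prob_space)
  qed
  have "(\<lambda>n. \<integral>y. G y \<partial>\<mu> n) \<longlonglongrightarrow> (\<integral>y. G y \<partial>\<nu>)"
    unfolding G_def by (rule gaussian_smoothing_tendsto) fact+
  then obtain N where N: "\<And>n. n \<ge> N \<Longrightarrow> \<bar>(\<integral>y. G y \<partial>\<mu> n) - (\<integral>y. G y \<partial>\<nu>)\<bar> < r / 4"
    using LIMSEQ_D[of _ _ "r / 4"] r by (metis divide_pos_pos real_norm_def zero_less_numeral)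
  have "\<bar>(\<integral>y. g y \<partial>\<mu> n) - (\<integral>y. g y \<partial>\<nu>)\<bar> < r" if "n \<ge> N" for n
    using N[OF that] close[OF \<mu>(1)[of n] \<mu>(2)[of n]] close[OF \<nu>] r by linarith
  then show "\<exists>no. \<forall>n\<ge>no. norm ((\<integral>y. g y \<partial>\<mu> n) - (\<integral>y. g y \<partial>\<nu>)) < r" by auto
qed

text \<open>Tightness is not assumed but obtained: the integral of the compactly supported cut-off
  \<open>X\<close> converges, so the small mass that \<open>\<nu>\<close> has outside bounds that of
  \<open>\<mu> n\<close> eventually. The product of \<open>g\<close> and \<open>X\<close> is
  compactly supported, and replacing \<open>g\<close> by it costs little.\<close>

theorem multivariate_levy_continuity:
  fixes \<mu> :: "nat \<Rightarrow> (real^'p) measure" and \<nu> :: "(real^'p) measure" and g :: "real^'p \<Rightarrow> real"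
  assumes \<mu>: "\<And>n. prob_space (\<mu> n)" "\<And>n. sets (\<mu> n) = sets borel"
    and \<nu>: "prob_space \<nu>" "sets \<nu> = sets borel"
    and conv: "\<And>t. (\<lambda>n. mchar (\<mu> n) t) \<longlonglongrightarrow> mchar \<nu> t"
    and g: "continuous_on UNIV g" "bounded (range g)"
  shows "(\<lambda>n. \<integral>y. g y \<partial>\<mu> n) \<longlonglongrightarrow> (\<integral>y. g y \<partial>\<nu>)"
proof (rule LIMSEQ_I)
  fix r :: real assume r: "r > 0"
  obtain B where B: "\<And>y. \<bar>g y\<bar> \<le> B" using g(2) by (auto simp: bounded_iff)
  have B0: "B \<ge> 0" using B[of 0] by linarith
  have gm [measurable]: "g \<in> borel_measurable borel"
    using g(1) by (rule borel_measurable_continuous_onI)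
  define cut where "cut = (\<lambda>R. \<lambda>y::real^'p. max 0 (min 1 (R + 1 - norm y)))"
  have cutc: "continuous_on UNIV (cut R)" for R unfolding cut_def by (intro continuous_intros)
  have cutm [measurable]: "cut R \<in> borel_measurable borel" for R
    using cutc by (rule borel_measurable_continuous_onI)
  have cut01: "0 \<le> cut R y" "cut R y \<le> 1" for R y by (auto simp: cut_def)
  have cut0: "cut R y = 0" if "norm y > R + 1" for R y using that by (simp add: cut_def)
  interpret \<nu>: prob_space \<nu> by fact
  have "(\<lambda>n. \<integral>y. cut (real n) y \<partial>\<nu>) \<longlonglongrightarrow> (\<integral>y. 1 \<partial>\<nu>)"
  proof (rule integral_dominated_convergence[where w = "\<lambda>_. 1"])
    show "AE y in \<nu>. (\<lambda>n. cut (real n) y) \<longlonglongrightarrow> 1"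
    proof (rule AE_I2)
      fix y
      have "\<forall>\<^sub>F n in sequentially. cut (real n) y = 1"
        using eventually_ge_at_top[of "nat \<lceil>norm y\<rceil>"]
      proof eventually_elim
        case (elim n)
        then have "norm y \<le> real n" by linarith
        then show ?case by (simp add: cut_def)
      qed
      then show "(\<lambda>n. cut (real n) y) \<longlonglongrightarrow> 1" by (rule tendsto_eventually)
    qed
  qed (use \<nu> cut01 in \<open>auto simp: measurable_cong_sets[OF \<nu>(2) refl]\<close>)
  \<comment> \<open>Replacing \<open>g\<close> by its product with the cut-off costs at most
    \<open>B\<close> times the missing mass, hence at most \<open>r / 8\<close> on either side of
    the limit.\<close>
  then have "\<forall>\<^sub>F n in sequentially. (\<integral>y. cut (real n) y \<partial>\<nu>) > 1 - r / (8 * (B + 1))"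
    using r B0 \<nu>.prob_space by (intro order_tendstoD) auto
  then obtain m where m: "(\<integral>y. cut (real m) y \<partial>\<nu>) > 1 - r / (8 * (B + 1))"
    by (auto simp: eventually_sequentially)
  define X where "X = cut (real m)"
  have Xm [measurable]: "X \<in> borel_measurable borel" by (simp add: X_def)
  have "(\<lambda>n. \<integral>y. X y \<partial>\<mu> n) \<longlonglongrightarrow> (\<integral>y. X y \<partial>\<nu>)"
    unfolding X_def
    by (rule char_tendsto_imp_compact_support[OF \<mu> \<nu> conv cutc, where B = 1 and R = "real m + 1"]) (use cut01 cut0 in auto)
  moreover have "(\<integral>y. X y \<partial>\<nu>) > 1 - r / (8 * (B + 1))" using m by (simp add: X_def)
  ultimately have ev1: "\<forall>\<^sub>F n in sequentially. (\<integral>y. X y \<partial>\<mu> n) > 1 - r / (8 * (B + 1))"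
    by (rule order_tendstoD)
  have gX: "(\<lambda>n. \<integral>y. g y * X y \<partial>\<mu> n) \<longlonglongrightarrow> (\<integral>y. g y * X y \<partial>\<nu>)"
    unfolding X_def
  proof (rule char_tendsto_imp_compact_support[OF \<mu> \<nu> conv, where B = B and R = "real m + 1"])
    show "\<bar>g y * cut (real m) y\<bar> \<le> B" for y
      using mult_mono[OF B[of y] cut01(2)[of "real m" y]] cut01[of "real m" y] B0 by (simp add: abs_mult)
  qed (use cut0 in \<open>auto intro!: continuous_intros g cutc\<close>)
  have ev2: "\<forall>\<^sub>F n in sequentially. \<bar>(\<integral>y. g y * X y \<partial>\<mu> n) - (\<integral>y. g y * X y \<partial>\<nu>)\<bar> < r / 2"
    using tendstoD[OF gX, of "r / 2"] r by (simp add: dist_real_def)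
  from ev1 ev2 have "\<forall>\<^sub>F n in sequentially. \<bar>(\<integral>y. g y \<partial>\<mu> n) - (\<integral>y. g y \<partial>\<nu>)\<bar> < r"
  proof eventually_elim
    case (elim n)
    have near: "\<bar>(\<integral>y. g y \<partial>\<mu>) - (\<integral>y. g y * X y \<partial>\<mu>)\<bar> \<le> r / 8"
      if p: "prob_space \<mu>" and s: "sets \<mu> = sets borel" and b: "(\<integral>y. X y \<partial>\<mu>) > 1 - r / (8 * (B + 1))" for \<mu>
    proof -
      interpret prob_space \<mu> by fact
      note [measurable_cong] = s
      have ig: "integrable \<mu> g" by (rule integrable_const_bound[of _ B]) (auto simp: B)
      have iX: "integrable \<mu> X" by (rule integrable_const_bound[of _ 1]) (auto simp: X_def cut01)
      have b1: "\<bar>g y - g y * X y\<bar> \<le> B * (1 - X y)" for y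
      proof -
        have "g y - g y * X y = g y * (1 - X y)" by (simp add: right_diff_distrib)
        then have "\<bar>g y - g y * X y\<bar> = \<bar>g y\<bar> * (1 - X y)"
          using cut01(2)[of "real m" y] by (simp add: X_def abs_mult)
        then show ?thesis using B cut01(2) by (auto simp: X_def intro!: mult_right_mono)
      qed
      have igX: "integrable \<mu> (\<lambda>y. g y * X y)"
        using ig by (rule Bochner_Integration.integrable_bound)
          (auto simp: abs_mult X_def cut01 intro!: mult_left_le)
      have "\<bar>\<integral>y. g y - g y * X y \<partial>\<mu>\<bar> \<le> (\<integral>y. B * (1 - X y) \<partial>\<mu>)"
        using b1 ig igX iX by (intro Bochner_Integration.integral_abs_bound_integral) auto
      also have "\<dots> = B * (1 - (\<integral>y. X y \<partial>\<mu>))" using iX by (simp add: prob_space)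
      also have "\<dots> \<le> B * (r / (8 * (B + 1)))" using b B0 by (intro mult_left_mono) auto
      also have "\<dots> \<le> r / 8" using r B0 by (simp add: field_simps)
      finally show ?thesis using ig igX by simp
    qed
    have "\<bar>a - e\<bar> < r" if "\<bar>a - b\<bar> \<le> r / 8" "\<bar>e - d\<bar> \<le> r / 8" "\<bar>b - d\<bar> < r / 2" for a b d e :: real
      using that r by linarith
    from this[OF near[OF \<mu>(1)[of n] \<mu>(2)[of n] elim(1)] near[OF \<nu> m[folded X_def]] elim(2)]
    show ?case .
  qed
  then show "\<exists>no. \<forall>n\<ge>no. norm ((\<integral>y. g y \<partial>\<mu> n) - (\<integral>y. g y \<partial>\<nu>)) < r"
    by (simp add: eventually_sequentially)
qed

section \<open>Characteristic functions of weighted sums\<close>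

lemma exp_minus_quadratic_bound: "y \<ge> 0 \<Longrightarrow> \<bar>exp (- y) - (1 - y)\<bar> \<le> y\<^sup>2 / 2" for y :: real
proof -
  assume y: "y \<ge> 0"
  have lower: "1 - x \<le> exp (- x)" for x :: real using exp_ge_add_one_self[of "- x"] by simp
  have "(\<lambda>x. 1 - x + x\<^sup>2 / 2 - exp (- x)) 0 \<le> (\<lambda>x. 1 - x + x\<^sup>2 / 2 - exp (- x)) y"
    using y
  proof (rule DERIV_nonneg_imp_nondecreasing)
    fix x :: real
    show "\<exists>d. ((\<lambda>x. 1 - x + x\<^sup>2 / 2 - exp (- x)) has_real_derivative d) (at x) \<and> 0 \<le> d"
      using lower[of x] by (intro exI[of _ "exp (- x) - (1 - x)"]) (auto intro!: derivative_eq_intros)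
  qed
  with lower[of y] show ?thesis by simp
qed

text \<open>Both sides are compared with \<open>1 - a^2 / 2\<close>: the Taylor remainder costs the
  third absolute moment, the variance its distance from 1, the Gaussian factor a fourth-order term.
  Surplus powers of \<open>a\<close> are given up for \<open>\<epsilon>\<close>, so that every error
  is proportional to \<open>a^2\<close> and can be summed.\<close>

lemma (in prob_space) char_approx_gaussian:
  fixes X :: "'a \<Rightarrow> real"
  assumes X: "random_variable borel X" and int: "integrable M (\<lambda>\<omega>. \<bar>X \<omega>\<bar> ^ 3)"
    and mean: "expectation X = 0" and var: "\<bar>expectation (\<lambda>\<omega>. (X \<omega>)\<^sup>2) - 1\<bar> \<le> \<eta>"
    and third: "expectation (\<lambda>\<omega>. \<bar>X \<omega>\<bar> ^ 3) \<le> B" and a: "\<bar>a\<bar> \<le> \<epsilon>"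
  shows "cmod (expectation (\<lambda>\<omega>. iexp (a * X \<omega>)) - of_real (exp (- a\<^sup>2 / 2))) \<le> (\<epsilon> * B + \<eta> + \<epsilon>\<^sup>2) * a\<^sup>2"
proof -
  have \<epsilon>: "\<epsilon> \<ge> 0" using a by linarith
  have B0: "0 \<le> B" by (rule order.trans[OF Bochner_Integration.integral_nonneg third]) simp
  have [measurable]: "X \<in> borel_measurable M" using X by simp
  have i2: "integrable M (\<lambda>\<omega>. (X \<omega>)\<^sup>2)"
  proof (rule Bochner_Integration.integrable_bound)
    show "integrable M (\<lambda>\<omega>. 1 + \<bar>X \<omega>\<bar> ^ 3)" using int by simp
    have "x\<^sup>2 \<le> 1 + \<bar>x\<bar> ^ 3" for x :: real
    proof (cases "\<bar>x\<bar> \<le> 1")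
      case True
      then have "x\<^sup>2 \<le> 1" by (simp add: abs_square_le_1)
      then show ?thesis by (simp add: add_increasing2)
    next
      case False
      then have "\<bar>x\<bar> ^ 2 \<le> \<bar>x\<bar> ^ 3" by (intro power_increasing) auto
      then show ?thesis by simp
    qed
    then show "AE \<omega> in M. norm ((X \<omega>)\<^sup>2) \<le> norm (1 + \<bar>X \<omega>\<bar> ^ 3)" by (simp add: abs_of_nonneg)
  qed simp
  have i1: "integrable M X"
    by (rule square_integrable_imp_integrable[OF _ i2]) simp
  have icx: "integrable M (\<lambda>\<omega>. complex_of_real (X \<omega>))" "integrable M (\<lambda>\<omega>. complex_of_real ((X \<omega>)\<^sup>2))"
    by (rule integrable_of_real, fact)+
  have ie: "integrable M (\<lambda>\<omega>. iexp (a * X \<omega>))"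
    by (rule integrable_const_bound[of _ 1]) auto
  let ?v = "expectation (\<lambda>\<omega>. (X \<omega>)\<^sup>2)"
  have rem: "cmod (iexp x - (1 + \<i> * x - (of_real x)\<^sup>2 / 2)) \<le> \<bar>x\<bar> ^ 3 / 6" for x :: real
  proof -
    have s: "(\<Sum>k\<le>2. (\<i> * of_real x) ^ k / fact k) = 1 + \<i> * x - (of_real x)\<^sup>2 / 2"
      by (simp add: numeral_2_eq_2 power2_eq_square algebra_simps)
    show ?thesis
      using iexp_approx1[of x 2, unfolded s] by (simp add: fact_numeral)
  qed
  have "expectation (\<lambda>\<omega>. 1 + \<i> * of_real (a * X \<omega>) - (of_real (a * X \<omega>))\<^sup>2 / 2)
      = expectation (\<lambda>\<omega>. 1 + (\<i> * of_real a) * of_real (X \<omega>) - of_real (a\<^sup>2 / 2) * of_real ((X \<omega>)\<^sup>2))"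
    by (intro Bochner_Integration.integral_cong) (auto simp: power_mult_distrib)
  also have "\<dots> = 1 - of_real (a\<^sup>2 / 2 * ?v)"
    using icx mean by (simp add: prob_space del: of_real_power of_real_divide) simp
  finally have main: "expectation (\<lambda>\<omega>. 1 + \<i> * of_real (a * X \<omega>) - (of_real (a * X \<omega>))\<^sup>2 / 2) = of_real (1 - a\<^sup>2 / 2 * ?v)"
    by simp
  have imain: "integrable M (\<lambda>\<omega>. 1 + \<i> * of_real (a * X \<omega>) - (of_real (a * X \<omega>))\<^sup>2 / 2)"
    using i1 i2 by (auto simp: power_mult_distrib simp flip: of_real_power)
  have "cmod (expectation (\<lambda>\<omega>. iexp (a * X \<omega>)) - of_real (1 - a\<^sup>2 / 2 * ?v))
      = cmod (expectation (\<lambda>\<omega>. iexp (a * X \<omega>) - (1 + \<i> * of_real (a * X \<omega>) - (of_real (a * X \<omega>))\<^sup>2 / 2)))"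
    unfolding main[symmetric] using ie imain by (subst Bochner_Integration.integral_diff) auto
  also have "\<dots> \<le> expectation (\<lambda>\<omega>. cmod (iexp (a * X \<omega>) - (1 + \<i> * of_real (a * X \<omega>) - (of_real (a * X \<omega>))\<^sup>2 / 2)))"
    by (rule integral_norm_bound)
  also have "\<dots> \<le> expectation (\<lambda>\<omega>. \<bar>a\<bar> ^ 3 / 6 * \<bar>X \<omega>\<bar> ^ 3)"
    using rem[of "a * X _"] int
    by (intro Bochner_Integration.integral_mono') (auto simp: abs_mult power_mult_distrib)
  also have "\<dots> \<le> \<bar>a\<bar> ^ 3 / 6 * B"
    using third by (simp add: mult_left_mono)
  also have "\<dots> \<le> \<epsilon> * a\<^sup>2 * B"
  proof (rule mult_right_mono[OF _ B0])
    have "\<bar>a\<bar> ^ 3 = \<bar>a\<bar> * a\<^sup>2" by (simp add: power3_eq_cube power2_eq_square)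
    also have "\<dots> \<le> \<epsilon> * a\<^sup>2" using a by (intro mult_right_mono) auto
    finally show "\<bar>a\<bar> ^ 3 / 6 \<le> \<epsilon> * a\<^sup>2" using zero_le_power[OF abs_ge_zero, of a 3] by linarith
  qed
  finally have 1: "cmod (expectation (\<lambda>\<omega>. iexp (a * X \<omega>)) - of_real (1 - a\<^sup>2 / 2 * ?v)) \<le> \<epsilon> * B * a\<^sup>2"
    by (simp add: mult_ac)
  have 2: "\<bar>(1 - a\<^sup>2 / 2 * ?v) - (1 - a\<^sup>2 / 2)\<bar> \<le> \<eta> * a\<^sup>2"
  proof -
    have "(1 - a\<^sup>2 / 2 * ?v) - (1 - a\<^sup>2 / 2) = - (a\<^sup>2 / 2 * (?v - 1))" by (simp add: algebra_simps)
    then have "\<bar>(1 - a\<^sup>2 / 2 * ?v) - (1 - a\<^sup>2 / 2)\<bar> = a\<^sup>2 / 2 * \<bar>?v - 1\<bar>" by (simp add: abs_mult)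
    also have "\<dots> \<le> a\<^sup>2 / 2 * \<eta>" using var by (intro mult_left_mono) auto
    also have "\<dots> = (\<eta> * a\<^sup>2) / 2" by simp
    also have "\<dots> \<le> \<eta> * a\<^sup>2"
    proof -
      have "\<eta> \<ge> 0" using var by linarith
      then have "0 \<le> \<eta> * a\<^sup>2" by simp
      then show ?thesis by linarith
    qed
    finally show ?thesis .
  qed
  have 3: "\<bar>(1 - a\<^sup>2 / 2) - exp (- a\<^sup>2 / 2)\<bar> \<le> \<epsilon>\<^sup>2 * a\<^sup>2"
  proof -
    have "\<bar>exp (- (a\<^sup>2 / 2)) - (1 - a\<^sup>2 / 2)\<bar> \<le> (a\<^sup>2 / 2)\<^sup>2 / 2"
      by (rule exp_minus_quadratic_bound) simp
    also have "\<dots> = a\<^sup>2 * a\<^sup>2 / 8" by (simp add: power2_eq_square)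
    also have "\<dots> \<le> \<epsilon>\<^sup>2 * a\<^sup>2 / 8"
      using a power_mono[OF a, of 2] by (intro divide_right_mono mult_right_mono) auto
    also have "\<dots> \<le> \<epsilon>\<^sup>2 * a\<^sup>2" by simp
    finally show ?thesis by (simp add: abs_minus_commute)
  qed
  have "cmod (expectation (\<lambda>\<omega>. iexp (a * X \<omega>)) - of_real (exp (- a\<^sup>2 / 2)))
      \<le> cmod (expectation (\<lambda>\<omega>. iexp (a * X \<omega>)) - of_real (1 - a\<^sup>2 / 2 * ?v))
        + cmod (of_real (1 - a\<^sup>2 / 2 * ?v) - of_real (exp (- a\<^sup>2 / 2)))"
    using dist_triangle[of "expectation (\<lambda>\<omega>. iexp (a * X \<omega>))" "of_real (exp (- a\<^sup>2 / 2))" "of_real (1 - a\<^sup>2 / 2 * ?v)"]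
    by (simp only: dist_norm)
  also have "cmod (of_real (1 - a\<^sup>2 / 2 * ?v) - of_real (exp (- a\<^sup>2 / 2))) = \<bar>(1 - a\<^sup>2 / 2 * ?v) - exp (- a\<^sup>2 / 2)\<bar>"
    by (simp only: norm_of_real flip: of_real_diff)
  also have "\<dots> \<le> \<eta> * a\<^sup>2 + \<epsilon>\<^sup>2 * a\<^sup>2" using 2 3 by linarith
  finally show ?thesis using 1 by (simp add: algebra_simps)
qed

text \<open>Independence turns both sides into products of factors of modulus at most 1; such
  products differ by at most the sum of the differences of their factors.\<close>

lemma (in prob_space) char_weighted_sum_approx:
  fixes X :: "'i \<Rightarrow> 'a \<Rightarrow> real"
  assumes ind: "indep_vars (\<lambda>_. borel) X I" and fin: "finite I"
    and int: "\<And>i. i \<in> I \<Longrightarrow> integrable M (\<lambda>\<omega>. \<bar>X i \<omega>\<bar> ^ 3)"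
    and mean: "\<And>i. i \<in> I \<Longrightarrow> expectation (X i) = 0"
    and var: "\<And>i. i \<in> I \<Longrightarrow> \<bar>expectation (\<lambda>\<omega>. (X i \<omega>)\<^sup>2) - 1\<bar> \<le> \<eta>"
    and third: "\<And>i. i \<in> I \<Longrightarrow> expectation (\<lambda>\<omega>. \<bar>X i \<omega>\<bar> ^ 3) \<le> B"
    and a: "\<And>i. i \<in> I \<Longrightarrow> \<bar>a i\<bar> \<le> \<epsilon>"
  shows "cmod (expectation (\<lambda>\<omega>. iexp (\<Sum>i\<in>I. a i * X i \<omega>)) - of_real (exp (- (\<Sum>i\<in>I. (a i)\<^sup>2) / 2)))
    \<le> (\<epsilon> * B + \<eta> + \<epsilon>\<^sup>2) * (\<Sum>i\<in>I. (a i)\<^sup>2)"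
proof -
  have rv [measurable]: "X i \<in> borel_measurable M" if "i \<in> I" for i
    using ind that by (auto simp: indep_vars_def)
  have ie: "integrable M (\<lambda>\<omega>. iexp (a i * X i \<omega>))" if "i \<in> I" for i
    using that by (intro integrable_const_bound[of _ 1]) auto
  have "indep_vars (\<lambda>_. borel) (\<lambda>i \<omega>. iexp (a i * X i \<omega>)) I"
    by (rule indep_vars_compose2[OF ind]) simp
  then have "expectation (\<lambda>\<omega>. \<Prod>i\<in>I. iexp (a i * X i \<omega>)) = (\<Prod>i\<in>I. expectation (\<lambda>\<omega>. iexp (a i * X i \<omega>)))"
    using ie by (intro indep_vars_lebesgue_integral fin)
  moreover have "(\<Prod>i\<in>I. iexp (a i * X i \<omega>)) = iexp (\<Sum>i\<in>I. a i * X i \<omega>)" for \<omega>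
    using fin by (simp add: exp_sum sum_distrib_left)
  ultimately have "expectation (\<lambda>\<omega>. iexp (\<Sum>i\<in>I. a i * X i \<omega>)) = (\<Prod>i\<in>I. expectation (\<lambda>\<omega>. iexp (a i * X i \<omega>)))"
    by simp
  moreover have "complex_of_real (exp (- (\<Sum>i\<in>I. (a i)\<^sup>2) / 2)) = (\<Prod>i\<in>I. of_real (exp (- (a i)\<^sup>2 / 2)))"
    using fin by (simp add: sum_negf sum_divide_distrib flip: exp_sum of_real_prod)
  moreover have "cmod ((\<Prod>i\<in>I. expectation (\<lambda>\<omega>. iexp (a i * X i \<omega>))) - (\<Prod>i\<in>I. of_real (exp (- (a i)\<^sup>2 / 2))))
      \<le> (\<Sum>i\<in>I. cmod (expectation (\<lambda>\<omega>. iexp (a i * X i \<omega>)) - of_real (exp (- (a i)\<^sup>2 / 2))))"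
  proof (rule norm_prod_diff)
    fix i assume "i \<in> I"
    have "cmod (expectation (\<lambda>\<omega>. iexp (a i * X i \<omega>))) \<le> expectation (\<lambda>\<omega>. cmod (iexp (a i * X i \<omega>)))"
      by (rule integral_norm_bound)
    then show "cmod (expectation (\<lambda>\<omega>. iexp (a i * X i \<omega>))) \<le> 1" by (simp add: prob_space)
  qed simp
  moreover have "\<dots> \<le> (\<Sum>i\<in>I. (\<epsilon> * B + \<eta> + \<epsilon>\<^sup>2) * (a i)\<^sup>2)"
    using int mean var third a rv by (intro sum_mono char_approx_gaussian) auto
  ultimately show ?thesis by (simp add: sum_distrib_left)
qed

section \<open>The Poisson process on a strip\<close>

definition level :: "(real \<times> real) measure \<Rightarrow> (real \<times> real) set \<Rightarrow> real \<Rightarrow> real" where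
  "level \<mu> D s = measure \<mu> {z \<in> D. snd z \<le> s}"

text \<open>If the level vanishes at height 0, the second branch would give
  \<open>- measure \<mu> D\<close> on an empty strip. The value 0 keeps the mean exactly 0, and
  empty strips are accounted for in the remainder.\<close>

definition strip_noise ::
    "('w \<Rightarrow> (real \<times> real) multiset) \<Rightarrow> (real \<times> real) measure \<Rightarrow> (real \<times> real) set \<Rightarrow> 'w \<Rightarrow> real" where
  "strip_noise N \<mu> D \<omega> =
     (if num_points N D \<omega> = 0 then 0
      else (1 + 1 / real (num_points N D \<omega>)) * level \<mu> D (strip_max N D \<omega>) - measure \<mu> D)"

section \<open>Points below and above a height, and independence of the strips\<close>

lemma num_points_eq_0_iff: "num_points N A \<omega> = 0 \<longleftrightarrow> (\<forall>z\<in>#N \<omega>. z \<notin> A)"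
  unfolding num_points_def size_eq_0_iff_empty filter_mset_eq_mempty_iff by blast

lemma num_points_split:
  "num_points N D \<omega> = num_points N {z \<in> D. P z} \<omega> + num_points N {z \<in> D. \<not> P z} \<omega>"
proof -
  have "filter_mset (\<lambda>z. z \<in> D) (N \<omega>) = filter_mset (\<lambda>z. z \<in> D \<and> P z) (N \<omega>) + filter_mset (\<lambda>z. z \<in> D \<and> \<not> P z) (N \<omega>)"
    by (rule multiset_eqI) auto
  then show ?thesis by (simp add: num_points_def)
qed

lemma strip_max_set: "{y. \<exists>x. (x, y) \<in># N \<omega> \<and> (x, y) \<in> D} = snd ` (set_mset (N \<omega>) \<inter> D)"
proof (intro set_eqI iffI)
  fix y assume "y \<in> {y. \<exists>x. (x, y) \<in># N \<omega> \<and> (x, y) \<in> D}"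
  then obtain x where "(x, y) \<in> set_mset (N \<omega>) \<inter> D" by auto
  then show "y \<in> snd ` (set_mset (N \<omega>) \<inter> D)" by (metis image_eqI snd_conv)
qed auto

lemma strip_max_mem:
  assumes "num_points N D \<omega> \<noteq> 0"
  obtains z where "z \<in># N \<omega>" "z \<in> D" "strip_max N D \<omega> = snd z"
proof -
  have "snd ` (set_mset (N \<omega>) \<inter> D) \<noteq> {}"
    using assms by (auto simp: num_points_eq_0_iff)
  then have "Max (snd ` (set_mset (N \<omega>) \<inter> D)) \<in> snd ` (set_mset (N \<omega>) \<inter> D)"
    by (intro Max_in) auto
  with assms show ?thesis
    using that by (auto simp: strip_max_def strip_max_set)
qed

lemma strip_max_bounds:
  assumes "\<And>z. z \<in> D \<Longrightarrow> 0 \<le> snd z \<and> snd z \<le> h" "0 \<le> h"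
  shows "0 \<le> strip_max N D \<omega>" "strip_max N D \<omega> \<le> h"
proof -
  have "0 \<le> strip_max N D \<omega> \<and> strip_max N D \<omega> \<le> h"
  proof (cases "num_points N D \<omega> = 0")
    case True
    then show ?thesis using assms(2) by (simp add: strip_max_def)
  next
    case False
    then obtain z where "z \<in> D" "strip_max N D \<omega> = snd z" by (rule strip_max_mem)
    then show ?thesis using assms(1)[of z] by simp
  qed
  then show "0 \<le> strip_max N D \<omega>" "strip_max N D \<omega> \<le> h" by auto
qed

text \<open>For \<open>0 \<le> s\<close> the default maximum 0 of an empty strip is on the right
  side of the inequality, so emptiness needs no exception.\<close>

lemma strip_max_le_iff:
  assumes "0 \<le> s"
  shows "strip_max N D \<omega> \<le> s \<longleftrightarrow> num_points N {z \<in> D. \<not> snd z \<le> s} \<omega> = 0"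
proof (cases "num_points N D \<omega> = 0")
  case True
  then show ?thesis using assms by (auto simp: strip_max_def num_points_eq_0_iff)
next
  case False
  then have "snd ` (set_mset (N \<omega>) \<inter> D) \<noteq> {}" by (auto simp: num_points_eq_0_iff)
  then have "strip_max N D \<omega> \<le> s \<longleftrightarrow> (\<forall>y \<in> snd ` (set_mset (N \<omega>) \<inter> D). y \<le> s)"
    using False by (simp add: strip_max_def strip_max_set)
  then show ?thesis by (auto simp: num_points_eq_0_iff)
qed

lemma measurable_num_points:
  "poisson_point_process M N \<mu> \<Longrightarrow> A \<in> sets \<mu> \<Longrightarrow> num_points N A \<in> measurable M (count_space UNIV)"
  by (auto simp: poisson_point_process_def)

text \<open>\<open>poisson_point_process\<close> states independence for sequences indexed by
  \<open>{..<m}\<close>. The lower parts of the sets \<open>D r\<close> are placed at the even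
  positions and the upper parts at the odd positions of a sequence of length
  \<open>2 * card R\<close>; the product is then regrouped in pairs.\<close>

lemma (in prob_space) prob_two_level_events:
  assumes ppp: "poisson_point_process M N \<mu>"
    and sets: "\<And>r s. r \<in> R \<Longrightarrow> {z \<in> D r. snd z \<le> s} \<in> sets \<mu>" "\<And>r. r \<in> R \<Longrightarrow> D r \<in> sets \<mu>"
    and disj: "disjoint_family_on D R" and R: "finite R" "R \<noteq> {}"
  shows "prob (\<Inter>r\<in>R. {\<omega> \<in> space M. num_points N {z \<in> D r. snd z \<le> s r} \<omega> \<in> B r \<and> num_points N {z \<in> D r. \<not> snd z \<le> s r} \<omega> = 0})
    = (\<Prod>r\<in>R. prob {\<omega> \<in> space M. num_points N {z \<in> D r. snd z \<le> s r} \<omega> \<in> B r} *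
               prob {\<omega> \<in> space M. num_points N {z \<in> D r. \<not> snd z \<le> s r} \<omega> = 0})"
    (is "?L = ?R")
proof -
  obtain m where m: "bij_betw m {..<card R} R"
    using finite_same_card_bij[of "{..<card R}" R] R by auto
  define A where "A = (\<lambda>i. if even i then {z \<in> D (m (i div 2)). snd z \<le> s (m (i div 2))}
    else {z \<in> D (m (i div 2)). \<not> snd z \<le> s (m (i div 2))})"
  define C where "C = (\<lambda>i. if even i then B (m (i div 2)) else {0::nat})"
  define n where "n = 2 * card R"
  have mR: "m i \<in> R" if "i < card R" for i using m that by (auto simp: bij_betw_def)
  have minj: "m i = m j \<Longrightarrow> i = j" if "i < card R" "j < card R" for i j
    using m that by (auto simp: bij_betw_def inj_on_def)
  have div: "i div 2 < card R" if "i < n" for i using that by (auto simp: n_def)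
  have gt: "{z \<in> D r. \<not> snd z \<le> t} \<in> sets \<mu>" if "r \<in> R" for r t
  proof -
    have "{z \<in> D r. \<not> snd z \<le> t} = D r - {z \<in> D r. snd z \<le> t}" by auto
    then show ?thesis using sets[OF that] by simp
  qed
  have "A i \<in> sets \<mu>" if "i < n" for i
    using sets gt mR[OF div[OF that]] by (auto simp: A_def)
  moreover have "disjoint_family_on A {..<n}"
    unfolding disjoint_family_on_def
  proof (intro ballI impI)
    fix i j assume ij: "i \<in> {..<n}" "j \<in> {..<n}" "i \<noteq> j"
    show "A i \<inter> A j = {}"
    proof (cases "i div 2 = j div 2")
      case True
      with ij have "even i \<noteq> even j"
        by (metis dvd_mult_div_cancel odd_two_times_div_two_succ)
      with True show ?thesis by (auto simp: A_def)
    next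
      case False
      then have "m (i div 2) \<noteq> m (j div 2)" using minj div ij by auto
      then have "D (m (i div 2)) \<inter> D (m (j div 2)) = {}"
        using disj mR div ij by (auto simp: disjoint_family_on_def)
      then show ?thesis by (auto simp: A_def)
    qed
  qed
  ultimately have ind: "indep_vars (\<lambda>_. count_space UNIV) (\<lambda>i. num_points N (A i)) {..<n}"
    using ppp by (auto simp: poisson_point_process_def)
  have n0: "n > 0" using R by (simp add: n_def card_gt_0_iff)
  let ?E = "\<lambda>i. num_points N (A i) -` C i \<inter> space M"
  have A1: "prob (\<Inter>i<n. ?E i) = (\<Prod>i<n. prob (?E i))"
    by (rule indep_varsD[OF ind]) (use n0 in auto)
  have split: "{..<n} = (\<lambda>i. 2 * i) ` {..<card R} \<union> (\<lambda>i. 2 * i + 1) ` {..<card R}"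
  proof -
    have "i \<in> (\<lambda>i. 2 * i) ` {..<card R} \<union> (\<lambda>i. 2 * i + 1) ` {..<card R}" if "i < n" for i
    proof (cases "even i")
      case True
      then have "i = 2 * (i div 2)" by simp
      then show ?thesis using div[OF that] by blast
    next
      case False
      then have "i = 2 * (i div 2) + 1" by simp
      then show ?thesis using div[OF that] by blast
    qed
    then show ?thesis by (auto simp: n_def)
  qed
  have "(\<Prod>i<n. prob (?E i)) = (\<Prod>i<card R. prob (?E (2 * i))) * (\<Prod>i<card R. prob (?E (2 * i + 1)))"
    unfolding split
    by (subst prod.union_disjoint) (auto simp: prod.reindex inj_on_def, presburger)
  also have "\<dots> = (\<Prod>i<card R. prob (?E (2 * i)) * prob (?E (2 * i + 1)))"
    by (simp add: prod.distrib)
  also have "\<dots> = (\<Prod>i<card R. (\<lambda>r. prob {\<omega> \<in> space M. num_points N {z \<in> D r. snd z \<le> s r} \<omega> \<in> B r} *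
               prob {\<omega> \<in> space M. num_points N {z \<in> D r. \<not> snd z \<le> s r} \<omega> = 0}) (m i))"
    by (intro prod.cong refl arg_cong2[where f = "(*)"] arg_cong[where f = prob]) (auto simp: A_def C_def)
  also have "\<dots> = ?R"
    by (rule prod.reindex_bij_betw[OF m])
  finally have A2: "(\<Prod>i<n. prob (?E i)) = ?R" .
  have "(\<Inter>i<n. ?E i) = (\<Inter>r\<in>R. {\<omega> \<in> space M. num_points N {z \<in> D r. snd z \<le> s r} \<omega> \<in> B r \<and> num_points N {z \<in> D r. \<not> snd z \<le> s r} \<omega> = 0})"
  proof -
    have "(\<Inter>i<n. ?E i) = (\<Inter>i<card R. ?E (2 * i) \<inter> ?E (2 * i + 1))"
    proof -
      have "(\<Inter>i\<in>f ` S \<union> g ` S. X i) = (\<Inter>i\<in>S. X (f i) \<inter> X (g i))" for f g :: "nat \<Rightarrow> nat" and X :: "nat \<Rightarrow> 'a set" and S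
        by blast
      then show ?thesis unfolding split .
    qed
    also have "\<dots> = (\<Inter>i<card R. (\<lambda>r. {\<omega> \<in> space M. num_points N {z \<in> D r. snd z \<le> s r} \<omega> \<in> B r \<and> num_points N {z \<in> D r. \<not> snd z \<le> s r} \<omega> = 0}) (m i))"
      by (intro INF_cong refl) (auto simp: A_def C_def)
    also have "\<dots> = (\<Inter>r\<in>m ` {..<card R}. {\<omega> \<in> space M. num_points N {z \<in> D r. snd z \<le> s r} \<omega> \<in> B r \<and> num_points N {z \<in> D r. \<not> snd z \<le> s r} \<omega> = 0})"
      by (simp add: image_image)
    also have "m ` {..<card R} = R" using m by (simp add: bij_betw_def)
    finally show ?thesis .
  qed
  with A1 A2 show ?thesis by simp
qed

text \<open>The events \<open>E r s B\<close> are closed under intersection and generate the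
  sigma-algebra of the pair of count and maximum; their independence is
  \<open>prob_two_level_events\<close> and extends to the generated sigma-algebras. The pair is
  needed because the noise depends on both components.\<close>

lemma (in prob_space) indep_vars_strip_count_max:
  assumes ppp: "poisson_point_process M N \<mu>"
    and sets: "\<And>r s. r \<in> I \<Longrightarrow> {z \<in> D r. snd z \<le> s} \<in> sets \<mu>" "\<And>r. r \<in> I \<Longrightarrow> D r \<in> sets \<mu>"
    and disj: "disjoint_family_on D I"
    and height: "\<And>r z. r \<in> I \<Longrightarrow> z \<in> D r \<Longrightarrow> 0 \<le> snd z \<and> snd z \<le> h"
  shows "indep_vars (\<lambda>_. count_space UNIV \<Otimes>\<^sub>M borel)
    (\<lambda>r \<omega>. (num_points N (D r) \<omega>, strip_max N (D r) \<omega>)) I"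
proof -
  define E where "E = (\<lambda>r s B. {\<omega> \<in> space M. num_points N {z \<in> D r. snd z \<le> s} \<omega> \<in> B \<and> num_points N {z \<in> D r. \<not> snd z \<le> s} \<omega> = 0})"
  define F where "F = (\<lambda>r. {E r s B | s B. True})"
  \<comment> \<open>If no point lies above \<open>s\<close>, the points up to \<open>s\<close> are
    all points, so the event can be written with the full count.\<close>
  have Eeq: "E r s B = {\<omega> \<in> space M. num_points N (D r) \<omega> \<in> B \<and> num_points N {z \<in> D r. \<not> snd z \<le> s} \<omega> = 0}" for r s B
    using num_points_split[of N "D r" _ "\<lambda>z. snd z \<le> s"] by (auto simp: E_def)
  have gt: "{z \<in> D r. \<not> snd z \<le> t} \<in> sets \<mu>" if "r \<in> I" for r t
  proof -
    have "{z \<in> D r. \<not> snd z \<le> t} = D r - {z \<in> D r. snd z \<le> t}" by auto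
    then show ?thesis using sets[OF that] by simp
  qed
  note meas = measurable_num_points[OF ppp]
  have Eev: "E r s B \<in> events" if "r \<in> I" for r s B
  proof -
    have "E r s B = (num_points N {z \<in> D r. snd z \<le> s} -` B \<inter> space M) \<inter> (num_points N {z \<in> D r. \<not> snd z \<le> s} -` {0} \<inter> space M)"
      by (auto simp: E_def)
    then show ?thesis
      using measurable_sets[OF meas[OF sets(1)[OF that]], of B] measurable_sets[OF meas[OF gt[OF that]], of "{0}"]
      by simp
  qed
  have "indep_sets F I"
  proof (rule indep_setsI)
    show "F r \<subseteq> events" if "r \<in> I" for r using Eev[OF that] by (auto simp: F_def)
  next
    fix A J assume J: "J \<noteq> {}" "J \<subseteq> I" "finite J" "\<forall>j\<in>J. A j \<in> F j"
    then have "\<forall>j\<in>J. \<exists>s B. A j = E j s B" by (auto simp: F_def)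
    then obtain s B where A: "\<And>j. j \<in> J \<Longrightarrow> A j = E j (s j) (B j)" by metis
    \<comment> \<open>Stated for subsets \<open>K\<close> of \<open>J\<close>, so that singletons
      also give the probabilities of the single events.\<close>
    have *: "prob (\<Inter>j\<in>K. A j) = (\<Prod>r\<in>K. prob {\<omega> \<in> space M. num_points N {z \<in> D r. snd z \<le> s r} \<omega> \<in> B r} *
               prob {\<omega> \<in> space M. num_points N {z \<in> D r. \<not> snd z \<le> s r} \<omega> = 0})" if K: "K \<subseteq> J" "K \<noteq> {}" for K
    proof -
      have "(\<Inter>j\<in>K. A j) = (\<Inter>j\<in>K. E j (s j) (B j))" using A K by auto
      also have "prob \<dots> = (\<Prod>r\<in>K. prob {\<omega> \<in> space M. num_points N {z \<in> D r. snd z \<le> s r} \<omega> \<in> B r} *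
               prob {\<omega> \<in> space M. num_points N {z \<in> D r. \<not> snd z \<le> s r} \<omega> = 0})"
        unfolding E_def
      proof (rule prob_two_level_events[OF ppp])
        show "disjoint_family_on D K"
          using J K by (intro disjoint_family_on_mono[OF _ disj]) auto
      qed (use J K sets in \<open>auto intro: finite_subset\<close>)
      finally show ?thesis .
    qed
    have "prob (A j) = prob {\<omega> \<in> space M. num_points N {z \<in> D j. snd z \<le> s j} \<omega> \<in> B j} *
               prob {\<omega> \<in> space M. num_points N {z \<in> D j. \<not> snd z \<le> s j} \<omega> = 0}" if "j \<in> J" for j
      using *[of "{j}"] that by simp
    then show "prob (\<Inter>j\<in>J. A j) = (\<Prod>j\<in>J. prob (A j))"
      using *[of J] J by simp
  qed
  moreover have "Int_stable (F r)" for r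
  proof (rule Int_stableI)
    fix a b assume "a \<in> F r" "b \<in> F r"
    then obtain s B s' B' where "a = E r s B" "b = E r s' B'" by (auto simp: F_def)
    then have "a \<inter> b = E r (min s s') (B \<inter> B')"
      unfolding Eeq by (auto simp: num_points_eq_0_iff)
    then show "a \<inter> b \<in> F r" by (auto simp: F_def)
  qed
  ultimately have "indep_sets (\<lambda>r. sigma_sets (space M) (F r)) I"
    by (rule indep_sets_sigma)
  moreover have pair: "(\<lambda>\<omega>. (num_points N (D r) \<omega>, strip_max N (D r) \<omega>)) \<in> measurable (sigma (space M) (F r)) (count_space UNIV \<Otimes>\<^sub>M borel)"
    if r: "r \<in> I" for r
  proof -
    let ?S = "sigma (space M) (F r)"
    have FS: "F r \<subseteq> Pow (space M)" by (auto simp: F_def E_def)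
    have E_S: "E r s B \<in> sets ?S" for s B
      using FS by (auto simp: F_def)
    have "num_points N (D r) \<in> measurable ?S (count_space UNIV)"
    proof (rule measurable_count_space_eq2_countable[THEN iffD2], safe)
      fix j
      \<comment> \<open>Nothing lies above the height \<open>h\<close>, so only the count is
        constrained.\<close>
      have "num_points N (D r) -` {j} \<inter> space ?S = E r h {j}"
        using height[OF r] FS by (auto simp: Eeq num_points_eq_0_iff)
      then show "num_points N (D r) -` {j} \<inter> space ?S \<in> sets ?S" using E_S by simp
    qed auto
    moreover have "strip_max N (D r) \<in> borel_measurable ?S"
    proof (rule borel_measurableI_le)
      fix s :: real
      show "{\<omega> \<in> space ?S. strip_max N (D r) \<omega> \<le> s} \<in> sets ?S"
      proof (cases "0 \<le> s")
        case True
        then have "{\<omega> \<in> space ?S. strip_max N (D r) \<omega> \<le> s} = E r s UNIV"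
          using FS by (auto simp: strip_max_le_iff Eeq)
        then show ?thesis using E_S by simp
      next
        case False
        have "0 \<le> strip_max N (D r) \<omega>" for \<omega>
          by (rule strip_max_bounds[where h = "max h 0"]) (use height[OF r] in \<open>fastforce+\<close>)
        then have "\<not> strip_max N (D r) \<omega> \<le> s" for \<omega> using False order.trans by blast
        then have "{\<omega> \<in> space ?S. strip_max N (D r) \<omega> \<le> s} = {}" by simp
        then show ?thesis by (simp only: sets.empty_sets)
      qed
    qed
    ultimately show ?thesis by (rule measurable_Pair)
  qed
  have FS: "F r \<subseteq> Pow (space M)" for r by (auto simp: F_def E_def)
  have sub: "{(\<lambda>\<omega>. (num_points N (D r) \<omega>, strip_max N (D r) \<omega>)) -` A \<inter> space M | A. A \<in> sets (count_space UNIV \<Otimes>\<^sub>M borel)}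
      \<subseteq> sigma_sets (space M) (F r)" if "r \<in> I" for r
    using measurable_sets[OF pair[OF that]] FS[of r] by auto
  have sev: "sigma_sets (space M) (F r) \<subseteq> events" if "r \<in> I" for r
    using Eev[OF that] by (intro sets.sigma_sets_subset) (auto simp: F_def)
  show ?thesis
    unfolding indep_vars_def2
  proof (intro conjI ballI)
    fix r assume r: "r \<in> I"
    show "random_variable (count_space UNIV \<Otimes>\<^sub>M borel) (\<lambda>\<omega>. (num_points N (D r) \<omega>, strip_max N (D r) \<omega>))"
    proof (rule measurableI)
      fix A :: "(nat \<times> real) set" assume "A \<in> sets (count_space UNIV \<Otimes>\<^sub>M borel)"
      then show "(\<lambda>\<omega>. (num_points N (D r) \<omega>, strip_max N (D r) \<omega>)) -` A \<inter> space M \<in> events"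
        using sub[OF r] sev[OF r] by blast
    qed (simp add: space_pair_measure)
  next
    show "indep_sets (\<lambda>i. {(\<lambda>\<omega>. (num_points N (D i) \<omega>, strip_max N (D i) \<omega>)) -` A \<inter> space M |A. A \<in> sets (count_space UNIV \<Otimes>\<^sub>M borel)}) I"
      by (rule indep_sets_mono_sets) (fact, rule sub)
  qed
qed

text \<open>Continuity of the level function excludes heights carrying mass: every value between 0
  and \<open>\<Lambda>\<close> is then attained as a level, and \<open>T\<close> has a density on
  each event of a fixed positive count.\<close>

locale poisson_strip = prob_space M for M :: "'w measure" +
  fixes N :: "'w \<Rightarrow> (real \<times> real) multiset" and \<mu> :: "(real \<times> real) measure"
    and D :: "(real \<times> real) set" and h :: real
  assumes ppp: "poisson_point_process M N \<mu>"
    and below: "\<And>s. {z \<in> D. snd z \<le> s} \<in> sets \<mu>"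
    and height: "\<And>z. z \<in> D \<Longrightarrow> 0 \<le> snd z \<and> snd z \<le> h" and h: "0 \<le> h"
    and cont: "continuous_on UNIV (level \<mu> D)"
    and pos: "measure \<mu> D > 0"
begin

abbreviation "G \<equiv> level \<mu> D"
abbreviation "\<Lambda> \<equiv> measure \<mu> D"
abbreviation "cnt \<equiv> num_points N D"
abbreviation "top_point \<equiv> strip_max N D"
abbreviation "T \<equiv> (\<lambda>\<omega>. level \<mu> D (strip_max N D \<omega>))"
abbreviation "\<xi> \<equiv> strip_noise N \<mu> D"

lemma finite_measure_\<mu>: "finite_measure \<mu>"
  using ppp by (simp add: poisson_point_process_def)

lemma D_eq: "D = {z \<in> D. snd z \<le> h}" using height by auto

lemma D_sets: "D \<in> sets \<mu>" using below[of h] D_eq by simp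

lemma above: "{z \<in> D. \<not> snd z \<le> s} \<in> sets \<mu>"
proof -
  have "{z \<in> D. \<not> snd z \<le> s} = D - {z \<in> D. snd z \<le> s}" by auto
  then show ?thesis using below D_sets by simp
qed

lemma G_mono: "s \<le> t \<Longrightarrow> G s \<le> G t"
  unfolding level_def using finite_measure_\<mu>
  by (intro finite_measure.finite_measure_mono below) auto

lemma G_nonneg: "0 \<le> G s" by (simp add: level_def)

lemma G_h: "h \<le> s \<Longrightarrow> G s = \<Lambda>"
proof -
  assume "h \<le> s"
  then have "{z \<in> D. snd z \<le> s} = D" using height by fastforce
  then show ?thesis by (simp add: level_def)
qed

lemma G_le: "G s \<le> \<Lambda>"
  using G_mono[of s "max s h"] G_h[of "max s h"] by simp

lemma G_neg: "s < 0 \<Longrightarrow> G s = 0"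
proof -
  assume "s < 0"
  then have "{z \<in> D. snd z \<le> s} = {}" using height by fastforce
  then show ?thesis by (simp only: level_def measure_empty)
qed

text \<open>Negative heights have level 0, and continuity carries this over to the height 0.\<close>

lemma G_0: "G 0 = 0"
proof -
  have "isCont G 0" using cont by (simp add: continuous_on_eq_continuous_at)
  then have "(G \<longlongrightarrow> G 0) (at_left 0)"
    unfolding isCont_def by (rule filterlim_mono) (auto simp: at_within_le_at)
  moreover have "(G \<longlongrightarrow> 0) (at_left 0)"
    by (rule tendsto_eventually) (auto simp: eventually_at_filter G_neg)
  ultimately show ?thesis by (rule tendsto_unique[rotated]) simp
qed

lemma above_measure: "measure \<mu> {z \<in> D. \<not> snd z \<le> s} = \<Lambda> - G s"
proof -
  interpret finite_measure \<mu> by (rule finite_measure_\<mu>)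
  have "measure \<mu> (D - {z \<in> D. snd z \<le> s}) = \<Lambda> - G s"
    unfolding level_def by (rule finite_measure_Diff) (auto intro: D_sets below)
  moreover have "D - {z \<in> D. snd z \<le> s} = {z \<in> D. \<not> snd z \<le> s}" by auto
  ultimately show ?thesis by simp
qed

lemma measurable_cnt [measurable]: "cnt \<in> measurable M (count_space UNIV)"
  by (rule measurable_num_points[OF ppp D_sets])

lemma measurable_top [measurable]: "top_point \<in> borel_measurable M"
proof -
  \<comment> \<open>A one-element family: its independence is used only for the measurability it
    contains.\<close>
  have "indep_vars (\<lambda>_. count_space UNIV \<Otimes>\<^sub>M borel) (\<lambda>r \<omega>. (cnt \<omega>, top_point \<omega>)) {0::nat}"
    by (rule indep_vars_strip_count_max[OF ppp, of "{0}" "\<lambda>_. D" h])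
       (simp_all add: below D_sets height disjoint_family_on_def)
  then have "(\<lambda>\<omega>. (cnt \<omega>, top_point \<omega>)) \<in> measurable M (count_space UNIV \<Otimes>\<^sub>M borel)"
    by (simp add: indep_vars_def)
  from measurable_compose[OF this measurable_snd] show ?thesis by simp
qed

lemma measurable_G [measurable]: "G \<in> borel_measurable borel"
  using cont by (rule borel_measurable_continuous_onI)

lemma prob_points:
  assumes "A \<in> sets \<mu>"
  shows "prob {\<omega> \<in> space M. num_points N A \<omega> = j} = measure \<mu> A ^ j / fact j * exp (- measure \<mu> A)"
  using ppp assms by (simp add: poisson_point_process_def)

text \<open>The event says that \<open>j\<close> points lie up to \<open>s\<close> and none above.
  The two counts are independent Poisson variables, and their exponential factors multiply to
  \<open>exp (- \<Lambda>)\<close>.\<close>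

lemma prob_count_le_level:
  assumes "0 \<le> s"
  shows "prob {\<omega> \<in> space M. cnt \<omega> = j \<and> top_point \<omega> \<le> s} = G s ^ j / fact j * exp (- \<Lambda>)"
proof -
  have "prob (\<Inter>r\<in>{0::nat}. {\<omega> \<in> space M. num_points N {z \<in> D. snd z \<le> s} \<omega> \<in> {j} \<and> num_points N {z \<in> D. \<not> snd z \<le> s} \<omega> = 0})
    = (\<Prod>r\<in>{0::nat}. prob {\<omega> \<in> space M. num_points N {z \<in> D. snd z \<le> s} \<omega> \<in> {j}} *
               prob {\<omega> \<in> space M. num_points N {z \<in> D. \<not> snd z \<le> s} \<omega> = 0})"
    by (rule prob_two_level_events[OF ppp, where D = "\<lambda>_. D"])
       (auto intro: below D_sets simp: disjoint_family_on_def)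
  then have "prob {\<omega> \<in> space M. num_points N {z \<in> D. snd z \<le> s} \<omega> = j \<and> num_points N {z \<in> D. \<not> snd z \<le> s} \<omega> = 0}
      = prob {\<omega> \<in> space M. num_points N {z \<in> D. snd z \<le> s} \<omega> = j} * prob {\<omega> \<in> space M. num_points N {z \<in> D. \<not> snd z \<le> s} \<omega> = 0}"
    by simp
  also have "\<dots> = G s ^ j / fact j * exp (- G s) * exp (- (\<Lambda> - G s))"
    by (simp only: prob_points[OF below] prob_points[OF above] above_measure level_def[symmetric]) simp
  also have "\<dots> = G s ^ j / fact j * exp (- \<Lambda>)"
    by (simp flip: exp_add)
  also have "{\<omega> \<in> space M. num_points N {z \<in> D. snd z \<le> s} \<omega> = j \<and> num_points N {z \<in> D. \<not> snd z \<le> s} \<omega> = 0}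
      = {\<omega> \<in> space M. cnt \<omega> = j \<and> top_point \<omega> \<le> s}"
    using num_points_split[of N D _ "\<lambda>z. snd z \<le> s"] by (auto simp: strip_max_le_iff[OF assms])
  finally show ?thesis .
qed

text \<open>Of all heights with level \<open>\<tau>\<close> the largest one is chosen, so that flat pieces of the level
  function do no harm.\<close>

lemma level_quantile:
  assumes "0 \<le> \<tau>" "\<tau> < \<Lambda>"
  obtains s where "0 \<le> s" "G s = \<tau>" "\<And>y. G y \<le> \<tau> \<longleftrightarrow> y \<le> s"
proof -
  let ?S = "{s \<in> {0..h}. G s \<le> \<tau>}"
  have cG: "continuous_on A G" for A using cont continuous_on_subset by blast
  have "closed ?S"
    using continuous_closed_preimage[OF cG[of "{0..h}"], of "{..\<tau>}"]
    by (simp add: vimage_def Int_def conj_commute)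
  then have "compact ({0..h} \<inter> ?S)" by (intro compact_Int_closed) auto
  also have "{0..h} \<inter> ?S = ?S" by auto
  finally have "compact ?S" .
  moreover have "0 \<in> ?S" using h assms by (simp add: G_0)
  ultimately obtain s where s: "s \<in> ?S" "\<And>t. t \<in> ?S \<Longrightarrow> t \<le> s"
    using compact_attains_sup[of ?S] by blast
  have max: "y \<le> s" if "G y \<le> \<tau>" for y
  proof -
    have "y \<le> h" using G_h[of y] that assms by (cases "y \<le> h") auto
    then show ?thesis using s that by (cases "0 \<le> y") auto
  qed
  have "G s = \<tau>"
  proof (rule ccontr)
    assume "G s \<noteq> \<tau>"
    with s have "G s \<le> \<tau>" "\<tau> \<le> G h" "s \<le> h" using assms G_h[of h] by auto
    then obtain t where "s \<le> t" "G t = \<tau>"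
      using IVT'[of G s \<tau> h] cG by auto
    moreover from this have "t \<noteq> s" using \<open>G s \<noteq> \<tau>\<close> by auto
    ultimately show False using max[of t] by simp
  qed
  moreover have "G y \<le> \<tau> \<longleftrightarrow> y \<le> s" for y
    using max[of y] G_mono[of y s] \<open>G s = \<tau>\<close> by auto
  moreover have "0 \<le> s" using s by simp
  ultimately show ?thesis by (intro that)
qed

lemma prob_count_le_T:
  assumes "0 \<le> \<tau>" "\<tau> < \<Lambda>"
  shows "prob {\<omega> \<in> space M. cnt \<omega> = j \<and> T \<omega> \<le> \<tau>} = \<tau> ^ j / fact j * exp (- \<Lambda>)"
proof -
  obtain s where s: "0 \<le> s" "G s = \<tau>" "\<And>y. G y \<le> \<tau> \<longleftrightarrow> y \<le> s"
    using level_quantile[OF assms] by blast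
  then show ?thesis using prob_count_le_level[OF s(1), of j] by simp
qed

lemma prob_count: "prob {\<omega> \<in> space M. cnt \<omega> = j} = \<Lambda> ^ j / fact j * exp (- \<Lambda>)"
  by (rule prob_points[OF D_sets])

text \<open>Clamping \<open>\<tau>\<close> to the range of \<open>T\<close> makes the formula valid
  for every real \<open>\<tau>\<close>, as needed to identify a measure by its values on
  half-lines.\<close>

lemma prob_count_gt_T:
  assumes "j \<ge> 1"
  shows "prob {\<omega> \<in> space M. cnt \<omega> = j \<and> T \<omega> > \<tau>} = exp (- \<Lambda>) / fact j * (\<Lambda> ^ j - (max 0 (min \<tau> \<Lambda>)) ^ j)"
proof -
  consider "\<tau> < 0" | "0 \<le> \<tau>" "\<tau> < \<Lambda>" | "\<Lambda> \<le> \<tau>" by linarith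
  then show ?thesis
  proof cases
    case 1
    then have "{\<omega> \<in> space M. cnt \<omega> = j \<and> T \<omega> > \<tau>} = {\<omega> \<in> space M. cnt \<omega> = j}"
      using G_nonneg order.strict_trans2 by blast
    then show ?thesis using 1 pos assms by (simp add: prob_count)
  next
    case 2
    have "prob {\<omega> \<in> space M. cnt \<omega> = j} = prob ({\<omega> \<in> space M. cnt \<omega> = j \<and> T \<omega> \<le> \<tau>} \<union> {\<omega> \<in> space M. cnt \<omega> = j \<and> T \<omega> > \<tau>})"
      by (rule arg_cong[where f = prob]) auto
    also have "\<dots> = prob {\<omega> \<in> space M. cnt \<omega> = j \<and> T \<omega> \<le> \<tau>} + prob {\<omega> \<in> space M. cnt \<omega> = j \<and> T \<omega> > \<tau>}"
      by (rule finite_measure_Union) auto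
    finally show ?thesis
      using 2 by (simp add: prob_count prob_count_le_T field_simps)
  next
    case 3
    then have e: "{\<omega> \<in> space M. cnt \<omega> = j \<and> T \<omega> > \<tau>} = {}"
      using G_le order.trans not_le by blast
    show ?thesis unfolding e using 3 pos by simp
  qed
qed

text \<open>The restriction of \<open>M\<close> to a count of \<open>j\<close> is not normalized;
  both sides are finite and agree on the half-lines \<open>{\<tau><..}\<close>. The density is the
  derivative of \<open>exp (- \<Lambda>) * u ^ j / fact j\<close>.\<close>

lemma distr_T_count:
  assumes j: "j \<ge> 1"
  shows "distr (density M (\<lambda>\<omega>. indicator {\<omega> \<in> space M. cnt \<omega> = j} \<omega>)) borel T
    = density lborel (\<lambda>u. ennreal (exp (- \<Lambda>) / fact j * (real j * u ^ (j - 1)) * indicator {0..\<Lambda>} u))"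
    (is "?L = ?R")
proof (rule measure_eqI_lessThan)
  have L: "emeasure ?L {\<tau><..} = ennreal (exp (- \<Lambda>) / fact j * (\<Lambda> ^ j - (max 0 (min \<tau> \<Lambda>)) ^ j))" for \<tau>
  proof -
    have "emeasure ?L {\<tau><..} = emeasure (density M (\<lambda>\<omega>. indicator {\<omega> \<in> space M. cnt \<omega> = j} \<omega>)) (T -` {\<tau><..} \<inter> space M)"
      by (subst emeasure_distr) auto
    also have "\<dots> = (\<integral>\<^sup>+\<omega>. indicator {\<omega> \<in> space M. cnt \<omega> = j} \<omega> * indicator (T -` {\<tau><..} \<inter> space M) \<omega> \<partial>M)"
      by (subst emeasure_density) auto
    also have "\<dots> = (\<integral>\<^sup>+\<omega>. indicator {\<omega> \<in> space M. cnt \<omega> = j \<and> T \<omega> > \<tau>} \<omega> \<partial>M)"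
      by (intro nn_integral_cong) (auto split: split_indicator)
    also have "\<dots> = emeasure M {\<omega> \<in> space M. cnt \<omega> = j \<and> T \<omega> > \<tau>}"
      by (subst nn_integral_indicator) auto
    finally show ?thesis
      using prob_count_gt_T[OF j] by (simp add: emeasure_eq_measure)
  qed
  then show "emeasure ?L {\<tau><..} < \<infinity>" for \<tau> by simp
  fix \<tau>
  define a where "a = max 0 (min \<tau> \<Lambda>)"
  have a: "0 \<le> a" "a \<le> \<Lambda>" using pos by (auto simp: a_def)
  have "emeasure ?R {\<tau><..} = (\<integral>\<^sup>+u. ennreal (exp (- \<Lambda>) / fact j * (real j * u ^ (j - 1)) * indicator {0..\<Lambda>} u) * indicator {\<tau><..} u \<partial>lborel)"
    by (subst emeasure_density) auto
  also have "\<dots> = (\<integral>\<^sup>+u. ennreal (exp (- \<Lambda>) / fact j * (real j * u ^ (j - 1))) * indicator {a..\<Lambda>} u \<partial>lborel)"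
  proof (rule nn_integral_cong_AE)
    show "AE u in lborel. ennreal (exp (- \<Lambda>) / fact j * (real j * u ^ (j - 1)) * indicator {0..\<Lambda>} u) * indicator {\<tau><..} u
        = ennreal (exp (- \<Lambda>) / fact j * (real j * u ^ (j - 1))) * indicator {a..\<Lambda>} u"
      using AE_lborel_singleton[of a] AE_lborel_singleton[of \<Lambda>]
    proof eventually_elim
      case (elim u)
      have "(u \<in> {0..\<Lambda>} \<and> u \<in> {\<tau><..}) \<longleftrightarrow> u \<in> {a..\<Lambda>}"
        using elim by (auto simp: a_def min_def max_def split: if_splits)
      then show ?case by (auto split: split_indicator)
    qed
  qed
  also have "\<dots> = exp (- \<Lambda>) / fact j * \<Lambda> ^ j - exp (- \<Lambda>) / fact j * a ^ j"
    by (rule nn_integral_FTC_Icc) (use a in \<open>auto intro!: derivative_eq_intros\<close>)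
  finally show "emeasure ?L {\<tau><..} = emeasure ?R {\<tau><..}"
    by (simp add: L a_def right_diff_distrib)
qed simp_all

lemma T_bounds: "0 \<le> T \<omega>" "T \<omega> \<le> \<Lambda>"
  by (simp_all only: G_nonneg G_le)

text \<open>Given a count of \<open>j\<close>, \<open>T / \<Lambda>\<close> has the Beta(j, 1) law
  of a maximum of uniforms, with \<open>q\<close>-th moment \<open>j / (j + q)\<close>.\<close>

lemma moment_T_count:
  assumes j: "j \<ge> 1"
  shows "expectation (\<lambda>\<omega>. indicator {\<omega> \<in> space M. cnt \<omega> = j} \<omega> * T \<omega> ^ q)
    = \<Lambda> ^ j / fact j * exp (- \<Lambda>) * (\<Lambda> ^ q * (real j / (real j + real q)))"
proof -
  let ?A = "{\<omega> \<in> space M. cnt \<omega> = j}"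
  have A [measurable]: "?A \<in> events" by measurable
  have Tm [measurable]: "T \<in> borel_measurable M" by measurable
  have Tq: "(\<lambda>\<omega>. T \<omega> ^ q) \<in> borel_measurable M" by (rule borel_measurable_power[OF Tm])
  have "(\<integral>\<omega>. T \<omega> ^ q \<partial>density M (\<lambda>\<omega>. ennreal (indicator ?A \<omega>))) = expectation (\<lambda>\<omega>. indicator ?A \<omega> *\<^sub>R T \<omega> ^ q)"
    by (rule integral_density[OF Tq]) (rule borel_measurable_indicator[OF A], simp)
  moreover have "(\<lambda>\<omega>. ennreal (indicator ?A \<omega>)) = indicator ?A" by (rule ext) (simp split: split_indicator)
  ultimately have "expectation (\<lambda>\<omega>. indicator ?A \<omega> * T \<omega> ^ q) = (\<integral>\<omega>. T \<omega> ^ q \<partial>density M (indicator ?A))"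
    by (simp only: real_scaleR_def)
  also have "\<dots> = (\<integral>u. u ^ q \<partial>distr (density M (indicator ?A)) borel T)"
    by (rule integral_distr[symmetric]) (simp_all add: Tm)
  also have "\<dots> = (\<integral>u. u ^ q \<partial>density lborel (\<lambda>u. ennreal (exp (- \<Lambda>) / fact j * (real j * u ^ (j - 1)) * indicator {0..\<Lambda>} u)))"
    by (simp only: distr_T_count[OF j])
  also have "\<dots> = (\<integral>u. (exp (- \<Lambda>) / fact j * (real j * u ^ (j - 1 + q))) * indicator {0..\<Lambda>} u \<partial>lborel)"
    by (subst integral_density) (auto intro!: AE_I2 Bochner_Integration.integral_cong simp: power_add split: split_indicator)
  also have "\<dots> = exp (- \<Lambda>) / fact j * (real j * \<Lambda> ^ (j + q) / (real j + real q)) - exp (- \<Lambda>) / fact j * (real j * 0 ^ (j + q) / (real j + real q))"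
  proof (rule integral_FTC_Icc_nonneg[where F = "\<lambda>u. exp (- \<Lambda>) / fact j * (real j * u ^ (j + q) / (real j + real q))"])
    fix u assume u: "u \<in> {0..\<Lambda>}"
    have e: "j + q - 1 = j - 1 + q" using j by simp
    show "((\<lambda>u. exp (- \<Lambda>) / fact j * (real j * u ^ (j + q) / (real j + real q))) has_real_derivative
        exp (- \<Lambda>) / fact j * (real j * u ^ (j - 1 + q))) (at u)"
      using j by (auto intro!: derivative_eq_intros simp: e)
    show "0 \<le> exp (- \<Lambda>) / fact j * (real j * u ^ (j - 1 + q))" using u by simp
  qed (use pos in auto)
  also have "\<dots> = \<Lambda> ^ j / fact j * exp (- \<Lambda>) * (\<Lambda> ^ q * (real j / (real j + real q)))"
    using j by (simp add: power_add zero_power)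
  finally show ?thesis .
qed

section \<open>Moments of the noise\<close>

definition pois :: "nat \<Rightarrow> real" where
  "pois j = \<Lambda> ^ j / fact j * exp (- \<Lambda>)"

lemma pois_nonneg: "pois j \<ge> 0" using pos by (simp add: pois_def)

text \<open>Trades a factor \<open>\<Lambda>\<close> for a shift of the index. This turns the moment
  series into shifted Poisson sums, which are at most 1.\<close>

lemma pois_Suc: "real (Suc j) * pois (Suc j) = \<Lambda> * pois j"
  unfolding pois_def fact_Suc of_nat_mult by (simp add: divide_simps del: of_nat_Suc)

lemma pois_sums: "pois sums 1"
proof -
  have "(\<lambda>j. \<Lambda> ^ j /\<^sub>R fact j * exp (- \<Lambda>)) sums (exp \<Lambda> * exp (- \<Lambda>))"
    by (intro sums_mult2 exp_converges)
  then show ?thesis unfolding pois_def[abs_def] by (simp add: divide_inverse_commute exp_minus_inverse)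
qed

text \<open>The partial sums are the expectations over \<open>cnt < n\<close>, so dominated
  convergence with the bound \<open>\<bar>F\<bar>\<close> applies.\<close>

lemma sums_over_count:
  fixes F :: "'w \<Rightarrow> real"
  assumes F: "integrable M F"
  shows "(\<lambda>j. expectation (\<lambda>\<omega>. indicator {\<omega> \<in> space M. cnt \<omega> = j} \<omega> * F \<omega>)) sums expectation F"
proof -
  have [measurable]: "F \<in> borel_measurable M" using F by simp
  have ev [measurable]: "{\<omega> \<in> space M. cnt \<omega> = j} \<in> events" for j by measurable
  have "(\<lambda>n. expectation (\<lambda>\<omega>. indicator {\<omega> \<in> space M. cnt \<omega> < n} \<omega> * F \<omega>)) \<longlonglongrightarrow> expectation F"
  proof (rule integral_dominated_convergence[where w = "\<lambda>\<omega>. \<bar>F \<omega>\<bar>"])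
    show "AE \<omega> in M. (\<lambda>n. indicator {\<omega> \<in> space M. cnt \<omega> < n} \<omega> * F \<omega>) \<longlonglongrightarrow> F \<omega>"
    proof (rule AE_I2)
      fix \<omega> assume \<omega>: "\<omega> \<in> space M"
      show "(\<lambda>n. indicator {\<omega> \<in> space M. cnt \<omega> < n} \<omega> * F \<omega>) \<longlonglongrightarrow> F \<omega>"
        by (rule tendsto_eventually, rule eventually_mono[OF eventually_gt_at_top[of "cnt \<omega>"]]) (simp add: \<omega>)
    qed
    show "AE \<omega> in M. norm (indicator {\<omega> \<in> space M. cnt \<omega> < n} \<omega> * F \<omega>) \<le> \<bar>F \<omega>\<bar>" for n
      by (rule AE_I2) (simp split: split_indicator)
    show "(\<lambda>\<omega>. indicator {\<omega> \<in> space M. cnt \<omega> < n} \<omega> * F \<omega>) \<in> borel_measurable M" for n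
      by measurable
  qed (use F in simp_all)
  moreover have "expectation (\<lambda>\<omega>. indicator {\<omega> \<in> space M. cnt \<omega> < n} \<omega> * F \<omega>)
      = (\<Sum>j<n. expectation (\<lambda>\<omega>. indicator {\<omega> \<in> space M. cnt \<omega> = j} \<omega> * F \<omega>))" for n
  proof -
    have "integrable M (\<lambda>\<omega>. indicator {\<omega> \<in> space M. cnt \<omega> = j} \<omega> * F \<omega>)" for j
      using integrable_mult_indicator[OF ev F, of j] by simp
    then have "(\<Sum>j<n. expectation (\<lambda>\<omega>. indicator {\<omega> \<in> space M. cnt \<omega> = j} \<omega> * F \<omega>))
        = expectation (\<lambda>\<omega>. \<Sum>j<n. indicator {\<omega> \<in> space M. cnt \<omega> = j} \<omega> * F \<omega>)"
      by (intro Bochner_Integration.integral_sum[symmetric])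
    also have "\<dots> = expectation (\<lambda>\<omega>. indicator {\<omega> \<in> space M. cnt \<omega> < n} \<omega> * F \<omega>)"
    proof (rule Bochner_Integration.integral_cong[OF refl])
      fix \<omega> assume \<omega>: "\<omega> \<in> space M"
      have "(\<Sum>j<n. indicator {\<omega> \<in> space M. cnt \<omega> = j} \<omega> * F \<omega>) = (\<Sum>j<n. if cnt \<omega> = j then F \<omega> else 0)"
        by (intro sum.cong) (auto simp: \<omega>)
      also have "\<dots> = (if cnt \<omega> \<in> {..<n} then F \<omega> else 0)"
        by (rule sum.delta') simp
      also have "\<dots> = indicator {\<omega> \<in> space M. cnt \<omega> < n} \<omega> * F \<omega>"
        by (simp add: \<omega> split: split_indicator)
      finally show "(\<Sum>j<n. indicator {\<omega> \<in> space M. cnt \<omega> = j} \<omega> * F \<omega>) = indicator {\<omega> \<in> space M. cnt \<omega> < n} \<omega> * F \<omega>" .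
    qed
    finally show ?thesis by simp
  qed
  ultimately show ?thesis by (simp add: sums_def)
qed

lemma measurable_noise [measurable]: "\<xi> \<in> borel_measurable M"
  unfolding strip_noise_def[abs_def] by measurable

lemma noise_bound: "\<bar>\<xi> \<omega>\<bar> \<le> 2 * \<Lambda>"
proof (cases "cnt \<omega> = 0")
  case True
  then show ?thesis by (simp add: strip_noise_def)
next
  case False
  define a where "a = 1 + 1 / real (cnt \<omega>)"
  have a: "0 \<le> a" "a \<le> 2" using False by (auto simp: a_def divide_le_eq)
  have "a * T \<omega> \<le> 2 * \<Lambda>" using a T_bounds[of \<omega>] by (intro mult_mono) auto
  moreover have "0 \<le> a * T \<omega>" using a T_bounds[of \<omega>] by simp
  moreover have "\<xi> \<omega> = a * T \<omega> - \<Lambda>" using False by (simp add: strip_noise_def a_def)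
  ultimately show ?thesis using pos by linarith
qed

lemma integrable_noise_power: "integrable M (\<lambda>\<omega>. \<xi> \<omega> ^ q)"
proof (rule integrable_const_bound[of _ "(2 * \<Lambda>) ^ q"])
  show "AE \<omega> in M. norm (\<xi> \<omega> ^ q) \<le> (2 * \<Lambda>) ^ q"
    by (rule AE_I2, unfold real_norm_def power_abs, intro power_mono noise_bound abs_ge_zero)
qed measurable

lemma noise_power_count:
  "expectation (\<lambda>\<omega>. indicator {\<omega> \<in> space M. cnt \<omega> = 0} \<omega> * \<xi> \<omega>) = 0"
  "expectation (\<lambda>\<omega>. indicator {\<omega> \<in> space M. cnt \<omega> = 0} \<omega> * \<xi> \<omega> ^ Suc q) = 0"
  by (rule integral_eq_zero_AE, rule AE_I2, simp add: strip_noise_def split: split_indicator)+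

text \<open>On a count of \<open>j\<close> the noise is \<open>a * T - \<Lambda>\<close>, where
  \<open>a = (j + 1) / j\<close> is the reciprocal of the conditional mean of
  \<open>T / \<Lambda>\<close>. Binomial expansion with the Beta moments leaves rational functions
  of \<open>j\<close>; cancellation brings the last one down to order \<open>j^(-4)\<close>, which
  compensates \<open>\<Lambda> ^ 4\<close>.\<close>

lemma noise_moments_count:
  assumes j: "j \<ge> 1"
  defines "x \<equiv> real j"
  shows "expectation (\<lambda>\<omega>. indicator {\<omega> \<in> space M. cnt \<omega> = j} \<omega> * \<xi> \<omega>) = 0"
    and "expectation (\<lambda>\<omega>. indicator {\<omega> \<in> space M. cnt \<omega> = j} \<omega> * \<xi> \<omega> ^ 2) = pois j * \<Lambda>\<^sup>2 / (x * (x + 2))"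
    and "expectation (\<lambda>\<omega>. indicator {\<omega> \<in> space M. cnt \<omega> = j} \<omega> * \<xi> \<omega> ^ 4)
      = pois j * \<Lambda> ^ 4 * ((9 * x\<^sup>2 - 3 * x + 6) / (x ^ 3 * (x + 2) * (x + 3) * (x + 4)))"
proof -
  let ?I = "indicator {\<omega> \<in> space M. cnt \<omega> = j} :: 'w \<Rightarrow> real"
  have x: "x \<ge> 1" using j by (simp add: x_def)
  define a where "a = 1 + 1 / x"
  have ev: "{\<omega> \<in> space M. cnt \<omega> = j} \<in> events" by measurable
  have int: "integrable M (\<lambda>\<omega>. ?I \<omega> * T \<omega> ^ q)" for q
  proof -
    have "integrable M (\<lambda>\<omega>. T \<omega> ^ q)"
      by (rule integrable_const_bound[of _ "\<Lambda> ^ q"]) (auto simp: power_abs G_nonneg intro!: power_mono G_le)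
    then show ?thesis using integrable_mult_indicator[OF ev, of "\<lambda>\<omega>. T \<omega> ^ q"] by simp
  qed
  have m: "expectation (\<lambda>\<omega>. ?I \<omega> * T \<omega> ^ q) = pois j * (\<Lambda> ^ q * (x / (x + real q)))" for q
    using moment_T_count[OF j, of q] by (simp add: pois_def x_def)
  have noise: "?I \<omega> * \<xi> \<omega> ^ q = ?I \<omega> * (a * T \<omega> - \<Lambda>) ^ q" for \<omega> q
    using j by (auto simp: strip_noise_def a_def x_def split: split_indicator)
  have "expectation (\<lambda>\<omega>. ?I \<omega> * \<xi> \<omega>) = expectation (\<lambda>\<omega>. a * (?I \<omega> * T \<omega> ^ 1) - \<Lambda> * (?I \<omega> * T \<omega> ^ 0))"
    using noise[of _ 1] by (intro Bochner_Integration.integral_cong refl) (simp add: algebra_simps)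
  also have "\<dots> = a * (pois j * (\<Lambda> ^ 1 * (x / (x + real 1)))) - \<Lambda> * (pois j * (\<Lambda> ^ 0 * (x / (x + real 0))))"
    by (subst Bochner_Integration.integral_diff; (intro integrable_mult_right int)?) (simp only: integral_mult_right_zero m)
  also have "\<dots> = pois j * \<Lambda> * (a * (x / (x + 1)) - x / x)" by (simp add: algebra_simps)
  also have "a * (x / (x + 1)) = 1" using x by (simp add: a_def divide_simps)
  also have "pois j * \<Lambda> * (1 - x / x) = 0" using x by simp
  finally show "expectation (\<lambda>\<omega>. ?I \<omega> * \<xi> \<omega>) = 0" .
  have "expectation (\<lambda>\<omega>. ?I \<omega> * \<xi> \<omega> ^ 2)
      = expectation (\<lambda>\<omega>. a\<^sup>2 * (?I \<omega> * T \<omega> ^ 2) + (- 2 * a * \<Lambda>) * (?I \<omega> * T \<omega> ^ 1) + \<Lambda>\<^sup>2 * (?I \<omega> * T \<omega> ^ 0))"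
    unfolding noise by (intro Bochner_Integration.integral_cong refl) (simp add: power2_eq_square algebra_simps)
  also have "\<dots> = a\<^sup>2 * (pois j * (\<Lambda> ^ 2 * (x / (x + real 2)))) + (- 2 * a * \<Lambda>) * (pois j * (\<Lambda> ^ 1 * (x / (x + real 1))))
      + \<Lambda>\<^sup>2 * (pois j * (\<Lambda> ^ 0 * (x / (x + real 0))))"
    by (simp only: Bochner_Integration.integral_add integrable_mult_right int Bochner_Integration.integrable_add integral_mult_right_zero m)
  also have "\<dots> = pois j * \<Lambda>\<^sup>2 * (a\<^sup>2 * (x / (x + 2)) - 2 * a * (x / (x + 1)) + 1)"
    using x by (simp add: power2_eq_square algebra_simps)
  also have "a\<^sup>2 * (x / (x + 2)) - 2 * a * (x / (x + 1)) + 1 = 1 / (x * (x + 2))"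
    using x by (simp add: a_def divide_simps) (simp add: algebra_simps power2_eq_square)
  finally show "expectation (\<lambda>\<omega>. ?I \<omega> * \<xi> \<omega> ^ 2) = pois j * \<Lambda>\<^sup>2 / (x * (x + 2))" by simp
  have "expectation (\<lambda>\<omega>. ?I \<omega> * \<xi> \<omega> ^ 4)
      = expectation (\<lambda>\<omega>. a ^ 4 * (?I \<omega> * T \<omega> ^ 4) + (- 4 * a ^ 3 * \<Lambda>) * (?I \<omega> * T \<omega> ^ 3) + (6 * a\<^sup>2 * \<Lambda>\<^sup>2) * (?I \<omega> * T \<omega> ^ 2)
         + (- 4 * a * \<Lambda> ^ 3) * (?I \<omega> * T \<omega> ^ 1) + \<Lambda> ^ 4 * (?I \<omega> * T \<omega> ^ 0))"
    unfolding noise by (intro Bochner_Integration.integral_cong refl) (simp add: power4_eq_xxxx power2_eq_square power3_eq_cube algebra_simps)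
  also have "\<dots> = a ^ 4 * (pois j * (\<Lambda> ^ 4 * (x / (x + real 4)))) + (- 4 * a ^ 3 * \<Lambda>) * (pois j * (\<Lambda> ^ 3 * (x / (x + real 3))))
      + (6 * a\<^sup>2 * \<Lambda>\<^sup>2) * (pois j * (\<Lambda> ^ 2 * (x / (x + real 2)))) + (- 4 * a * \<Lambda> ^ 3) * (pois j * (\<Lambda> ^ 1 * (x / (x + real 1))))
      + \<Lambda> ^ 4 * (pois j * (\<Lambda> ^ 0 * (x / (x + real 0))))"
    by (simp only: Bochner_Integration.integral_add integrable_mult_right int Bochner_Integration.integrable_add integral_mult_right_zero m)
  also have "\<dots> = pois j * \<Lambda> ^ 4 * (a ^ 4 * (x / (x + 4)) - 4 * a ^ 3 * (x / (x + 3)) + 6 * a\<^sup>2 * (x / (x + 2)) - 4 * a * (x / (x + 1)) + 1)"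
    using x by (simp add: power2_eq_square power4_eq_xxxx power3_eq_cube algebra_simps)
  also have "a ^ 4 * (x / (x + 4)) - 4 * a ^ 3 * (x / (x + 3)) + 6 * a\<^sup>2 * (x / (x + 2)) - 4 * a * (x / (x + 1)) + 1
      = (9 * x\<^sup>2 - 3 * x + 6) / (x ^ 3 * (x + 2) * (x + 3) * (x + 4))"
  proof -
    have a: "a = (x + 1) / x" using x by (simp add: a_def add_divide_distrib)
    have e: "a ^ 4 * (x / (x + 4)) = (x + 1) ^ 4 / (x ^ 3 * (x + 4))"
      "a ^ 3 * (x / (x + 3)) = (x + 1) ^ 3 / (x\<^sup>2 * (x + 3))"
      "a\<^sup>2 * (x / (x + 2)) = (x + 1) ^ 2 / (x * (x + 2))"
      "a * (x / (x + 1)) = 1"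
      using x by (simp_all add: a power_divide power4_eq_xxxx power3_eq_cube power2_eq_square)
    have "a ^ 4 * (x / (x + 4)) - 4 * a ^ 3 * (x / (x + 3)) + 6 * a\<^sup>2 * (x / (x + 2)) - 4 * a * (x / (x + 1)) + 1
        = (x + 1) ^ 4 / (x ^ 3 * (x + 4)) - 4 * ((x + 1) ^ 3 / (x\<^sup>2 * (x + 3))) + 6 * ((x + 1) ^ 2 / (x * (x + 2))) - 3"
      unfolding mult.assoc e by simp
    also have "\<dots> = ((x + 1) ^ 4 * ((x + 2) * (x + 3)) - 4 * (x + 1) ^ 3 * (x * (x + 2) * (x + 4))
        + 6 * (x + 1) ^ 2 * (x\<^sup>2 * (x + 3) * (x + 4)) - 3 * (x ^ 3 * (x + 2) * (x + 3) * (x + 4))) / (x ^ 3 * (x + 2) * (x + 3) * (x + 4))"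
      using x by (simp add: diff_divide_distrib add_divide_distrib power3_eq_cube power2_eq_square)
    also have "(x + 1) ^ 4 * ((x + 2) * (x + 3)) - 4 * (x + 1) ^ 3 * (x * (x + 2) * (x + 4))
        + 6 * (x + 1) ^ 2 * (x\<^sup>2 * (x + 3) * (x + 4)) - 3 * (x ^ 3 * (x + 2) * (x + 3) * (x + 4)) = 9 * x\<^sup>2 - 3 * x + 6"
      by algebra
    finally show ?thesis .
  qed
  finally show "expectation (\<lambda>\<omega>. ?I \<omega> * \<xi> \<omega> ^ 4)
      = pois j * \<Lambda> ^ 4 * ((9 * x\<^sup>2 - 3 * x + 6) / (x ^ 3 * (x + 2) * (x + 3) * (x + 4)))" .
qed

lemma noise_mean: "expectation \<xi> = 0"
proof -
  have z: "expectation (\<lambda>\<omega>. indicator {\<omega> \<in> space M. cnt \<omega> = j} \<omega> * \<xi> \<omega>) = 0" for j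
    using noise_moments_count(1)[of j] noise_power_count(1) by (cases "j = 0") auto
  have "(\<lambda>j. 0) sums expectation \<xi>"
    using sums_over_count[of \<xi>] integrable_noise_power[of 1] unfolding z by simp
  then show ?thesis using sums_unique2 sums_zero by blast
qed

text \<open>An index shift by 2 turns the \<open>j\<close>-th term into
  \<open>(1 + 1 / j) * pois (j + 2)\<close>. The sum is therefore 1 up to two errors of order
  \<open>1 / \<Lambda>\<close>: the correction \<open>1 / j\<close>, and the Poisson mass at 0, 1
  and 2, which the shifted series misses.\<close>

lemma noise_variance: "\<bar>expectation (\<lambda>\<omega>. (\<xi> \<omega>)\<^sup>2) - 1\<bar> \<le> 4 / \<Lambda>"
proof -
  define s where "s = (\<lambda>j. expectation (\<lambda>\<omega>. indicator {\<omega> \<in> space M. cnt \<omega> = j} \<omega> * (\<xi> \<omega>)\<^sup>2))"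
  have s: "s sums expectation (\<lambda>\<omega>. (\<xi> \<omega>)\<^sup>2)"
    unfolding s_def by (rule sums_over_count[OF integrable_noise_power])
  have shift2: "(real j + 1) * (real j + 2) * pois (j + 2) = \<Lambda>\<^sup>2 * pois j" for j
  proof -
    have "(real j + 1) * pois (j + 1) = \<Lambda> * pois j" "(real j + 2) * pois (j + 2) = \<Lambda> * pois (j + 1)"
      using pois_Suc[of j] pois_Suc[of "j + 1"] by (simp_all add: algebra_simps eval_nat_numeral)
    then show ?thesis by algebra
  qed
  have shift3: "(real j + 3) * pois (j + 3) = \<Lambda> * pois (j + 2)" for j
    using pois_Suc[of "j + 2"] by (simp add: algebra_simps eval_nat_numeral)
  have sj: "s j = (real j + 1) / real j * pois (j + 2)" if "j \<ge> 1" for j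
  proof -
    have "s j = ((real j + 1) * (real j + 2) * pois (j + 2)) / (real j * (real j + 2))"
      using noise_moments_count(2)[OF that] unfolding s_def shift2 by (simp add: mult.commute)
    then show ?thesis using that by (simp add: divide_simps)
  qed
  have upper: "s j \<le> pois (j + 2) + 4 / \<Lambda> * pois (j + 3)" for j
  proof (cases "j = 0")
    case True
    then show ?thesis using noise_power_count(2)[of 1] pois_nonneg pos by (simp add: s_def numeral_2_eq_2)
  next
    case False
    then have "s j = pois (j + 2) + 1 / real j * pois (j + 2)" using sj[of j] by (simp add: field_simps)
    \<comment> \<open>The denominator \<open>j + 3\<close> is the one that a further index shift
      absorbs; \<open>j \<ge> 1\<close> yields the factor 4.\<close>
    also have "1 / real j * pois (j + 2) \<le> 4 / (real j + 3) * pois (j + 2)"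
      using False pois_nonneg by (intro mult_right_mono) (auto simp: field_simps)
    also have "\<dots> = 4 / \<Lambda> * pois (j + 3)"
    proof -
      have "(4 * pois (j + 2)) / (real j + 3) = (4 * pois (j + 3)) / \<Lambda>"
        by (subst frac_eq_eq) (use pos shift3[of j] in \<open>simp_all add: algebra_simps\<close>)
      then show ?thesis by simp
    qed
    finally show ?thesis by simp
  qed
  \<comment> \<open>The term for \<open>j = 0\<close> vanishes, as an empty strip has no noise, so
    \<open>pois 2\<close> has to be given up.\<close>
  have lower: "pois (j + 2) - (if j = 0 then pois 2 else 0) \<le> s j" for j
  proof (cases "j = 0")
    case True
    then show ?thesis using noise_power_count(2)[of 1] by (simp add: s_def numeral_2_eq_2)
  next
    case False
    then have "1 * pois (j + 2) \<le> (real j + 1) / real j * pois (j + 2)"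
      using pois_nonneg by (intro mult_right_mono) auto
    then show ?thesis using sj[of j] False by simp
  qed
  have tail: "(\<lambda>j. pois (j + m)) sums (1 - (\<Sum>i<m. pois i))" for m
    by (rule sums_split_initial_segment[OF pois_sums])
  have "expectation (\<lambda>\<omega>. (\<xi> \<omega>)\<^sup>2) \<le> (1 - (\<Sum>i<2. pois i)) + 4 / \<Lambda> * (1 - (\<Sum>i<3. pois i))"
    by (rule sums_le[OF upper s]) (intro sums_add sums_mult tail)
  also have "\<dots> \<le> 1 + 4 / \<Lambda> * 1"
    using pois_nonneg pos by (intro add_mono mult_left_mono) (auto intro!: sum_nonneg)
  finally have U: "expectation (\<lambda>\<omega>. (\<xi> \<omega>)\<^sup>2) \<le> 1 + 4 / \<Lambda>" by simp
  have "(1 - (\<Sum>i<2. pois i)) - pois 2 \<le> expectation (\<lambda>\<omega>. (\<xi> \<omega>)\<^sup>2)"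
    by (rule sums_le[OF lower _ s]) (intro sums_diff tail sums_single)
  \<comment> \<open>Each of the three is the next Poisson probability times 1, 2 or 3, divided by
    \<open>\<Lambda>\<close>.\<close>
  moreover have "pois 0 + pois 1 + pois 2 \<le> 3 / \<Lambda>"
  proof -
    have "\<Lambda> * pois 0 = pois 1" "\<Lambda> * pois 1 = 2 * pois 2" "\<Lambda> * pois 2 = 3 * pois 3"
      using pois_Suc[of 0] pois_Suc[of 1] pois_Suc[of 2] by (simp_all add: numeral_2_eq_2 numeral_3_eq_3)
    then have "\<Lambda> * (pois 0 + pois 1 + pois 2) \<le> 3 * (pois 0 + pois 1 + pois 2 + pois 3)"
      using pois_nonneg[of 0] pois_nonneg[of 1] pois_nonneg[of 2] pois_nonneg[of 3] by (simp only: distrib_left)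
    also have "\<dots> \<le> 3 * 1"
    proof (rule mult_left_mono)
      have "(\<Sum>i<4. pois i) \<le> 1"
        using sum_le_suminf[of pois "{..<4}"] pois_sums pois_nonneg by (simp add: sums_iff)
      then show "pois 0 + pois 1 + pois 2 + pois 3 \<le> 1" by (simp add: eval_nat_numeral)
    qed simp
    finally show ?thesis using pos by (simp add: field_simps)
  qed
  moreover have "(\<Sum>i<2. pois i) = pois 0 + pois 1" by (simp add: numeral_2_eq_2)
  moreover have "3 / \<Lambda> \<le> 4 / \<Lambda>" using pos by (simp add: divide_right_mono)
  ultimately show ?thesis using U by linarith
qed

text \<open>For \<open>x \<ge> 1\<close> the numerator is at most \<open>12 * x^2\<close>, and
  \<open>2 * x \<ge> x + 1\<close>. The rational function is thus at most 24 divided by the four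
  consecutive factors that an index shift by 4 absorbs.\<close>

lemma noise_fourth_moment: "expectation (\<lambda>\<omega>. \<xi> \<omega> ^ 4) \<le> 24"
proof -
  define s where "s = (\<lambda>j. expectation (\<lambda>\<omega>. indicator {\<omega> \<in> space M. cnt \<omega> = j} \<omega> * \<xi> \<omega> ^ 4))"
  have s: "s sums expectation (\<lambda>\<omega>. \<xi> \<omega> ^ 4)"
    unfolding s_def by (rule sums_over_count[OF integrable_noise_power])
  have shift: "(real j + 1) * (real j + 2) * (real j + 3) * (real j + 4) * pois (j + 4) = \<Lambda> ^ 4 * pois j" for j
  proof -
    have "(real j + 1) * pois (j + 1) = \<Lambda> * pois j" "(real j + 2) * pois (j + 2) = \<Lambda> * pois (j + 1)"
      "(real j + 3) * pois (j + 3) = \<Lambda> * pois (j + 2)" "(real j + 4) * pois (j + 4) = \<Lambda> * pois (j + 3)"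
      using pois_Suc[of j] pois_Suc[of "j + 1"] pois_Suc[of "j + 2"] pois_Suc[of "j + 3"]
      by (simp_all add: algebra_simps eval_nat_numeral)
    then show ?thesis by algebra
  qed
  have "s j \<le> 24 * pois (j + 4)" for j
  proof (cases "j = 0")
    case True
    then show ?thesis using noise_power_count(2)[of 3] pois_nonneg by (simp add: s_def eval_nat_numeral)
  next
    case False
    define x where "x = real j"
    have x: "x \<ge> 1" using False by (simp add: x_def)
    have j: "j \<ge> 1" using False by simp
    have "(9 * x\<^sup>2 - 3 * x + 6) \<le> 12 * x\<^sup>2"
    proof -
      have "x * 1 \<le> x * x" using x by (intro mult_left_mono) auto
      then show ?thesis using x unfolding power2_eq_square by linarith
    qed
    then have "(9 * x\<^sup>2 - 3 * x + 6) / (x ^ 3 * (x + 2) * (x + 3) * (x + 4)) \<le> 12 * x\<^sup>2 / (x ^ 3 * (x + 2) * (x + 3) * (x + 4))"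
      using x by (intro divide_right_mono) auto
    also have "\<dots> = 24 / (2 * x * ((x + 2) * (x + 3) * (x + 4)))"
      using x by (simp add: power3_eq_cube power2_eq_square)
    also have "\<dots> \<le> 24 / ((x + 1) * ((x + 2) * (x + 3) * (x + 4)))"
      using x by (intro divide_left_mono mult_right_mono) auto
    finally have bd: "(9 * x\<^sup>2 - 3 * x + 6) / (x ^ 3 * (x + 2) * (x + 3) * (x + 4)) \<le> 24 / ((x + 1) * ((x + 2) * (x + 3) * (x + 4)))" .
    have "s j = \<Lambda> ^ 4 * pois j * ((9 * x\<^sup>2 - 3 * x + 6) / (x ^ 3 * (x + 2) * (x + 3) * (x + 4)))"
      using noise_moments_count(3)[OF j] by (simp add: s_def x_def)
    also have "\<dots> \<le> \<Lambda> ^ 4 * pois j * (24 / ((x + 1) * ((x + 2) * (x + 3) * (x + 4))))"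
      using bd pois_nonneg by (intro mult_left_mono) auto
    also have "\<dots> = 24 * pois (j + 4)"
      unfolding shift[symmetric] x_def[symmetric] using x by (simp add: divide_simps)
    finally show ?thesis .
  qed
  then have "expectation (\<lambda>\<omega>. \<xi> \<omega> ^ 4) \<le> 24 * (1 - (\<Sum>i<4. pois i))"
    by (rule sums_le[OF _ s]) (intro sums_mult sums_split_initial_segment[OF pois_sums])
  also have "\<dots> \<le> 24" using pois_nonneg by (simp add: sum_nonneg)
  finally show ?thesis .
qed

lemma integrable_noise_cubed: "integrable M (\<lambda>\<omega>. \<bar>\<xi> \<omega>\<bar> ^ 3)"
  using integrable_norm[OF integrable_noise_power[of 3]] by (simp add: power_abs)

text \<open>From \<open>\<bar>y\<bar>^3 \<le> y^2 + y^4\<close>; the two moments contribute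
  \<open>1 + 4 / \<Lambda>\<close> and 24.\<close>

lemma noise_third_moment: "expectation (\<lambda>\<omega>. \<bar>\<xi> \<omega>\<bar> ^ 3) \<le> 25 + 4 / \<Lambda>"
proof -
  have cube: "\<bar>y\<bar> ^ 3 \<le> y\<^sup>2 + y ^ 4" for y :: real
  proof (cases "\<bar>y\<bar> \<le> 1")
    case True
    then have "\<bar>y\<bar> ^ 3 \<le> \<bar>y\<bar> ^ 2" by (intro power_decreasing) auto
    moreover have "0 \<le> y ^ 4" "\<bar>y\<bar> ^ 2 = y\<^sup>2" by simp_all
    ultimately show ?thesis by linarith
  next
    case False
    then have "\<bar>y\<bar> ^ 3 \<le> \<bar>y\<bar> ^ 4" by (intro power_increasing) auto
    then show ?thesis by (simp add: add_increasing)
  qed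
  have "expectation (\<lambda>\<omega>. \<bar>\<xi> \<omega>\<bar> ^ 3) \<le> expectation (\<lambda>\<omega>. (\<xi> \<omega>)\<^sup>2 + \<xi> \<omega> ^ 4)"
    by (intro Bochner_Integration.integral_mono integrable_noise_cubed Bochner_Integration.integrable_add integrable_noise_power cube)
  also have "\<dots> = expectation (\<lambda>\<omega>. (\<xi> \<omega>)\<^sup>2) + expectation (\<lambda>\<omega>. \<xi> \<omega> ^ 4)"
    by (intro Bochner_Integration.integral_add integrable_noise_power)
  finally show ?thesis using noise_variance noise_fourth_moment by linarith
qed

end

text \<open>If no point lies above \<open>l\<close>, then \<open>T / w\<close> is exactly the
  largest height and the difference vanishes. A point above \<open>l\<close> occurs with probability
  at most \<open>w * (h - l)\<close>, and then the difference is at most \<open>h - l\<close>, times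
  at most 2 for the factor \<open>1 + 1 / cnt\<close>. The rarity of the event supplies the second
  power of \<open>h - l\<close>.\<close>

lemma (in poisson_strip) slanted_top_bound:
  assumes w: "w > 0" and l: "0 \<le> l" "l \<le> h"
    and flat: "\<And>s. 0 \<le> s \<Longrightarrow> s \<le> l \<Longrightarrow> G s = w * s"
    and top: "\<And>s. l \<le> s \<Longrightarrow> s \<le> h \<Longrightarrow> w * l \<le> G s \<and> G s \<le> w * s"
  shows "integrable M (\<lambda>\<omega>. \<bar>(1 + 1 / real (cnt \<omega>)) * top_point \<omega> - (\<xi> \<omega> + (if cnt \<omega> = 0 then 0 else \<Lambda>)) / w\<bar>)"
    and "expectation (\<lambda>\<omega>. \<bar>(1 + 1 / real (cnt \<omega>)) * top_point \<omega> - (\<xi> \<omega> + (if cnt \<omega> = 0 then 0 else \<Lambda>)) / w\<bar>)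
      \<le> 2 * (h - l)\<^sup>2 * w"
proof -
  let ?d = "\<lambda>\<omega>. \<bar>(1 + 1 / real (cnt \<omega>)) * top_point \<omega> - (\<xi> \<omega> + (if cnt \<omega> = 0 then 0 else \<Lambda>)) / w\<bar>"
  let ?A = "{\<omega> \<in> space M. \<not> top_point \<omega> \<le> l}"
  have tp: "0 \<le> top_point \<omega>" "top_point \<omega> \<le> h" for \<omega>
    by (rule strip_max_bounds(1), erule height, rule h) (rule strip_max_bounds(2), erule height, rule h)
  have d: "?d \<omega> \<le> 2 * (h - l) * indicator ?A \<omega>" if \<omega>: "\<omega> \<in> space M" for \<omega>
  proof (cases "cnt \<omega> = 0")
    case True
    then show ?thesis using l by (simp add: strip_max_def strip_noise_def)
  next
    case False
    define a where "a = 1 + 1 / real (cnt \<omega>)"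
    have a: "0 \<le> a" "a \<le> 2" using False by (auto simp: a_def divide_le_eq)
    have "a * top_point \<omega> - (\<xi> \<omega> + \<Lambda>) / w = a * (top_point \<omega> - T \<omega> / w)"
      using False by (simp add: strip_noise_def a_def right_diff_distrib)
    then have eq: "?d \<omega> = a * \<bar>top_point \<omega> - T \<omega> / w\<bar>"
      using False a by (simp add: a_def abs_mult)
    show ?thesis
    proof (cases "top_point \<omega> \<le> l")
      case True
      then have "T \<omega> / w = top_point \<omega>" using flat[OF tp(1)] w by simp
      then show ?thesis using l by (simp add: eq)
    next
      case False
      then have "w * l \<le> T \<omega> \<and> T \<omega> \<le> w * top_point \<omega>" using top[OF _ tp(2)] by simp
      then have "l \<le> T \<omega> / w" "T \<omega> / w \<le> top_point \<omega>" using w by (simp_all add: field_simps)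
      then have "\<bar>top_point \<omega> - T \<omega> / w\<bar> \<le> h - l" using tp(2)[of \<omega>] by linarith
      then have "a * \<bar>top_point \<omega> - T \<omega> / w\<bar> \<le> 2 * (h - l)" using a by (intro mult_mono) auto
      then show ?thesis using False \<omega> by (simp only: eq) simp
    qed
  qed
  have A [measurable]: "?A \<in> events" by measurable
  have m [measurable]: "?d \<in> borel_measurable M" by measurable
  have iA: "integrable M (\<lambda>\<omega>. 2 * (h - l) * indicator ?A \<omega>)"
    by (rule integrable_const_bound[of _ "2 * (h - l)"]) (use l A in \<open>auto intro!: AE_I2 split: split_indicator\<close>)
  show i: "integrable M ?d"
    by (rule Bochner_Integration.integrable_bound[OF iA m], rule AE_I2)
       (use d l in \<open>simp add: abs_mult\<close>)
  have "prob ?A \<le> w * (h - l)"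
  proof -
    have "{\<omega> \<in> space M. top_point \<omega> \<le> l} = {\<omega> \<in> space M. num_points N {z \<in> D. \<not> snd z \<le> l} \<omega> = 0}"
      by (simp add: strip_max_le_iff[OF l(1)])
    then have "prob {\<omega> \<in> space M. top_point \<omega> \<le> l} = exp (- (\<Lambda> - G l))"
      by (simp add: prob_points[OF above] above_measure)
    then have "1 - (\<Lambda> - G l) \<le> prob {\<omega> \<in> space M. top_point \<omega> \<le> l}"
      using exp_ge_add_one_self[of "- (\<Lambda> - G l)"] by linarith
    moreover have "prob ?A = 1 - prob {\<omega> \<in> space M. top_point \<omega> \<le> l}"
      by (subst prob_compl[symmetric]) (auto intro!: arg_cong[where f = prob])
    moreover have "\<Lambda> \<le> w * h" using top[of h] l G_h[of h] by simp
    moreover have "G l = w * l" using flat[of l] l by simp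
    ultimately show ?thesis unfolding right_diff_distrib by linarith
  qed
  have "expectation ?d \<le> expectation (\<lambda>\<omega>. 2 * (h - l) * indicator ?A \<omega>)"
    by (rule Bochner_Integration.integral_mono[OF i iA d])
  also have "\<dots> = 2 * (h - l) * prob ?A"
    using A by simp
  also have "\<dots> \<le> 2 * (h - l) * (w * (h - l))"
    using \<open>prob ?A \<le> w * (h - l)\<close> l by (intro mult_left_mono) auto
  finally show "expectation ?d \<le> 2 * (h - l)\<^sup>2 * w" by (simp add: power2_eq_square mult_ac)
qed

section \<open>Cells and strips\<close>

lemma cell_props:
  assumes r: "r \<in> {1..k}"
  shows cell_subset: "cell k r \<subseteq> {(real r - 1) / real k .. real r / real k}"
    and cell_superset: "{(real r - 1) / real k <..< real r / real k} \<subseteq> cell k r"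
    and cell_measurable: "cell k r \<in> sets borel"
    and cell_unit: "{(real r - 1) / real k .. real r / real k} \<subseteq> {0..1}"
proof -
  have k: "k > 0" "1 \<le> real r" "real r \<le> real k" using r by auto
  show "cell k r \<subseteq> {(real r - 1) / real k .. real r / real k}" "{(real r - 1) / real k <..< real r / real k} \<subseteq> cell k r"
    using k by (auto simp: cell_def)
  show "cell k r \<in> sets borel" by (simp add: cell_def)
  show "{(real r - 1) / real k .. real r / real k} \<subseteq> {0..1}"
    using k by (auto simp: divide_le_eq intro: order.trans[rotated])
qed

lemma disjoint_cells: "disjoint_family_on (cell k) {1..k}"
proof -
  have "cell k r \<inter> cell k s = {}" if "r \<in> {1..k}" "s \<in> {1..k}" "r < s" for r s
  proof -
    have "cell k r \<subseteq> {..<real r / real k}" using that by (auto simp: cell_def)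
    moreover have "cell k s \<subseteq> {(real s - 1) / real k..}" using cell_subset[OF that(2)] by auto
    moreover have "real r / real k \<le> (real s - 1) / real k" using that by (intro divide_right_mono) auto
    ultimately show ?thesis by (force simp: subset_iff)
  qed
  then show ?thesis unfolding disjoint_family_on_def by (metis Int_commute linorder_neqE_nat)
qed

text \<open>A cell differs from the closed interval at end points only. This passes from the
  Lebesgue integral in the estimator to the gauge integral used for the kernel.\<close>

lemma cell_integral:
  fixes g :: "real \<Rightarrow> real"
  assumes r: "r \<in> {1..k}" and g: "continuous_on {0..1} g"
  shows "(LBINT t:cell k r. g t) = integral {(real r - 1) / real k .. real r / real k} g"
proof -
  let ?a = "(real r - 1) / real k" and ?b = "real r / real k"
  have c: "continuous_on {?a..?b} g" using g cell_unit[OF r] continuous_on_subset by blast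
  have si: "set_integrable lborel {?a..?b} g"
    by (rule borel_integrable_atLeastAtMost'[OF c])
  have "(LBINT t:cell k r. g t) = (LBINT t:{?a..?b}. g t)"
    unfolding set_lebesgue_integral_def
  proof (rule integral_cong_AE)
    have ind: "(\<lambda>t. indicator {?a..?b} t *\<^sub>R g t) \<in> borel_measurable lborel"
      using si unfolding set_integrable_def by simp
    then show "(\<lambda>t. indicator {?a..?b} t *\<^sub>R g t) \<in> borel_measurable lborel" .
    have "(\<lambda>t. indicator (cell k r) t *\<^sub>R (indicator {?a..?b} t *\<^sub>R g t)) \<in> borel_measurable lborel"
      using cell_measurable[OF r] by (intro borel_measurable_scaleR[OF borel_measurable_indicator ind]) simp
    also have "(\<lambda>t. indicator (cell k r) t *\<^sub>R (indicator {?a..?b} t *\<^sub>R g t)) = (\<lambda>t. indicator (cell k r) t *\<^sub>R g t)"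
      using cell_subset[OF r] by (auto simp: fun_eq_iff split: split_indicator)
    finally show "(\<lambda>t. indicator (cell k r) t *\<^sub>R g t) \<in> borel_measurable lborel" .
    show "AE t in lborel. indicator (cell k r) t *\<^sub>R g t = indicator {?a..?b} t *\<^sub>R g t"
      using AE_lborel_singleton[of ?a] AE_lborel_singleton[of ?b]
    proof eventually_elim
      case (elim t)
      have "t \<in> cell k r \<longleftrightarrow> t \<in> {?a..?b}"
      proof
        assume "t \<in> {?a..?b}"
        then have "t \<in> {?a<..<?b}" using elim by simp
        then show "t \<in> cell k r" using cell_superset[OF r] by blast
      qed (use cell_subset[OF r] in blast)
      then show ?case by (simp add: indicator_def)
    qed
  qed
  also have "\<dots> = integral {?a..?b} g" by (rule set_borel_integral_eq_integral(2)[OF si])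
  finally show ?thesis .
qed

lemma cell_integrals_sum:
  fixes g :: "real \<Rightarrow> real"
  assumes k: "k > 0" and g: "continuous_on {0..1} g"
  shows "(\<Sum>r=1..k. integral {(real r - 1) / real k .. real r / real k} g) = integral {0..1} g"
proof -
  have gi: "g integrable_on {0..1}" using g by (rule integrable_continuous_interval)
  have "m \<le> k \<Longrightarrow> (\<Sum>r=1..m. integral {(real r - 1) / real k .. real r / real k} g) = integral {0..real m / real k} g" for m
  proof (induction m)
    case (Suc m)
    have "g integrable_on {0..real (Suc m) / real k}"
      using Suc.prems k by (intro integrable_on_subinterval[OF gi]) (auto simp: divide_le_eq)
    then have "integral {0..real m / real k} g + integral {real m / real k..real (Suc m) / real k} g = integral {0..real (Suc m) / real k} g"
      using k by (intro Henstock_Kurzweil_Integration.integral_combine) (auto simp: divide_right_mono)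
    then show ?case using Suc by simp
  qed simp
  from this[of k] show ?thesis using k by simp
qed

lemma cell_average_bound:
  fixes \<phi> :: "real \<Rightarrow> real"
  assumes r: "r \<in> {1..k}" and \<phi>: "continuous_on {0..1} \<phi>"
    and lip: "\<And>s t. s \<in> {0..1} \<Longrightarrow> t \<in> {0..1} \<Longrightarrow> \<bar>\<phi> s - \<phi> t\<bar> \<le> L * \<bar>s - t\<bar>" and L: "L \<ge> 0"
    and t: "t \<in> {(real r - 1) / real k .. real r / real k}"
  shows "\<bar>real k * integral {(real r - 1) / real k .. real r / real k} \<phi> - \<phi> t\<bar> \<le> L / real k"
proof -
  let ?I = "{(real r - 1) / real k .. real r / real k}"
  have k: "k > 0" using r by auto
  have le: "(real r - 1) / real k \<le> real r / real k" by (simp add: divide_right_mono)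
  have len: "real r / real k - (real r - 1) / real k = 1 / real k" by (simp add: diff_divide_distrib)
  have c: "continuous_on ?I \<phi>" using \<phi> cell_unit[OF r] continuous_on_subset by blast
  have ti: "t \<in> {0..1}" using t cell_unit[OF r] by blast
  have "\<bar>integral ?I (\<lambda>s. \<phi> s - \<phi> t)\<bar> \<le> (L / real k) * (real r / real k - (real r - 1) / real k)"
  proof (rule integral_bound[OF le, of "\<lambda>s. \<phi> s - \<phi> t", unfolded real_norm_def])
    fix s assume s: "s \<in> ?I"
    have "\<bar>\<phi> s - \<phi> t\<bar> \<le> L * \<bar>s - t\<bar>" using lip s ti cell_unit[OF r] by blast
    also have "\<dots> \<le> L * (1 / real k)"
    proof (rule mult_left_mono[OF _ L])
      have "s \<le> t + 1 / real k" "t \<le> s + 1 / real k" using s t len by auto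
      then show "\<bar>s - t\<bar> \<le> 1 / real k" by linarith
    qed
    finally show "\<bar>\<phi> s - \<phi> t\<bar> \<le> L / real k" by simp
  qed (use c in \<open>intro continuous_intros\<close>)
  moreover have "integral ?I (\<lambda>s. \<phi> s - \<phi> t) = integral ?I \<phi> - \<phi> t / real k"
    using c len le by (subst integral_diff) (auto intro!: integrable_continuous_interval simp: content_real)
  ultimately have "real k * \<bar>integral ?I \<phi> - \<phi> t / real k\<bar> \<le> real k * (L / real k * (1 / real k))"
    unfolding len by (intro mult_left_mono) auto
  moreover have "\<bar>real k * integral ?I \<phi> - \<phi> t\<bar> = real k * \<bar>integral ?I \<phi> - \<phi> t / real k\<bar>"
  proof -
    have "real k * integral ?I \<phi> - \<phi> t = real k * (integral ?I \<phi> - \<phi> t / real k)"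
      using k by (simp add: right_diff_distrib)
    then show ?thesis by (simp add: abs_mult)
  qed
  ultimately show ?thesis using k by simp
qed

lemma cell_abs_integrals_le:
  fixes u :: "real \<Rightarrow> real"
  assumes k: "k > 0" and u: "continuous_on {0..1} u"
  shows "(\<Sum>r=1..k. \<bar>integral {(real r - 1) / real k .. real r / real k} u\<bar>) \<le> integral {0..1} (\<lambda>t. \<bar>u t\<bar>)"
proof -
  have "(\<Sum>r=1..k. \<bar>integral {(real r - 1) / real k .. real r / real k} u\<bar>)
      \<le> (\<Sum>r=1..k. integral {(real r - 1) / real k .. real r / real k} (\<lambda>t. \<bar>u t\<bar>))"
  proof (rule sum_mono)
    fix r assume r: "r \<in> {1..k}"
    have c: "continuous_on {(real r - 1) / real k .. real r / real k} u" using u cell_unit[OF r] continuous_on_subset by blast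
    show "\<bar>integral {(real r - 1) / real k .. real r / real k} u\<bar> \<le> integral {(real r - 1) / real k .. real r / real k} (\<lambda>t. \<bar>u t\<bar>)"
      using Henstock_Kurzweil_Integration.integral_norm_bound_integral[of u "{(real r - 1) / real k .. real r / real k}" "\<lambda>t. \<bar>u t\<bar>"] c
      by (simp add: integrable_continuous_interval continuous_on_rabs)
  qed
  also have "\<dots> = integral {0..1} (\<lambda>t. \<bar>u t\<bar>)"
    using u by (intro cell_integrals_sum k continuous_intros)
  finally show ?thesis .
qed

text \<open>On each cell \<open>\<phi>\<close> differs from its average by at most
  \<open>L / k\<close>. Integrating this against \<open>\<bar>u\<bar>\<close> brings in the
  \<open>L^1\<close> norm of \<open>u\<close>, so that for kernels only the Lebesgue constant is
  paid. Applied to the kernel and \<open>f\<close>, and to a combination of kernels with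
  itself.\<close>

lemma cell_averages_product:
  fixes u \<phi> :: "real \<Rightarrow> real"
  assumes k: "k > 0" and u: "continuous_on {0..1} u" and \<phi>: "continuous_on {0..1} \<phi>"
    and lip: "\<And>s t. s \<in> {0..1} \<Longrightarrow> t \<in> {0..1} \<Longrightarrow> \<bar>\<phi> s - \<phi> t\<bar> \<le> L * \<bar>s - t\<bar>" and L: "L \<ge> 0"
  shows "\<bar>(\<Sum>r=1..k. integral {(real r - 1) / real k .. real r / real k} u * (real k * integral {(real r - 1) / real k .. real r / real k} \<phi>))
      - integral {0..1} (\<lambda>t. u t * \<phi> t)\<bar> \<le> L / real k * integral {0..1} (\<lambda>t. \<bar>u t\<bar>)"
proof -
  define I where "I = (\<lambda>r. {(real r - 1) / real k .. real r / real k})"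
  define A where "A = (\<lambda>r. real k * integral (I r) \<phi>)"
  have cI: "continuous_on (I r) u" "continuous_on (I r) \<phi>" if "r \<in> {1..k}" for r
    using u \<phi> cell_unit[OF that] continuous_on_subset unfolding I_def by blast+
  have cell: "\<bar>integral (I r) u * A r - integral (I r) (\<lambda>t. u t * \<phi> t)\<bar> \<le> L / real k * integral (I r) (\<lambda>t. \<bar>u t\<bar>)"
    if r: "r \<in> {1..k}" for r
  proof -
    have cI': "continuous_on (I r) (\<lambda>t. u t * A r)" "continuous_on (I r) (\<lambda>t. u t * \<phi> t)"
      "continuous_on (I r) (\<lambda>t. u t * A r - u t * \<phi> t)" "continuous_on (I r) (\<lambda>t. L / real k * \<bar>u t\<bar>)"
      using cI[OF r] k by (auto intro!: continuous_intros)
    have ci: "v integrable_on I r" if "continuous_on (I r) v" for v :: "real \<Rightarrow> real"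
      using that unfolding I_def by (rule integrable_continuous_interval)
    note int = cI'[THEN ci]
    have "integral (I r) u * A r - integral (I r) (\<lambda>t. u t * \<phi> t) = integral (I r) (\<lambda>t. u t * A r - u t * \<phi> t)"
      using integral_diff[OF int(1,2)] by simp
    also have "\<bar>\<dots>\<bar> \<le> integral (I r) (\<lambda>t. L / real k * \<bar>u t\<bar>)"
    proof -
      have "\<bar>u t * A r - u t * \<phi> t\<bar> \<le> L / real k * \<bar>u t\<bar>" if t: "t \<in> I r" for t
      proof -
        have "\<bar>A r - \<phi> t\<bar> \<le> L / real k"
          using cell_average_bound[OF r \<phi> lip L] t by (simp add: A_def I_def)
        then have "\<bar>u t\<bar> * \<bar>A r - \<phi> t\<bar> \<le> \<bar>u t\<bar> * (L / real k)" by (intro mult_left_mono) auto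
        moreover have "u t * A r - u t * \<phi> t = u t * (A r - \<phi> t)" by (simp add: right_diff_distrib)
        ultimately show ?thesis by (simp add: abs_mult mult.commute)
      qed
      then show ?thesis
        using Henstock_Kurzweil_Integration.integral_norm_bound_integral[OF int(3,4)] by simp
    qed
    finally show ?thesis by simp
  qed
  have "\<bar>(\<Sum>r=1..k. integral (I r) u * A r) - (\<Sum>r=1..k. integral (I r) (\<lambda>t. u t * \<phi> t))\<bar>
      \<le> (\<Sum>r=1..k. L / real k * integral (I r) (\<lambda>t. \<bar>u t\<bar>))"
    unfolding sum_subtractf[symmetric] by (rule order.trans[OF sum_abs sum_mono[OF cell]])
  also have "\<dots> = L / real k * integral {0..1} (\<lambda>t. \<bar>u t\<bar>)"
    unfolding sum_distrib_left[symmetric] I_def using u by (subst cell_integrals_sum[OF k]) (auto intro!: continuous_intros)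
  also have "(\<Sum>r=1..k. integral (I r) (\<lambda>t. u t * \<phi> t)) = integral {0..1} (\<lambda>t. u t * \<phi> t)"
    unfolding I_def using u \<phi> by (intro cell_integrals_sum[OF k] continuous_intros)
  finally show ?thesis unfolding A_def I_def .
qed

lemma strip_sets_intensity:
  fixes g :: "real \<Rightarrow> real"
  assumes g: "continuous_on {0..1} g" and A: "A \<in> sets borel" "A \<subseteq> {0..1}"
  shows "{(x, y). x \<in> A \<and> 0 \<le> y \<and> y \<le> g x} \<in> sets (restrict_space lborel {0..1} \<Otimes>\<^sub>M restrict_space lborel {0..})"
    (is "?S \<in> sets ?P")
proof -
  let ?X = "restrict_space lborel {0..1::real}" and ?Y = "restrict_space lborel {0::real..}"
  have sX: "sets ?X = sets (restrict_space borel {0..1})" by (intro sets_restrict_space_cong) simp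
  have [measurable]: "g \<in> borel_measurable ?X"
    using borel_measurable_continuous_on_restrict[OF g] by (simp add: measurable_cong_sets[OF sX refl])
  have [measurable]: "(\<lambda>y. y) \<in> borel_measurable ?Y" "(\<lambda>x. x) \<in> borel_measurable ?X"
    by (rule measurable_restrict_space1, simp)+
  have [measurable]: "A \<in> sets borel" by (rule A)
  have "{z \<in> space ?P. fst z \<in> A \<and> snd z \<le> g (fst z)} \<in> sets ?P"
  proof -
    have [measurable]: "fst \<in> borel_measurable ?P" "snd \<in> borel_measurable ?P" "(\<lambda>z. g (fst z)) \<in> borel_measurable ?P"
      using measurable_compose[OF measurable_fst[of ?X ?Y] \<open>(\<lambda>x. x) \<in> borel_measurable ?X\<close>]
        measurable_compose[OF measurable_snd[of ?X ?Y] \<open>(\<lambda>y. y) \<in> borel_measurable ?Y\<close>]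
        measurable_compose[OF measurable_fst[of ?X ?Y] \<open>g \<in> borel_measurable ?X\<close>] by simp_all
    show ?thesis by measurable
  qed
  also have "{z \<in> space ?P. fst z \<in> A \<and> snd z \<le> g (fst z)} = ?S"
    using A(2) by (auto simp: space_pair_measure space_restrict_space)
  finally show ?thesis .
qed

text \<open>Stated for every \<open>g\<close> below \<open>f\<close>, because the part of a strip up
  to a given height is again the region under a graph, on which the indicator in the intensity is
  1.\<close>

lemma measure_intensity_strip:
  fixes f g :: "real \<Rightarrow> real"
  assumes f: "continuous_on {0..1} f" and g: "continuous_on {0..1} g"
    and fg: "\<And>x. x \<in> {0..1} \<Longrightarrow> 0 \<le> g x \<and> g x \<le> f x" and r: "r \<in> {1..k}" and c: "c > 0"
  shows "strip g k r \<in> sets (intensity f c n)"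
    and "measure (intensity f c n) (strip g k r) = real n * c * integral {(real r - 1) / real k .. real r / real k} g"
proof -
  let ?X = "restrict_space lborel {0..1::real}" and ?Y = "restrict_space lborel {0::real..}"
  let ?P = "?X \<Otimes>\<^sub>M ?Y"
  have cu: "cell k r \<subseteq> {0..1}" using cell_subset[OF r] cell_unit[OF r] by blast
  have S: "strip g k r \<in> sets ?P"
    unfolding strip_def by (rule strip_sets_intensity[OF g cell_measurable[OF r] cu])
  then show "strip g k r \<in> sets (intensity f c n)" by (simp add: intensity_def)
  have supp: "support_set f \<in> sets ?P"
    unfolding support_set_def by (rule strip_sets_intensity[OF f]) auto
  have sub: "strip g k r \<subseteq> support_set f"
    using fg cu by (auto simp: strip_def support_set_def) (meson atLeastAtMost_iff order.trans subsetD)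
  interpret Y: sigma_finite_measure ?Y
    by (rule sigma_finite_measure_restrict_space) (simp_all add: sigma_finite_lborel)
  let ?I = "{(real r - 1) / real k .. real r / real k}"
  have cI: "continuous_on ?I g" using g cell_unit[OF r] continuous_on_subset by blast
  have si: "set_integrable lborel (cell k r) g"
    by (rule set_integrable_subset[OF borel_integrable_atLeastAtMost'[OF cI]])
       (use cell_measurable[OF r] cell_subset[OF r] in auto)
  have "emeasure ?P (strip g k r) = (\<integral>\<^sup>+x. emeasure ?Y (Pair x -` strip g k r) \<partial>?X)"
    by (rule Y.emeasure_pair_measure_alt[OF S])
  also have "\<dots> = (\<integral>\<^sup>+x. emeasure ?Y (Pair x -` strip g k r) * indicator {0..1} x \<partial>lborel)"
    by (rule nn_integral_restrict_space) simp
  also have "\<dots> = (\<integral>\<^sup>+x. ennreal (indicator (cell k r) x *\<^sub>R g x) \<partial>lborel)"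
  proof (intro nn_integral_cong)
    fix x :: real
    show "emeasure ?Y (Pair x -` strip g k r) * indicator {0..1} x = ennreal (indicator (cell k r) x *\<^sub>R g x)"
    proof (cases "x \<in> cell k r")
      case True
      then have "Pair x -` strip g k r = {0..g x}" "x \<in> {0..1}" using cu by (auto simp: strip_def)
      moreover have "emeasure ?Y {0..g x} = emeasure lborel {0..g x}"
        by (rule emeasure_restrict_space) auto
      ultimately show ?thesis using True fg[of x] by simp
    next
      case False
      then have "Pair x -` strip g k r = {}" by (auto simp: strip_def)
      then show ?thesis using False by simp
    qed
  qed
  also have "\<dots> = ennreal (LBINT x:cell k r. g x)"
    unfolding set_lebesgue_integral_def
    by (rule nn_integral_eq_integral)
       (use si fg cu in \<open>auto simp: set_integrable_def intro!: AE_I2 split: split_indicator\<close>)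
  finally have E: "emeasure ?P (strip g k r) = ennreal (integral ?I g)"
    by (simp only: cell_integral[OF r g])
  have "integral ?I g \<ge> 0"
    using cI fg cell_unit[OF r] by (intro integral_nonneg integrable_continuous_interval) auto
  have "emeasure (intensity f c n) (strip g k r) = (\<integral>\<^sup>+z. ennreal (real n * c) * indicator (support_set f) z * indicator (strip g k r) z \<partial>?P)"
    unfolding intensity_def using supp S by (intro emeasure_density) auto
  also have "\<dots> = (\<integral>\<^sup>+z. ennreal (real n * c) * indicator (strip g k r) z \<partial>?P)"
    using sub by (intro nn_integral_cong) (auto split: split_indicator)
  also have "\<dots> = ennreal (real n * c) * emeasure ?P (strip g k r)"
    using S by (rule nn_integral_cmult_indicator)
  also have "\<dots> = ennreal (real n * c * integral ?I g)"
    unfolding E using c by (intro ennreal_mult[symmetric]) (auto simp: \<open>integral ?I g \<ge> 0\<close>)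
  finally show "measure (intensity f c n) (strip g k r) = real n * c * integral ?I g"
    using c \<open>integral ?I g \<ge> 0\<close> by (simp add: measure_def)
qed

lemma strip_below_eq:
  "0 \<le> s \<Longrightarrow> {z \<in> strip f k r. snd z \<le> s} = strip (\<lambda>x. min (f x) s) k r"
  "s < 0 \<Longrightarrow> {z \<in> strip f k r. snd z \<le> s} = {}"
  by (auto simp: strip_def)

text \<open>The lower part of the strip is the region under the clipped function;
  \<open>max 0 s\<close> covers negative heights, where it is empty.\<close>

lemma level_strip:
  fixes f :: "real \<Rightarrow> real"
  assumes f: "continuous_on {0..1} f" and f0: "\<And>x. x \<in> {0..1} \<Longrightarrow> 0 \<le> f x" and r: "r \<in> {1..k}" and c: "c > 0"
  shows "{z \<in> strip f k r. snd z \<le> s} \<in> sets (intensity f c n)"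
    and "level (intensity f c n) (strip f k r) s
      = real n * c * integral {(real r - 1) / real k .. real r / real k} (\<lambda>x. min (f x) (max 0 s))"
proof -
  have cm: "continuous_on {0..1} (\<lambda>x. min (f x) t)" for t using f by (intro continuous_intros)
  have "{z \<in> strip f k r. snd z \<le> s} \<in> sets (intensity f c n) \<and> level (intensity f c n) (strip f k r) s
      = real n * c * integral {(real r - 1) / real k .. real r / real k} (\<lambda>x. min (f x) (max 0 s))"
  proof (cases "0 \<le> s")
    case True
    then show ?thesis
      using measure_intensity_strip[OF f cm[of s] _ r c, of n] f0
      by (simp add: level_def strip_below_eq max_def)
  next
    case False
    have "integral {(real r - 1) / real k .. real r / real k} (\<lambda>x. min (f x) 0) = integral {(real r - 1) / real k .. real r / real k} (\<lambda>x. 0)"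
    proof (rule Henstock_Kurzweil_Integration.integral_cong)
      fix x assume "x \<in> {(real r - 1) / real k .. real r / real k}"
      then have "0 \<le> f x" using f0 cell_unit[OF r] by blast
      then show "min (f x) 0 = 0" by simp
    qed
    with False show ?thesis
      by (simp add: level_def strip_below_eq max_def)
  qed
  then show "{z \<in> strip f k r. snd z \<le> s} \<in> sets (intensity f c n)"
    "level (intensity f c n) (strip f k r) s
      = real n * c * integral {(real r - 1) / real k .. real r / real k} (\<lambda>x. min (f x) (max 0 s))" by auto
qed

text \<open>\<open>l\<close> and \<open>h\<close> are the minimum and maximum of \<open>f\<close> on
  the closed cell, at most \<open>L / k\<close> apart. Up to \<open>l\<close> the strip is a
  rectangle of width \<open>1 / k\<close>, and \<open>w\<close> is its mean number of points per
  unit height.\<close>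

lemma cell_strip_properties:
  fixes f :: "real \<Rightarrow> real"
  assumes M: "prob_space M" and ppp: "poisson_point_process M N (intensity f c n)"
    and f: "continuous_on {0..1} f" and fm: "\<And>x. x \<in> {0..1} \<Longrightarrow> m \<le> f x" and m: "m > 0"
    and lip: "\<And>s t. s \<in> {0..1} \<Longrightarrow> t \<in> {0..1} \<Longrightarrow> \<bar>f s - f t\<bar> \<le> L * \<bar>s - t\<bar>" and L: "L \<ge> 0"
    and r: "r \<in> {1..k}" and c: "c > 0" and n: "n \<ge> 1"
  defines "w \<equiv> real n * c / real k"
  obtains h l where "poisson_strip M N (intensity f c n) (strip f k r) h"
    and "0 \<le> l" "l \<le> h" "h - l \<le> L / real k"
    and "\<And>s. 0 \<le> s \<Longrightarrow> s \<le> l \<Longrightarrow> level (intensity f c n) (strip f k r) s = w * s"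
    and "\<And>s. l \<le> s \<Longrightarrow> s \<le> h \<Longrightarrow> w * l \<le> level (intensity f c n) (strip f k r) s \<and> level (intensity f c n) (strip f k r) s \<le> w * s"
proof -
  let ?a = "(real r - 1) / real k" and ?b = "real r / real k"
  let ?I = "{?a .. ?b}"
  have k: "k > 0" using r by auto
  have ab: "?a \<le> ?b" by (simp add: divide_right_mono)
  have len: "?b - ?a = 1 / real k" by (simp add: diff_divide_distrib)
  have cI: "continuous_on ?I f" using f cell_unit[OF r] continuous_on_subset by blast
  have f0: "0 \<le> f x" if "x \<in> {0..1}" for x using fm[OF that] m by linarith
  have ne: "?I \<noteq> {}" using ab by simp
  obtain x0 where x0: "x0 \<in> ?I" "\<And>x. x \<in> ?I \<Longrightarrow> f x0 \<le> f x"
    using continuous_attains_inf[OF compact_Icc ne cI] by blast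
  obtain x1 where x1: "x1 \<in> ?I" "\<And>x. x \<in> ?I \<Longrightarrow> f x \<le> f x1"
    using continuous_attains_sup[OF compact_Icc ne cI] by blast
  define l where "l = f x0"
  define h where "h = f x1"
  have lh: "0 \<le> l" "l \<le> h"
    using x0 x1 f0 cell_unit[OF r] by (auto simp: l_def h_def)
  have hl: "h - l \<le> L / real k"
  proof -
    have "h - l \<le> \<bar>f x1 - f x0\<bar>" by (simp add: h_def l_def)
    also have "\<dots> \<le> L * \<bar>x1 - x0\<bar>" using lip x0(1) x1(1) cell_unit[OF r] by blast
    also have "\<dots> \<le> L * (1 / real k)"
    proof (rule mult_left_mono[OF _ L])
      show "\<bar>x1 - x0\<bar> \<le> 1 / real k" using x0(1) x1(1) len by (simp only: atLeastAtMost_iff) linarith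
    qed
    finally show ?thesis by simp
  qed
  let ?\<mu> = "intensity f c n" and ?D = "strip f k r"
  have cmin: "continuous_on ?I (\<lambda>x. min (f x) t)" for t using cI by (intro continuous_intros)
  note imin = integrable_continuous_interval[OF cmin]
  have lev: "level ?\<mu> ?D s = real n * c * integral ?I (\<lambda>x. min (f x) (max 0 s))" for s
    by (rule level_strip(2)[OF f f0 r c])
  have const: "integral ?I (\<lambda>x. t) = t / real k" for t :: real
    using ab len by simp
  have flat: "level ?\<mu> ?D s = w * s" if "0 \<le> s" "s \<le> l" for s
  proof -
    have "integral ?I (\<lambda>x. min (f x) (max 0 s)) = integral ?I (\<lambda>x. s)"
      using that x0(2) by (intro Henstock_Kurzweil_Integration.integral_cong) (force simp: l_def min_def)
    then show ?thesis by (simp only: lev const) (simp add: w_def)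
  qed
  have nc: "0 \<le> real n * c" using c by simp
  have top: "w * l \<le> level ?\<mu> ?D s \<and> level ?\<mu> ?D s \<le> w * s" if s: "l \<le> s" "s \<le> h" for s
  proof -
    have s0: "max 0 s = s" using s lh by simp
    have "integral ?I (\<lambda>x. l) \<le> integral ?I (\<lambda>x. min (f x) s)"
      using x0(2) s by (intro integral_le imin) (auto simp: l_def)
    moreover have "integral ?I (\<lambda>x. min (f x) s) \<le> integral ?I (\<lambda>x. s)"
      by (intro integral_le imin) auto
    ultimately have "real n * c * (l / real k) \<le> real n * c * integral ?I (\<lambda>x. min (f x) s)"
      "real n * c * integral ?I (\<lambda>x. min (f x) s) \<le> real n * c * (s / real k)"
      using nc by (simp_all only: const) (intro mult_left_mono; assumption)+
    then show ?thesis by (simp add: lev s0 w_def)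
  qed
  have "poisson_strip M N ?\<mu> ?D h"
  proof (intro poisson_strip.intro M poisson_strip_axioms.intro ppp)
    show "{z \<in> ?D. snd z \<le> s} \<in> sets ?\<mu>" for s by (rule level_strip(1)[OF f f0 r c])
    show "0 \<le> snd z \<and> snd z \<le> h" if "z \<in> ?D" for z
    proof -
      have "fst z \<in> ?I" "0 \<le> snd z" "snd z \<le> f (fst z)"
        using that cell_subset[OF r] by (auto simp: strip_def)
      then show ?thesis using x1(2) unfolding h_def by force
    qed
    show "0 \<le> h" using lh by simp
    show "continuous_on UNIV (level ?\<mu> ?D)"
    proof -
      \<comment> \<open>Clipping is 1-Lipschitz in the height, so the level is Lipschitz with
        constant \<open>w\<close>, whatever the shape of \<open>f\<close>.\<close>
      have "\<bar>level ?\<mu> ?D s - level ?\<mu> ?D t\<bar> \<le> (real n * c / real k) * \<bar>s - t\<bar>" for s t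
      proof -
        have "level ?\<mu> ?D s - level ?\<mu> ?D t = real n * c * integral ?I (\<lambda>x. min (f x) (max 0 s) - min (f x) (max 0 t))"
          unfolding lev by (simp add: integral_diff[OF imin imin] right_diff_distrib)
        then have A: "\<bar>level ?\<mu> ?D s - level ?\<mu> ?D t\<bar> = real n * c * \<bar>integral ?I (\<lambda>x. min (f x) (max 0 s) - min (f x) (max 0 t))\<bar>"
          using c by (simp add: abs_mult)
        have B: "\<bar>integral ?I (\<lambda>x. min (f x) (max 0 s) - min (f x) (max 0 t))\<bar> \<le> \<bar>s - t\<bar> * (?b - ?a)"
        proof -
          have "norm (integral ?I (\<lambda>x. min (f x) (max 0 s) - min (f x) (max 0 t))) \<le> \<bar>s - t\<bar> * (?b - ?a)"
            by (rule integral_bound[OF ab]) (use cmin in \<open>auto intro!: continuous_on_diff simp: min_def max_def\<close>)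
          then show ?thesis by simp
        qed
        from mult_left_mono[OF B nc] show ?thesis unfolding A len by simp
      qed
      then have "(real n * c / real k)-lipschitz_on UNIV (level ?\<mu> ?D)"
        using nc by (intro lipschitz_onI) (auto simp: dist_real_def)
      then show ?thesis by (rule lipschitz_on_continuous_on)
    qed
    have "x0 \<in> {0..1}" using x0(1) cell_unit[OF r] by blast
    then have "0 < l" using fm[of x0] m by (simp add: l_def)
    then have "0 < w * l" using n c k by (simp add: w_def)
    also have "\<dots> = level ?\<mu> ?D l" using flat[of l] lh by simp
    also have "\<dots> \<le> measure ?\<mu> ?D"
    proof -
      have fin: "finite_measure ?\<mu>" using ppp by (simp add: poisson_point_process_def)
      have "?D \<in> sets ?\<mu>" using measure_intensity_strip(1)[OF f f _ r c] f0 by simp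
      then show ?thesis unfolding level_def using fin
        by (intro finite_measure.finite_measure_mono) auto
    qed
    finally show "0 < measure ?\<mu> ?D" .
  qed
  then show ?thesis using that lh hl flat top by blast
qed

section \<open>The estimator for a fixed sample size\<close>

lemma cmod_iexp_diff_le: "cmod (iexp x - iexp y) \<le> \<bar>x - y\<bar>"
proof -
  have "iexp x - iexp y = iexp y * (iexp (x - y) - 1)"
    by (simp add: algebra_simps flip: exp_add)
  then have "cmod (iexp x - iexp y) = cmod (iexp (x - y) - 1)"
    by (simp add: norm_mult)
  also have "\<dots> \<le> \<bar>x - y\<bar>" using iexp_approx1[of "x - y" 0] by simp
  finally show ?thesis .
qed

lemma vec_measurable:
  fixes F :: "'p::finite \<Rightarrow> 'w \<Rightarrow> real"
  assumes "\<And>j. F j \<in> borel_measurable M"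
  shows "(\<lambda>\<omega>. \<chi> j. F j \<omega>) \<in> borel_measurable M"
proof (subst borel_measurable_euclidean_space, intro ballI)
  fix i :: "real^'p" assume "i \<in> Basis"
  then obtain j where "i = axis j 1" by (auto simp: Basis_vec_def)
  then show "(\<lambda>\<omega>. (\<chi> j. F j \<omega>) \<bullet> i) \<in> borel_measurable M"
    using assms[of j] by (simp add: inner_axis)
qed

text \<open>With \<open>g\<close> the combination of kernels, the first sum integrates
  \<open>g\<close> against its own cell averages. It is close to the integral of \<open>g^2\<close>,
  which the reproducing property evaluates. The constant is \<open>2 * pi\<close> from the Lipschitz
  bound times 72 from the Lebesgue constant.\<close>

lemma weights_square_sum:
  fixes x t :: "real^'p"
  assumes k: "k \<ge> 1" and b: "b \<ge> 2" and x: "\<And>j. x $ j \<in> {0..1}"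
  shows "\<bar>real k * (\<Sum>r=1..k. (\<Sum>j\<in>UNIV. t $ j * integral {(real r - 1) / real k .. real r / real k} (dirichlet_kernel b (x $ j)))\<^sup>2)
      - (\<Sum>i\<in>UNIV. \<Sum>j\<in>UNIV. t $ i * t $ j * dirichlet_kernel b (x $ i) (x $ j))\<bar>
    \<le> (\<Sum>j\<in>UNIV. \<bar>t $ j\<bar>)\<^sup>2 * (144 * pi * ln (real b) * (real b + 1)\<^sup>2 / real k)"
proof -
  define T where "T = (\<Sum>j\<in>UNIV. \<bar>t $ j\<bar>)"
  have T0: "T \<ge> 0" by (simp add: T_def sum_nonneg)
  define g where "g = (\<lambda>s. \<Sum>j\<in>UNIV. t $ j * dirichlet_kernel b (x $ j) s)"
  have k0: "k > 0" using k by simp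
  have cg: "continuous_on S g" for S unfolding g_def by (intro continuous_intros)
  have cell: "integral {(real r - 1) / real k .. real r / real k} g
      = (\<Sum>j\<in>UNIV. t $ j * integral {(real r - 1) / real k .. real r / real k} (dirichlet_kernel b (x $ j)))" for r
    unfolding g_def
    by (subst integral_sum) (auto intro!: integrable_continuous_interval continuous_intros)
  have lip: "\<bar>g s - g s'\<bar> \<le> T * (2 * pi * (real b + 1)\<^sup>2) * \<bar>s - s'\<bar>" for s s'
  proof -
    have "\<bar>g s - g s'\<bar> \<le> (\<Sum>j\<in>UNIV. \<bar>t $ j\<bar> * \<bar>dirichlet_kernel b (x $ j) s - dirichlet_kernel b (x $ j) s'\<bar>)"
      unfolding g_def sum_subtractf[symmetric]
      by (rule order.trans[OF sum_abs]) (simp add: abs_mult flip: right_diff_distrib)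
    also have "\<dots> \<le> (\<Sum>j\<in>UNIV. \<bar>t $ j\<bar> * (2 * pi * (real b + 1)\<^sup>2 * \<bar>s - s'\<bar>))"
      by (intro sum_mono mult_left_mono dirichlet_kernel_lipschitz) auto
    also have "\<dots> = T * (2 * pi * (real b + 1)\<^sup>2) * \<bar>s - s'\<bar>"
      by (simp add: T_def sum_distrib_right mult.assoc)
    finally show ?thesis .
  qed
  have L1: "integral {0..1} (\<lambda>s. \<bar>g s\<bar>) \<le> T * (72 * ln (real b))"
  proof -
    have "integral {0..1} (\<lambda>s. \<bar>g s\<bar>) \<le> integral {0..1} (\<lambda>s. \<Sum>j\<in>UNIV. \<bar>t $ j\<bar> * \<bar>dirichlet_kernel b (x $ j) s\<bar>)"
    proof (rule integral_le)
      show "\<bar>g s\<bar> \<le> (\<Sum>j\<in>UNIV. \<bar>t $ j\<bar> * \<bar>dirichlet_kernel b (x $ j) s\<bar>)" for s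
        unfolding g_def by (rule order.trans[OF sum_abs]) (simp add: abs_mult)
    qed (intro integrable_continuous_interval continuous_intros cg)+
    also have "\<dots> = (\<Sum>j\<in>UNIV. \<bar>t $ j\<bar> * integral {0..1} (\<lambda>s. \<bar>dirichlet_kernel b (x $ j) s\<bar>))"
      by (subst integral_sum) (auto intro!: integrable_continuous_interval continuous_intros)
    also have "\<dots> \<le> (\<Sum>j\<in>UNIV. \<bar>t $ j\<bar> * (72 * ln (real b)))"
      using integral_abs_dirichlet_kernel[OF b x] by (intro sum_mono mult_left_mono) auto
    also have "\<dots> = T * (72 * ln (real b))" by (simp add: T_def sum_distrib_right)
    finally show ?thesis .
  qed
  have sq: "integral {0..1} (\<lambda>s. g s * g s) = (\<Sum>i\<in>UNIV. \<Sum>j\<in>UNIV. t $ i * t $ j * dirichlet_kernel b (x $ i) (x $ j))"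
  proof -
    have c1: "(\<lambda>s. t $ i * t $ j * (dirichlet_kernel b (x $ i) s * dirichlet_kernel b (x $ j) s)) integrable_on {0..1}" for i j
      by (intro integrable_continuous_interval continuous_intros)
    have "integral {0..1} (\<lambda>s. g s * g s)
        = integral {0..1} (\<lambda>s. \<Sum>i\<in>UNIV. \<Sum>j\<in>UNIV. t $ i * t $ j * (dirichlet_kernel b (x $ i) s * dirichlet_kernel b (x $ j) s))"
      by (simp add: g_def sum_product mult_ac)
    also have "\<dots> = (\<Sum>i\<in>UNIV. \<Sum>j\<in>UNIV. integral {0..1} (\<lambda>s. t $ i * t $ j * (dirichlet_kernel b (x $ i) s * dirichlet_kernel b (x $ j) s)))"
      using c1 by (simp add: integral_sum integrable_sum)
    finally show ?thesis by (simp add: integral_dirichlet_kernel_mult)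
  qed
  have "\<bar>(\<Sum>r=1..k. integral {(real r - 1) / real k .. real r / real k} g * (real k * integral {(real r - 1) / real k .. real r / real k} g))
      - integral {0..1} (\<lambda>s. g s * g s)\<bar> \<le> T * (2 * pi * (real b + 1)\<^sup>2) / real k * integral {0..1} (\<lambda>s. \<bar>g s\<bar>)"
    by (rule cell_averages_product[OF k0 cg cg]) (use lip T0 in auto)
  also have "\<dots> \<le> T * (2 * pi * (real b + 1)\<^sup>2) / real k * (T * (72 * ln (real b)))"
    using L1 T0 by (intro mult_left_mono) auto
  also have "\<dots> = T\<^sup>2 * (144 * pi * ln (real b) * (real b + 1)\<^sup>2 / real k)"
    by (simp add: power2_eq_square)
  also have "(\<Sum>r=1..k. integral {(real r - 1) / real k .. real r / real k} g * (real k * integral {(real r - 1) / real k .. real r / real k} g))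
      = real k * (\<Sum>r=1..k. (\<Sum>j\<in>UNIV. t $ j * integral {(real r - 1) / real k .. real r / real k} (dirichlet_kernel b (x $ j)))\<^sup>2)"
    unfolding cell by (subst sum_distrib_left) (simp only: power2_eq_square mult.left_commute)
  finally show ?thesis unfolding sq T_def .
qed

locale strip_estimation = prob_space M for M :: "'w measure" +
  fixes N :: "'w \<Rightarrow> (real \<times> real) multiset" and f :: "real \<Rightarrow> real" and c m L :: real and n k :: nat
  assumes ppp: "poisson_point_process M N (intensity f c n)"
    and f_cont: "continuous_on {0..1} f" and f_lower: "\<And>x. x \<in> {0..1} \<Longrightarrow> m \<le> f x" and m: "m > 0"
    and lip: "\<And>s t. s \<in> {0..1} \<Longrightarrow> t \<in> {0..1} \<Longrightarrow> \<bar>f s - f t\<bar> \<le> L * \<bar>s - t\<bar>" and L: "L \<ge> 0"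
    and c: "c > 0" and n: "n \<ge> 1" and k: "k \<ge> 1"
begin

definition w :: real where "w = real n * c / real k"
definition noise :: "nat \<Rightarrow> 'w \<Rightarrow> real" where "noise r = strip_noise N (intensity f c n) (strip f k r)"
definition lam :: "nat \<Rightarrow> real" where "lam r = measure (intensity f c n) (strip f k r)"
definition cell_int :: "nat \<Rightarrow> (real \<Rightarrow> real) \<Rightarrow> real" where
  "cell_int r u = integral {(real r - 1) / real k .. real r / real k} u"
definition corrected :: "nat \<Rightarrow> 'w \<Rightarrow> real" where
  "corrected r \<omega> = (1 + 1 / real (num_points N (strip f k r) \<omega>)) * strip_max N (strip f k r) \<omega>"

lemma w_pos: "w > 0" using n c k by (simp add: w_def)

lemma f_nonneg: "x \<in> {0..1} \<Longrightarrow> 0 \<le> f x" using f_lower m by force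

text \<open>Hence \<open>lam r / w\<close> is the average of \<open>f\<close> over the cell, the
  quantity that the corrected maximum estimates.\<close>

lemma lam_eq: "r \<in> {1..k} \<Longrightarrow> lam r = w * (real k * cell_int r f)"
  unfolding lam_def cell_int_def w_def using measure_intensity_strip(2)[OF f_cont f_cont _ _ c] f_nonneg k by simp

lemma lam_lower: "r \<in> {1..k} \<Longrightarrow> w * m \<le> lam r"
proof -
  assume r: "r \<in> {1..k}"
  let ?I = "{(real r - 1) / real k .. real r / real k}"
  have le: "(real r - 1) / real k \<le> real r / real k" by (simp add: divide_right_mono)
  have len: "real r / real k - (real r - 1) / real k = 1 / real k" by (simp add: diff_divide_distrib)
  have cI: "continuous_on ?I f" using f_cont cell_unit[OF r] continuous_on_subset by blast
  have "integral ?I (\<lambda>x. m) \<le> integral ?I f"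
    using f_lower cell_unit[OF r] by (intro integral_le integrable_continuous_interval cI) auto
  moreover have "integral ?I (\<lambda>x. m) = m / real k" using le len by simp
  ultimately have "m \<le> real k * cell_int r f" using k by (simp add: cell_int_def field_simps)
  then show ?thesis using w_pos r by (simp add: lam_eq)
qed

lemma strip_interp:
  assumes "r \<in> {1..k}"
  obtains h l where "poisson_strip M N (intensity f c n) (strip f k r) h"
    and "0 \<le> l" "l \<le> h" "h - l \<le> L / real k"
    and "\<And>s. 0 \<le> s \<Longrightarrow> s \<le> l \<Longrightarrow> level (intensity f c n) (strip f k r) s = w * s"
    and "\<And>s. l \<le> s \<Longrightarrow> s \<le> h \<Longrightarrow> w * l \<le> level (intensity f c n) (strip f k r) s \<and> level (intensity f c n) (strip f k r) s \<le> w * s"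
  using cell_strip_properties[OF prob_space_axioms ppp f_cont f_lower m lip L assms c n] unfolding w_def[symmetric] by blast

text \<open>All bounds are uniform in \<open>r\<close>: the individual means \<open>lam r\<close>
  are replaced by their common lower bound \<open>w * m\<close>.\<close>

lemma strip_facts:
  assumes r: "r \<in> {1..k}"
  shows measurable_count: "num_points N (strip f k r) \<in> measurable M (count_space UNIV)"
    and measurable_max: "strip_max N (strip f k r) \<in> borel_measurable M"
    and measurable_level: "level (intensity f c n) (strip f k r) \<in> borel_measurable borel"
    and measurable_noise: "noise r \<in> borel_measurable M"
    and noise_mean: "expectation (noise r) = 0"
    and noise_variance: "\<bar>expectation (\<lambda>\<omega>. (noise r \<omega>)\<^sup>2) - 1\<bar> \<le> 4 / (w * m)"
    and integrable_noise_cubed: "integrable M (\<lambda>\<omega>. \<bar>noise r \<omega>\<bar> ^ 3)"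
    and noise_third_moment: "expectation (\<lambda>\<omega>. \<bar>noise r \<omega>\<bar> ^ 3) \<le> 25 + 4 / (w * m)"
    and integrable_slant: "integrable M (\<lambda>\<omega>. \<bar>corrected r \<omega> - (noise r \<omega> + (if num_points N (strip f k r) \<omega> = 0 then 0 else lam r)) / w\<bar>)"
    and slant_bound: "expectation (\<lambda>\<omega>. \<bar>corrected r \<omega> - (noise r \<omega> + (if num_points N (strip f k r) \<omega> = 0 then 0 else lam r)) / w\<bar>)
      \<le> 2 * (L / real k)\<^sup>2 * w"
    and prob_empty: "prob {\<omega> \<in> space M. num_points N (strip f k r) \<omega> = 0} \<le> exp (- (w * m))"
proof -
  obtain h l where S: "poisson_strip M N (intensity f c n) (strip f k r) h"
    and l: "0 \<le> l" "l \<le> h" "h - l \<le> L / real k"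
    and flat: "\<And>s. 0 \<le> s \<Longrightarrow> s \<le> l \<Longrightarrow> level (intensity f c n) (strip f k r) s = w * s"
    and top: "\<And>s. l \<le> s \<Longrightarrow> s \<le> h \<Longrightarrow> w * l \<le> level (intensity f c n) (strip f k r) s \<and> level (intensity f c n) (strip f k r) s \<le> w * s"
    using strip_interp[OF r] by blast
  interpret S: poisson_strip M N "intensity f c n" "strip f k r" h by (rule S)
  have wm: "0 < w * m" using w_pos m by simp
  have lam4: "4 / lam r \<le> 4 / (w * m)"
    using lam_lower[OF r] wm by (intro frac_le) auto
  show "num_points N (strip f k r) \<in> measurable M (count_space UNIV)" by (rule S.measurable_cnt)
  show "strip_max N (strip f k r) \<in> borel_measurable M" by (rule S.measurable_top)
  show "level (intensity f c n) (strip f k r) \<in> borel_measurable borel" by (rule S.measurable_G)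
  show "noise r \<in> borel_measurable M" unfolding noise_def by (rule S.measurable_noise)
  show "expectation (noise r) = 0" unfolding noise_def by (rule S.noise_mean)
  show "\<bar>expectation (\<lambda>\<omega>. (noise r \<omega>)\<^sup>2) - 1\<bar> \<le> 4 / (w * m)"
    using S.noise_variance lam4 unfolding noise_def lam_def by linarith
  show "integrable M (\<lambda>\<omega>. \<bar>noise r \<omega>\<bar> ^ 3)" unfolding noise_def by (rule S.integrable_noise_cubed)
  show "expectation (\<lambda>\<omega>. \<bar>noise r \<omega>\<bar> ^ 3) \<le> 25 + 4 / (w * m)"
    using S.noise_third_moment lam4 unfolding noise_def lam_def by linarith
  show "integrable M (\<lambda>\<omega>. \<bar>corrected r \<omega> - (noise r \<omega> + (if num_points N (strip f k r) \<omega> = 0 then 0 else lam r)) / w\<bar>)"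
    unfolding corrected_def noise_def lam_def by (rule S.slanted_top_bound(1)[OF w_pos l(1,2) flat top])
  have "expectation (\<lambda>\<omega>. \<bar>corrected r \<omega> - (noise r \<omega> + (if num_points N (strip f k r) \<omega> = 0 then 0 else lam r)) / w\<bar>)
      \<le> 2 * (h - l)\<^sup>2 * w"
    unfolding corrected_def noise_def lam_def by (rule S.slanted_top_bound(2)[OF w_pos l(1,2) flat top])
  also have "\<dots> \<le> 2 * (L / real k)\<^sup>2 * w"
    using l w_pos by (intro mult_right_mono mult_left_mono power_mono) auto
  finally show "expectation (\<lambda>\<omega>. \<bar>corrected r \<omega> - (noise r \<omega> + (if num_points N (strip f k r) \<omega> = 0 then 0 else lam r)) / w\<bar>)
      \<le> 2 * (L / real k)\<^sup>2 * w" .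
  show "prob {\<omega> \<in> space M. num_points N (strip f k r) \<omega> = 0} \<le> exp (- (w * m))"
    using S.prob_count[of 0] lam_lower[OF r] by (simp add: lam_def)
qed

text \<open>The noise is a measurable function of count and maximum, and the strips inherit
  disjointness from the cells.\<close>

lemma indep_noise: "indep_vars (\<lambda>_. borel) noise {1..k}"
proof -
  have sets: "{z \<in> strip f k r. snd z \<le> s} \<in> sets (intensity f c n)" if "r \<in> {1..k}" for r s
    by (rule level_strip(1)[OF f_cont f_nonneg that c])
  have D: "strip f k r \<in> sets (intensity f c n)" if "r \<in> {1..k}" for r
    using measure_intensity_strip(1)[OF f_cont f_cont _ that c] f_nonneg by simp
  have disj: "disjoint_family_on (strip f k) {1..k}"
    using disjoint_cells[of k] by (fastforce simp: disjoint_family_on_def strip_def)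
  obtain B where B: "\<And>x. x \<in> {0..1} \<Longrightarrow> f x \<le> B"
    using compact_attains_sup[OF compact_continuous_image[OF f_cont compact_Icc]] by fastforce
  have height: "0 \<le> snd z \<and> snd z \<le> B" if "r \<in> {1..k}" "z \<in> strip f k r" for r z
  proof -
    have "fst z \<in> {0..1}" "0 \<le> snd z" "snd z \<le> f (fst z)"
      using that(2) cell_subset[OF that(1)] cell_unit[OF that(1)] by (auto simp: strip_def)
    then show ?thesis using B[of "fst z"] by linarith
  qed
  have "indep_vars (\<lambda>_. count_space UNIV \<Otimes>\<^sub>M borel)
      (\<lambda>r \<omega>. (num_points N (strip f k r) \<omega>, strip_max N (strip f k r) \<omega>)) {1..k}"
    by (rule indep_vars_strip_count_max[OF ppp sets D disj height])
  then have "indep_vars (\<lambda>_. borel)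
      (\<lambda>r \<omega>. (\<lambda>r (j, y). if j = 0 then 0 else (1 + 1 / real j) * level (intensity f c n) (strip f k r) y - lam r) r
         (num_points N (strip f k r) \<omega>, strip_max N (strip f k r) \<omega>)) {1..k}"
  proof (rule indep_vars_compose2)
    fix r assume "r \<in> {1..k}"
    note [measurable] = measurable_level[OF this]
    show "(\<lambda>(j, y). if j = 0 then 0 else (1 + 1 / real j) * level (intensity f c n) (strip f k r) y - lam r)
        \<in> borel_measurable (count_space UNIV \<Otimes>\<^sub>M borel)"
      by measurable
  qed
  then show ?thesis
    unfolding noise_def[abs_def] strip_noise_def[abs_def] lam_def[symmetric] by simp
qed

lemma estimator_eq: "estimator f N k b x \<omega> = (\<Sum>r=1..k. cell_int r (dirichlet_kernel b x) * corrected r \<omega>)"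
  unfolding estimator_def corrected_def cell_int_def
  by (intro sum.cong refl) (simp add: cell_integral continuous_on_dirichlet_kernel mult.assoc)

lemma measurable_corrected: "r \<in> {1..k} \<Longrightarrow> corrected r \<in> borel_measurable M"
proof -
  assume r: "r \<in> {1..k}"
  note [measurable] = measurable_count[OF r] measurable_max[OF r]
  show ?thesis unfolding corrected_def[abs_def] by measurable
qed

lemma measurable_estimator: "estimator f N k b x \<in> borel_measurable M"
proof -
  have "(\<lambda>\<omega>. \<Sum>r=1..k. cell_int r (dirichlet_kernel b x) * corrected r \<omega>) \<in> borel_measurable M"
    by (intro borel_measurable_sum borel_measurable_times measurable_corrected) auto
  then show ?thesis by (simp add: estimator_eq[abs_def])
qed

text \<open>The absolute weights sum to at most the integral of the absolute kernel, so an error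
  that is uniform over the cells is multiplied by the Lebesgue constant instead of the number of
  cells.\<close>

lemma estimator_remainder:
  assumes x: "x \<in> {0..1}" and b: "b \<ge> 2" and FM: "\<And>x. x \<in> {0..1} \<Longrightarrow> f x \<le> FM"
    and fourier: "\<bar>integral {0..1} (\<lambda>t. dirichlet_kernel b x t * f t) - f x\<bar> \<le> C / real b"
  shows "integrable M (\<lambda>\<omega>. \<bar>estimator f N k b x \<omega> - f x - (\<Sum>r=1..k. cell_int r (dirichlet_kernel b x) * noise r \<omega>) / w\<bar>)"
    and "expectation (\<lambda>\<omega>. \<bar>estimator f N k b x \<omega> - f x - (\<Sum>r=1..k. cell_int r (dirichlet_kernel b x) * noise r \<omega>) / w\<bar>)
      \<le> 72 * ln (real b) * (2 * (L / real k)\<^sup>2 * w + FM * exp (- (w * m)) + L / real k) + C / real b"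
proof -
  let ?K = "dirichlet_kernel b x"
  let ?W = "\<lambda>r. cell_int r ?K"
  let ?E = "\<lambda>r. {\<omega> \<in> space M. num_points N (strip f k r) \<omega> = 0}"
  let ?R = "\<lambda>\<omega>. \<bar>estimator f N k b x \<omega> - f x - (\<Sum>r=1..k. ?W r * noise r \<omega>) / w\<bar>"
  let ?d = "\<lambda>r \<omega>. \<bar>corrected r \<omega> - (noise r \<omega> + (if num_points N (strip f k r) \<omega> = 0 then 0 else lam r)) / w\<bar>"
  have k0: "k > 0" using k by simp
  have K1: "integral {0..1} (\<lambda>t. \<bar>?K t\<bar>) \<le> 72 * ln (real b)"
    by (rule integral_abs_dirichlet_kernel[OF b x])
  have W1: "(\<Sum>r=1..k. \<bar>?W r\<bar>) \<le> 72 * ln (real b)"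
    using cell_abs_integrals_le[OF k0 continuous_on_dirichlet_kernel, of b x] K1 unfolding cell_int_def by linarith
  have F: "real k * cell_int r f = lam r / w" if "r \<in> {1..k}" for r
    using lam_eq[OF that] w_pos by simp
  have FM0: "0 \<le> FM" using FM[of 0] f_nonneg[of 0] by simp
  have Fb: "0 \<le> lam r / w" "lam r / w \<le> FM" if r: "r \<in> {1..k}" for r
  proof -
    show "0 \<le> lam r / w" using w_pos by (simp add: lam_def)
    let ?I = "{(real r - 1) / real k .. real r / real k}"
    have le: "(real r - 1) / real k \<le> real r / real k" by (simp add: divide_right_mono)
    have len: "real r / real k - (real r - 1) / real k = 1 / real k" by (simp add: diff_divide_distrib)
    have cI: "continuous_on ?I f" using f_cont cell_unit[OF r] continuous_on_subset by blast
    have "integral ?I f \<le> integral ?I (\<lambda>x. FM)"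
      using FM cell_unit[OF r] by (intro integral_le integrable_continuous_interval cI) auto
    also have "\<dots> = FM / real k" using le len by simp
    finally show "lam r / w \<le> FM" unfolding F[OF r, symmetric] cell_int_def using k0 by (simp add: field_simps)
  qed
  have riemann: "\<bar>(\<Sum>r=1..k. ?W r * (lam r / w)) - integral {0..1} (\<lambda>t. ?K t * f t)\<bar> \<le> L / real k * (72 * ln (real b))"
  proof -
    have "(\<Sum>r=1..k. ?W r * (lam r / w)) = (\<Sum>r=1..k. ?W r * (real k * cell_int r f))"
      by (intro sum.cong refl) (simp add: F)
    moreover have "\<bar>(\<Sum>r=1..k. ?W r * (real k * cell_int r f)) - integral {0..1} (\<lambda>t. ?K t * f t)\<bar>
        \<le> L / real k * integral {0..1} (\<lambda>t. \<bar>?K t\<bar>)"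
      unfolding cell_int_def by (rule cell_averages_product[OF k0 continuous_on_dirichlet_kernel f_cont lip L])
    moreover have "L / real k * integral {0..1} (\<lambda>t. \<bar>?K t\<bar>) \<le> L / real k * (72 * ln (real b))"
      using K1 L by (intro mult_left_mono) auto
    ultimately show ?thesis by linarith
  qed
  define Y where "Y = (\<lambda>\<omega>. (\<Sum>r=1..k. \<bar>?W r\<bar> * ?d r \<omega>) + (\<Sum>r=1..k. \<bar>?W r\<bar> * (FM * indicator (?E r) \<omega>))
      + (L / real k * (72 * ln (real b)) + C / real b))"
  have bound: "?R \<omega> \<le> Y \<omega>" if \<omega>: "\<omega> \<in> space M" for \<omega>
  proof -
    \<comment> \<open>A corrected maximum is noise over \<open>w\<close>, plus the cell average
      \<open>lam r / w\<close>, plus the slanted-top error; on an empty strip the average is taken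
      away again.\<close>
    have split: "?W r * corrected r \<omega> - ?W r * noise r \<omega> / w =
        ?W r * (corrected r \<omega> - (noise r \<omega> + (if num_points N (strip f k r) \<omega> = 0 then 0 else lam r)) / w)
        + ?W r * (lam r / w) - ?W r * (lam r / w * indicator (?E r) \<omega>)" for r
      using \<omega> by (simp add: algebra_simps add_divide_distrib)
    have "estimator f N k b x \<omega> - f x - (\<Sum>r=1..k. ?W r * noise r \<omega>) / w
        = (\<Sum>r=1..k. ?W r * corrected r \<omega> - ?W r * noise r \<omega> / w) - f x"
      unfolding estimator_eq by (simp add: sum_subtractf sum_divide_distrib)
    also have "\<dots> = (\<Sum>r=1..k. ?W r * (corrected r \<omega> - (noise r \<omega> + (if num_points N (strip f k r) \<omega> = 0 then 0 else lam r)) / w))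
        - (\<Sum>r=1..k. ?W r * (lam r / w * indicator (?E r) \<omega>))
        + ((\<Sum>r=1..k. ?W r * (lam r / w)) - integral {0..1} (\<lambda>t. ?K t * f t))
        + (integral {0..1} (\<lambda>t. ?K t * f t) - f x)"
      unfolding split by (simp add: sum.distrib sum_subtractf)
    finally have "?R \<omega> \<le> \<bar>\<Sum>r=1..k. ?W r * (corrected r \<omega> - (noise r \<omega> + (if num_points N (strip f k r) \<omega> = 0 then 0 else lam r)) / w)\<bar>
        + \<bar>\<Sum>r=1..k. ?W r * (lam r / w * indicator (?E r) \<omega>)\<bar> + L / real k * (72 * ln (real b)) + C / real b"
      using riemann fourier by linarith
    also have "\<bar>\<Sum>r=1..k. ?W r * (corrected r \<omega> - (noise r \<omega> + (if num_points N (strip f k r) \<omega> = 0 then 0 else lam r)) / w)\<bar>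
        \<le> (\<Sum>r=1..k. \<bar>?W r\<bar> * ?d r \<omega>)"
      by (rule order.trans[OF sum_abs]) (simp only: abs_mult)
    also have "\<bar>\<Sum>r=1..k. ?W r * (lam r / w * indicator (?E r) \<omega>)\<bar> \<le> (\<Sum>r=1..k. \<bar>?W r\<bar> * (FM * indicator (?E r) \<omega>))"
    proof (rule order.trans[OF sum_abs], rule sum_mono)
      fix r assume r: "r \<in> {1..k}"
      show "\<bar>?W r * (lam r / w * indicator (?E r) \<omega>)\<bar> \<le> \<bar>?W r\<bar> * (FM * indicator (?E r) \<omega>)"
        unfolding abs_mult using Fb[OF r] by (intro mult_left_mono mult_mono) auto
    qed
    finally show ?thesis by (simp add: Y_def)
  qed
  have E [measurable]: "?E r \<in> events" if "r \<in> {1..k}" for r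
    using measurable_sets[OF measurable_count[OF that], of "{0}"] by (simp add: vimage_def Int_def conj_commute)
  have iE: "integrable M (\<lambda>\<omega>. \<bar>?W r\<bar> * (FM * indicator (?E r) \<omega>))" if "r \<in> {1..k}" for r
    using E[OF that] by (intro integrable_mult_right integrable_real_indicator) (auto simp: less_top[symmetric])
  have id: "integrable M (\<lambda>\<omega>. \<bar>?W r\<bar> * ?d r \<omega>)" if "r \<in> {1..k}" for r
    using integrable_slant[OF that] by (rule integrable_mult_right)
  have iY: "integrable M Y"
    unfolding Y_def using iE id by (intro Bochner_Integration.integrable_add Bochner_Integration.integrable_sum) auto
  have Rm: "?R \<in> borel_measurable M"
    using measurable_noise by (intro borel_measurable_abs borel_measurable_diff measurable_estimator borel_measurable_divide borel_measurable_sum borel_measurable_times) auto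
  show "integrable M ?R"
  proof (rule Bochner_Integration.integrable_bound[OF iY Rm], rule AE_I2)
    fix \<omega> assume "\<omega> \<in> space M"
    from bound[OF this] show "norm (?R \<omega>) \<le> norm (Y \<omega>)" by simp
  qed
  then have "expectation ?R \<le> expectation Y"
    by (rule Bochner_Integration.integral_mono[OF _ iY bound])
  also have "\<dots> = (\<Sum>r=1..k. \<bar>?W r\<bar> * expectation (?d r)) + (\<Sum>r=1..k. \<bar>?W r\<bar> * (FM * prob (?E r)))
      + (L / real k * (72 * ln (real b)) + C / real b)"
  proof -
    have "expectation Y = expectation (\<lambda>\<omega>. \<Sum>r=1..k. \<bar>?W r\<bar> * ?d r \<omega>) + expectation (\<lambda>\<omega>. \<Sum>r=1..k. \<bar>?W r\<bar> * (FM * indicator (?E r) \<omega>))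
      + expectation (\<lambda>\<omega>. L / real k * (72 * ln (real b)) + C / real b)"
      unfolding Y_def using iE id
      by (subst Bochner_Integration.integral_add, (intro Bochner_Integration.integrable_add Bochner_Integration.integrable_sum; simp)+)+
         simp
    also have "expectation (\<lambda>\<omega>. \<Sum>r=1..k. \<bar>?W r\<bar> * ?d r \<omega>) = (\<Sum>r=1..k. \<bar>?W r\<bar> * expectation (?d r))"
      using id by (subst Bochner_Integration.integral_sum) auto
    also have "expectation (\<lambda>\<omega>. \<Sum>r=1..k. \<bar>?W r\<bar> * (FM * indicator (?E r) \<omega>)) = (\<Sum>r=1..k. \<bar>?W r\<bar> * (FM * prob (?E r)))"
      using iE E by (subst Bochner_Integration.integral_sum) (auto intro!: sum.cong)
    finally show ?thesis by (simp add: prob_space)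
  qed
  also have "\<dots> \<le> (\<Sum>r=1..k. \<bar>?W r\<bar> * (2 * (L / real k)\<^sup>2 * w)) + (\<Sum>r=1..k. \<bar>?W r\<bar> * (FM * exp (- (w * m))))
      + (L / real k * (72 * ln (real b)) + C / real b)"
    using slant_bound prob_empty FM0 by (intro add_mono sum_mono mult_left_mono order.refl) auto
  also have "\<dots> = (\<Sum>r=1..k. \<bar>?W r\<bar>) * (2 * (L / real k)\<^sup>2 * w + FM * exp (- (w * m)))
      + (L / real k * (72 * ln (real b)) + C / real b)"
    by (simp add: sum_distrib_right distrib_left sum.distrib)
  also have "\<dots> \<le> 72 * ln (real b) * (2 * (L / real k)\<^sup>2 * w + FM * exp (- (w * m)))
      + (L / real k * (72 * ln (real b)) + C / real b)"
    using W1 FM0 w_pos by (intro add_right_mono mult_right_mono) auto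
  also have "\<dots> = 72 * ln (real b) * (2 * (L / real k)\<^sup>2 * w + FM * exp (- (w * m)) + L / real k) + C / real b"
    by (simp add: distrib_left mult_ac)
  finally show "expectation ?R \<le> 72 * ln (real b) * (2 * (L / real k)\<^sup>2 * w + FM * exp (- (w * m)) + L / real k) + C / real b" .
qed

end

context strip_estimation
begin

lemma cell_weight_bound: "r \<in> {1..k} \<Longrightarrow> \<bar>cell_int r (dirichlet_kernel b x)\<bar> \<le> 2 * (real b + 1) / real k"
proof -
  assume r: "r \<in> {1..k}"
  have le: "(real r - 1) / real k \<le> real r / real k" by (simp add: divide_right_mono)
  have len: "real r / real k - (real r - 1) / real k = 1 / real k" by (simp add: diff_divide_distrib)
  have "norm (integral {(real r - 1) / real k .. real r / real k} (dirichlet_kernel b x)) \<le> 2 * (real b + 1) * (real r / real k - (real r - 1) / real k)"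
    by (rule integral_bound[OF le continuous_on_dirichlet_kernel]) (simp only: real_norm_def abs_dirichlet_kernel_le)
  then show ?thesis unfolding len cell_int_def by simp
qed

text \<open>As \<open>iexp\<close> is 1-Lipschitz, the \<open>L^1\<close> remainder bounds the cost
  of replacing the statistic by the noise sum with weights \<open>\<alpha> r\<close>. The second
  line is \<open>char_weighted_sum_approx\<close>, where \<open>\<epsilon>\<close> bounds the
  weights: kernel supremum times cell length.\<close>

lemma char_bound:
  fixes x t :: "real^'p" and v C FM :: real
  assumes x: "\<And>j. x $ j \<in> {0..1}" and b: "b \<ge> 2" and FM: "\<And>x. x \<in> {0..1} \<Longrightarrow> f x \<le> FM"
    and fourier: "\<And>y. y \<in> {0..1} \<Longrightarrow> \<bar>integral {0..1} (\<lambda>t. dirichlet_kernel b y t * f t) - f y\<bar> \<le> C / real b"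
    and v: "v \<ge> 0"
  defines "\<rho> \<equiv> v * real k / real n" and "T \<equiv> (\<Sum>j\<in>UNIV. \<bar>t $ j\<bar>)"
  defines "\<alpha> \<equiv> \<lambda>r. \<rho> * (\<Sum>j\<in>UNIV. t $ j * cell_int r (dirichlet_kernel b (x $ j)))"
  defines "\<epsilon> \<equiv> \<rho> * (T * (2 * (real b + 1) / real k))"
  shows "cmod (expectation (\<lambda>\<omega>. iexp (t \<bullet> (\<chi> j. v * c * (estimator f N k b (x $ j) \<omega> - f (x $ j))))) - of_real (exp (- (\<Sum>r=1..k. (\<alpha> r)\<^sup>2) / 2)))
    \<le> T * (v * c * (72 * ln (real b) * (2 * (L / real k)\<^sup>2 * w + FM * exp (- (w * m)) + L / real k) + C / real b))
      + (\<epsilon> * (25 + 4 / (w * m)) + 4 / (w * m) + \<epsilon>\<^sup>2) * (\<Sum>r=1..k. (\<alpha> r)\<^sup>2)"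
proof -
  define V where "V = (\<lambda>\<omega>. t \<bullet> (\<chi> j. v * c * (estimator f N k b (x $ j) \<omega> - f (x $ j))))"
  define S where "S = (\<lambda>\<omega>. \<Sum>r=1..k. \<alpha> r * noise r \<omega>)"
  define R where "R = (\<lambda>j \<omega>. \<bar>estimator f N k b (x $ j) \<omega> - f (x $ j) - (\<Sum>r=1..k. cell_int r (dirichlet_kernel b (x $ j)) * noise r \<omega>) / w\<bar>)"
  define E where "E = 72 * ln (real b) * (2 * (L / real k)\<^sup>2 * w + FM * exp (- (w * m)) + L / real k) + C / real b"
  have \<rho>: "\<rho> \<ge> 0" using v by (simp add: \<rho>_def)
  have T: "T \<ge> 0" by (simp add: T_def sum_nonneg)
  \<comment> \<open>The factor \<open>c\<close> of the normalization cancels against the one in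
    \<open>w\<close>, so the weights are free of \<open>c\<close>.\<close>
  have \<rho>w: "\<rho> = v * c / w" using n k c by (simp add: \<rho>_def w_def)
  have Rint: "integrable M (R j)" and RE: "expectation (R j) \<le> E" for j
    unfolding R_def E_def using estimator_remainder[OF x b FM fourier[OF x]] by auto
  have V_eq: "V \<omega> = (\<Sum>j\<in>UNIV. t $ j * (v * c * (estimator f N k b (x $ j) \<omega> - f (x $ j))))" for \<omega>
    by (simp add: V_def inner_vec_def)
  have S_eq: "S \<omega> = (\<Sum>j\<in>UNIV. t $ j * (v * c * ((\<Sum>r=1..k. cell_int r (dirichlet_kernel b (x $ j)) * noise r \<omega>) / w)))" for \<omega>
  proof -
    have "S \<omega> = (\<Sum>r=1..k. \<Sum>j\<in>UNIV. t $ j * (\<rho> * (cell_int r (dirichlet_kernel b (x $ j)) * noise r \<omega>)))"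
      unfolding S_def \<alpha>_def by (simp add: sum_distrib_left sum_distrib_right mult_ac)
    also have "\<dots> = (\<Sum>j\<in>UNIV. \<Sum>r=1..k. t $ j * (\<rho> * (cell_int r (dirichlet_kernel b (x $ j)) * noise r \<omega>)))"
      by (rule sum.swap)
    finally show ?thesis by (simp add: \<rho>w sum_distrib_left sum_divide_distrib mult_ac)
  qed
  have diff: "\<bar>V \<omega> - S \<omega>\<bar> \<le> (\<Sum>j\<in>UNIV. \<bar>t $ j\<bar> * (v * c * R j \<omega>))" for \<omega>
  proof -
    have "V \<omega> - S \<omega> = (\<Sum>j\<in>UNIV. t $ j * (v * c * (estimator f N k b (x $ j) \<omega> - f (x $ j) - (\<Sum>r=1..k. cell_int r (dirichlet_kernel b (x $ j)) * noise r \<omega>) / w)))"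
      unfolding V_eq S_eq by (simp add: sum_subtractf right_diff_distrib)
    also have "\<bar>\<dots>\<bar> \<le> (\<Sum>j\<in>UNIV. \<bar>t $ j\<bar> * (v * c * R j \<omega>))"
      using v c by (intro order.trans[OF sum_abs]) (simp add: abs_mult R_def)
    finally show ?thesis .
  qed
  have estm: "(\<lambda>\<omega>. v * c * (estimator f N k b (x $ j) \<omega> - f (x $ j))) \<in> borel_measurable M" for j
    using measurable_estimator[of b "x $ j"] by simp
  have Vm [measurable]: "V \<in> borel_measurable M"
    unfolding V_eq[abs_def] by (intro borel_measurable_sum borel_measurable_times[OF borel_measurable_const estm])
  have Sm [measurable]: "S \<in> borel_measurable M"
    unfolding S_def using measurable_noise by (intro borel_measurable_sum borel_measurable_times) auto
  have iV: "integrable M (\<lambda>\<omega>. iexp (V \<omega>))" and iS: "integrable M (\<lambda>\<omega>. iexp (S \<omega>))"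
    by (rule integrable_const_bound[of _ 1]; simp)+
  have "cmod (expectation (\<lambda>\<omega>. iexp (V \<omega>)) - expectation (\<lambda>\<omega>. iexp (S \<omega>))) = cmod (expectation (\<lambda>\<omega>. iexp (V \<omega>) - iexp (S \<omega>)))"
    using iV iS by simp
  also have "\<dots> \<le> expectation (\<lambda>\<omega>. cmod (iexp (V \<omega>) - iexp (S \<omega>)))"
    by (rule integral_norm_bound)
  also have "\<dots> \<le> expectation (\<lambda>\<omega>. \<Sum>j\<in>UNIV. \<bar>t $ j\<bar> * (v * c * R j \<omega>))"
  proof (rule integral_mono')
    show "integrable M (\<lambda>\<omega>. \<Sum>j\<in>UNIV. \<bar>t $ j\<bar> * (v * c * R j \<omega>))"
      using Rint by (intro Bochner_Integration.integrable_sum integrable_mult_right) auto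
    show "cmod (iexp (V \<omega>) - iexp (S \<omega>)) \<le> (\<Sum>j\<in>UNIV. \<bar>t $ j\<bar> * (v * c * R j \<omega>))" for \<omega>
      by (rule order.trans[OF cmod_iexp_diff_le diff])
    show "0 \<le> (\<Sum>j\<in>UNIV. \<bar>t $ j\<bar> * (v * c * R j \<omega>))" for \<omega>
      using v c by (intro sum_nonneg mult_nonneg_nonneg) (auto simp: R_def)
  qed
  also have "\<dots> = (\<Sum>j\<in>UNIV. \<bar>t $ j\<bar> * (v * c * expectation (R j)))"
    using Rint by (subst Bochner_Integration.integral_sum) auto
  also have "\<dots> \<le> (\<Sum>j\<in>UNIV. \<bar>t $ j\<bar> * (v * c * E))"
    using v c RE by (intro sum_mono mult_left_mono) auto
  also have "\<dots> = T * (v * c * E)" by (simp add: T_def sum_distrib_right)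
  finally have 1: "cmod (expectation (\<lambda>\<omega>. iexp (V \<omega>)) - expectation (\<lambda>\<omega>. iexp (S \<omega>))) \<le> T * (v * c * E)" .
  have \<alpha>: "\<bar>\<alpha> r\<bar> \<le> \<epsilon>" if "r \<in> {1..k}" for r
  proof -
    have "\<bar>\<Sum>j\<in>UNIV. t $ j * cell_int r (dirichlet_kernel b (x $ j))\<bar> \<le> (\<Sum>j\<in>UNIV. \<bar>t $ j\<bar> * (2 * (real b + 1) / real k))"
    proof (intro order.trans[OF sum_abs] sum_mono)
      fix j :: 'p
      show "\<bar>t $ j * cell_int r (dirichlet_kernel b (x $ j))\<bar> \<le> \<bar>t $ j\<bar> * (2 * (real b + 1) / real k)"
        unfolding abs_mult by (rule mult_left_mono[OF cell_weight_bound[OF that] abs_ge_zero])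
    qed
    also have "\<dots> = T * (2 * (real b + 1) / real k)" by (simp only: T_def sum_distrib_right)
    finally have "\<bar>\<Sum>j\<in>UNIV. t $ j * cell_int r (dirichlet_kernel b (x $ j))\<bar> \<le> T * (2 * (real b + 1) / real k)" .
    from mult_left_mono[OF this \<rho>] show ?thesis
      by (simp only: \<alpha>_def \<epsilon>_def abs_mult abs_of_nonneg[OF \<rho>])
  qed
  have 2: "cmod (expectation (\<lambda>\<omega>. iexp (S \<omega>)) - of_real (exp (- (\<Sum>r=1..k. (\<alpha> r)\<^sup>2) / 2)))
      \<le> (\<epsilon> * (25 + 4 / (w * m)) + 4 / (w * m) + \<epsilon>\<^sup>2) * (\<Sum>r=1..k. (\<alpha> r)\<^sup>2)"
    unfolding S_def
    by (rule char_weighted_sum_approx[OF indep_noise])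
       (use \<alpha> integrable_noise_cubed noise_mean noise_variance noise_third_moment in auto)
  have "cmod (expectation (\<lambda>\<omega>. iexp (V \<omega>)) - of_real (exp (- (\<Sum>r=1..k. (\<alpha> r)\<^sup>2) / 2)))
      \<le> cmod (expectation (\<lambda>\<omega>. iexp (V \<omega>)) - expectation (\<lambda>\<omega>. iexp (S \<omega>)))
       + cmod (expectation (\<lambda>\<omega>. iexp (S \<omega>)) - of_real (exp (- (\<Sum>r=1..k. (\<alpha> r)\<^sup>2) / 2)))"
    using dist_triangle[of "expectation (\<lambda>\<omega>. iexp (V \<omega>))" "of_real (exp (- (\<Sum>r=1..k. (\<alpha> r)\<^sup>2) / 2))" "expectation (\<lambda>\<omega>. iexp (S \<omega>))"]
    by (simp only: dist_norm)
  with 1 2 show ?thesis unfolding V_def E_def by linarith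
qed

end

section \<open>Growth conditions and the limit\<close>

lemma rate_canonical:
  assumes n: "n \<ge> 2" and u: "u > 0"
  shows "rate n (sqrt (real n)) (sqrt (real n) * ln (real n) * u ^ 2)
    = sqrt (real n) * ln (real n) powr (- 1 / 2) * inverse u"
proof -
  have pos: "real n > 0" "ln (real n) > 0" using n by simp_all
  have "sqrt (real n) * (sqrt (real n) * ln (real n) * u ^ 2) = real n * ln (real n) * u ^ 2"
    by (simp flip: mult.assoc)
  then have "rate n (sqrt (real n)) (sqrt (real n) * ln (real n) * u ^ 2)
      = real n * (real n * ln (real n) * u ^ 2) powr (- 1 / 2)"
    by (simp only: rate_def)
  also have "\<dots> = real n * (real n powr (- 1 / 2) * ln (real n) powr (- 1 / 2) * (u ^ 2) powr (- 1 / 2))"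
    using pos by (simp add: powr_mult)
  also have "(u ^ 2) powr (- 1 / 2) = inverse u"
    using u by (simp add: powr_powr powr_minus flip: powr_numeral)
  also have "real n * (real n powr (- 1 / 2) * ln (real n) powr (- 1 / 2) * inverse u)
      = (real n powr 1 * real n powr (- 1 / 2)) * ln (real n) powr (- 1 / 2) * inverse u"
    using pos by simp
  also have "real n powr 1 * real n powr (- 1 / 2) = sqrt (real n)"
    by (simp only: powr_add[symmetric]) (simp add: powr_half_sqrt)
  finally show ?thesis .
qed

lemma asymp_equiv_bounds:
  fixes f g :: "nat \<Rightarrow> real"
  assumes "f \<sim>[at_top] g" and "\<forall>\<^sub>F n in at_top. g n > 0"
  shows "\<forall>\<^sub>F n in at_top. g n / 2 \<le> f n \<and> f n \<le> 2 * g n"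
proof -
  have "((\<lambda>n. f n / g n) \<longlongrightarrow> 1) at_top"
    by (rule asymp_equivD_strong[OF assms(1)]) (use assms(2) in eventually_elim, simp)
  then have "\<forall>\<^sub>F n in at_top. f n / g n > 1 / 2" "\<forall>\<^sub>F n in at_top. f n / g n < 2"
    using order_tendstoD(1)[of _ 1 _ "1 / 2"] order_tendstoD(2)[of _ 1 _ 2] by fastforce+
  with assms(2) show ?thesis
    by eventually_elim (auto simp: field_simps)
qed

text \<open>Up to a constant, (i) is the hypothesis \<open>slow\<close>. Eventually the quantities
  in (ii) and (iii) are at least \<open>u n / 4\<close> and the one in (iv) is at most
  \<open>4 / u n\<close>. For the four conditions factor-2 bounds on \<open>k\<close> and
  \<open>b\<close> suffice; the rate uses the full equivalences.\<close>

lemma canonical_choice: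
  fixes u :: "nat \<Rightarrow> real" and k b :: "nat \<Rightarrow> nat"
  assumes u: "filterlim u at_top sequentially"
    and slow: "(\<lambda>n. ln (real n) ^ 2 * u n ^ 2 / sqrt (real n)) \<longlonglongrightarrow> 0"
    and b: "(\<lambda>n. real (b n)) \<sim>[at_top] (\<lambda>n. sqrt (real n))"
    and k: "(\<lambda>n. real (k n)) \<sim>[at_top] (\<lambda>n. sqrt (real n) * ln (real n) * u n ^ 2)"
  shows "filterlim k at_top sequentially \<and> filterlim b at_top sequentially \<and> growth_conditions k b \<and>
    (\<lambda>n. rate n (b n) (k n)) \<sim>[at_top] (\<lambda>n. sqrt (real n) * ln (real n) powr (- 1 / 2) * inverse (u n))"
proof -
  define K where "K = (\<lambda>n. sqrt (real n) * ln (real n) * u n ^ 2)"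
  have u1: "\<forall>\<^sub>F n in sequentially. u n \<ge> 1" using u by (simp add: filterlim_at_top)
  \<comment> \<open>Large enough for \<open>1 \<le> ln n\<close> and for
    \<open>2 \<le> sqrt n\<close>; the latter gives \<open>b n \<le> n\<close> in the proof of
    (iii).\<close>
  have n9: "\<forall>\<^sub>F n in sequentially. n \<ge> 9" by (rule eventually_ge_at_top)
  have base: "\<forall>\<^sub>F n in sequentially. u n \<ge> 1 \<and> n \<ge> 9 \<and> ln (real n) \<ge> 1 \<and> sqrt (real n) \<ge> 1 \<and> K n > 0 \<and> sqrt (real n) * u n ^ 2 \<le> K n"
    using u1 n9
  proof eventually_elim
    case (elim n)
    have "exp 1 \<le> real n" using exp_le elim by linarith
    then have ln1: "ln (real n) \<ge> 1" using elim by (subst ln_ge_iff) auto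
    have s1: "sqrt (real n) \<ge> 1" using elim by simp
    have "sqrt (real n) * 1 * u n ^ 2 \<le> K n"
      unfolding K_def using ln1 s1 by (intro mult_right_mono mult_left_mono) auto
    moreover have "0 < sqrt (real n) * u n ^ 2" using s1 elim by simp
    ultimately have "0 < K n" "sqrt (real n) * u n ^ 2 \<le> K n" by linarith+
    then show ?case using elim ln1 s1 by blast
  qed
  have bb: "\<forall>\<^sub>F n in sequentially. sqrt (real n) / 2 \<le> real (b n) \<and> real (b n) \<le> 2 * sqrt (real n)"
    by (rule asymp_equiv_bounds[OF b]) (use eventually_gt_at_top[of 0] in \<open>eventually_elim, simp\<close>)
  have kb: "\<forall>\<^sub>F n in sequentially. K n / 2 \<le> real (k n) \<and> real (k n) \<le> 2 * K n"
    by (rule asymp_equiv_bounds[OF k[folded K_def]]) (use base in \<open>eventually_elim, simp\<close>)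
  have u2: "filterlim (\<lambda>n. u n / 4) at_top sequentially"
    using filterlim_tendsto_pos_mult_at_top[OF tendsto_const, of "1 / 4" u] u by simp
  have usq: "y \<le> y ^ 2" if "y \<ge> 1" for y :: real
    using that mult_left_mono[of 1 y y] by (simp add: power2_eq_square)
  have "filterlim (\<lambda>n. real (k n)) at_top sequentially"
  proof (rule filterlim_at_top_mono[OF u2])
    show "\<forall>\<^sub>F n in sequentially. u n / 4 \<le> real (k n)"
      using base kb
    proof eventually_elim
      case (elim n)
      have "1 * u n ^ 2 \<le> sqrt (real n) * u n ^ 2" using elim by (intro mult_right_mono) auto
      then show ?case using elim usq[of "u n"] by linarith
    qed
  qed
  then have kinf: "filterlim k at_top sequentially"
    by (simp add: filterlim_sequentially_iff_filterlim_real)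
  have "filterlim (\<lambda>n. sqrt (real n) / 2) at_top sequentially" by real_asymp
  then have "filterlim (\<lambda>n. real (b n)) at_top sequentially"
    by (rule filterlim_at_top_mono) (use bb in eventually_elim, simp)
  then have binf: "filterlim b at_top sequentially"
    by (simp add: filterlim_sequentially_iff_filterlim_real)
  have i: "(\<lambda>n. real (k n) * ln (real n) / real n) \<longlonglongrightarrow> 0"
  proof (rule tendsto_sandwich[where f = "\<lambda>_. 0"])
    show "(\<lambda>n. 2 * (ln (real n) ^ 2 * u n ^ 2 / sqrt (real n))) \<longlonglongrightarrow> 0"
      using tendsto_mult_right_zero[OF slow, of 2] by simp
    show "\<forall>\<^sub>F n in sequentially. 0 \<le> real (k n) * ln (real n) / real n"
      using base by eventually_elim simp
    show "\<forall>\<^sub>F n in sequentially. real (k n) * ln (real n) / real n \<le> 2 * (ln (real n) ^ 2 * u n ^ 2 / sqrt (real n))"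
      using base kb
    proof eventually_elim
      case (elim n)
      have "real (k n) * ln (real n) / real n \<le> 2 * K n * ln (real n) / real n"
        using elim by (intro divide_right_mono mult_right_mono) auto
      also have "\<dots> = 2 * (ln (real n) ^ 2 * u n ^ 2) * (sqrt (real n) / real n)"
        by (simp add: K_def power2_eq_square)
      also have "sqrt (real n) / real n = 1 / sqrt (real n)"
        by (simp add: sqrt_divide_self_eq inverse_eq_divide)
      finally show ?case by simp
    qed
  qed simp
  have ii: "filterlim (\<lambda>n. real (k n) ^ 2 / real n) at_top sequentially"
  proof (rule filterlim_at_top_mono[OF u2])
    show "\<forall>\<^sub>F n in sequentially. u n / 4 \<le> real (k n) ^ 2 / real n"
      using base kb
    proof eventually_elim
      case (elim n)
      have "u n * real n \<le> (u n ^ 2) ^ 2 * real n"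
        using elim usq[of "u n"] usq[of "u n ^ 2"] by (intro mult_right_mono) auto
      also have "\<dots> = (sqrt (real n) * u n ^ 2) ^ 2" by (simp add: power_mult_distrib)
      also have "\<dots> \<le> (2 * real (k n)) ^ 2" using elim by (intro power_mono) auto
      finally show ?case using elim by (simp add: field_simps power_mult_distrib)
    qed
  qed
  have iii: "filterlim (\<lambda>n. real (k n) / (real (b n) * ln (real (b n)))) at_top sequentially"
  proof (rule filterlim_at_top_mono[OF u2])
    have "\<forall>\<^sub>F n in sequentially. b n \<ge> 2" using binf by (simp add: filterlim_at_top)
    then show "\<forall>\<^sub>F n in sequentially. u n / 4 \<le> real (k n) / (real (b n) * ln (real (b n)))"
      using base kb bb
    proof eventually_elim
      case (elim n)
      have "2 * sqrt (real n) \<le> sqrt (real n) * sqrt (real n)"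
        using elim real_sqrt_le_mono[of 4 "real n"] by (intro mult_right_mono) auto
      then have "real (b n) \<le> real n" using elim by simp
      then have "ln (real (b n)) \<le> ln (real n)" using elim by (intro ln_mono) auto
      then have "real (b n) * ln (real (b n)) \<le> (2 * sqrt (real n)) * ln (real n)"
        using elim by (intro mult_mono) auto
      then have "u n / 4 * (real (b n) * ln (real (b n))) \<le> u n ^ 2 / 4 * ((2 * sqrt (real n)) * ln (real n))"
        using elim usq[of "u n"] by - (rule mult_mono, auto)
      also have "\<dots> = K n / 2" by (simp add: K_def)
      finally have "u n / 4 * (real (b n) * ln (real (b n))) \<le> real (k n)" using elim by linarith
      then show ?case using elim by (subst pos_le_divide_eq) auto
    qed
  qed
  have iv: "(\<lambda>n. real n * real (k n) powr (- 1 / 2) * real (b n) powr (- 3 / 2)) \<longlonglongrightarrow> 0"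
  proof (rule tendsto_sandwich[where f = "\<lambda>_. 0"])
    show "(\<lambda>n. 4 / u n) \<longlonglongrightarrow> 0" by (rule real_tendsto_divide_at_top[OF tendsto_const u])
    show "\<forall>\<^sub>F n in sequentially. 0 \<le> real n * real (k n) powr (- 1 / 2) * real (b n) powr (- 3 / 2)" by simp
    show "\<forall>\<^sub>F n in sequentially. real n * real (k n) powr (- 1 / 2) * real (b n) powr (- 3 / 2) \<le> 4 / u n"
      using base kb bb
    proof eventually_elim
      case (elim n)
      define s where "s = sqrt (real n)"
      have s: "s \<ge> 1" "s > 0" using elim by (auto simp: s_def)
      have "real (k n) powr (- 1 / 2) \<le> (s * u n ^ 2 / 2) powr (- 1 / 2)"
        using elim s by (intro powr_mono2') (auto simp: s_def)
      moreover have "real (b n) powr (- 3 / 2) \<le> (s / 2) powr (- 3 / 2)"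
        using elim s by (intro powr_mono2') (auto simp: s_def)
      ultimately have "real n * real (k n) powr (- 1 / 2) * real (b n) powr (- 3 / 2)
          \<le> real n * (s * u n ^ 2 / 2) powr (- 1 / 2) * (s / 2) powr (- 3 / 2)"
        by (intro mult_mono mult_left_mono) auto
      also have "(s * u n ^ 2 / 2) powr (- 1 / 2) = (s / 2) powr (- 1 / 2) * (u n ^ 2) powr (- 1 / 2)"
        using s by (simp flip: powr_mult)
      also have "(u n ^ 2) powr (- 1 / 2) = 1 / u n"
        using elim by (simp add: powr_powr powr_minus inverse_eq_divide flip: powr_numeral)
      also have "real n * ((s / 2) powr (- 1 / 2) * (1 / u n)) * (s / 2) powr (- 3 / 2)
          = real n * ((s / 2) powr (- 1 / 2) * (s / 2) powr (- 3 / 2)) / u n" by simp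
      \<comment> \<open>The powers combine to \<open>4 / n\<close>, which cancels the factor
        \<open>n\<close> and leaves \<open>4 / u n\<close>.\<close>
      also have "(s / 2) powr (- 1 / 2) * (s / 2) powr (- 3 / 2) = (s / 2) powr (- 2)"
        by (simp flip: powr_add)
      also have "(s / 2) powr (- 2) = 4 / real n"
        using s elim by (simp add: powr_minus powr_numeral power_divide s_def inverse_eq_divide)
      finally show ?case using elim by simp
    qed
  qed simp
  have "(\<lambda>n. real (b n) / sqrt (real n)) \<longlonglongrightarrow> 1"
    by (rule asymp_equivD_strong[OF b]) (use eventually_gt_at_top[of 0] in \<open>eventually_elim, simp\<close>)
  moreover have "(\<lambda>n. real (k n) / K n) \<longlonglongrightarrow> 1"
    by (rule asymp_equivD_strong[OF k[folded K_def]]) (use base in \<open>eventually_elim, simp\<close>)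
  ultimately have "(\<lambda>n. ((real (b n) / sqrt (real n)) * (real (k n) / K n)) powr (- 1 / 2)) \<longlonglongrightarrow> (1 * 1) powr (- 1 / 2)"
    by (intro tendsto_intros) auto
  moreover have "\<forall>\<^sub>F n in sequentially. ((real (b n) / sqrt (real n)) * (real (k n) / K n)) powr (- 1 / 2)
      = rate n (b n) (k n) / (sqrt (real n) * ln (real n) powr (- 1 / 2) * inverse (u n))"
    using base kb bb
  proof eventually_elim
    case (elim n)
    have "sqrt (real n) * ln (real n) powr (- 1 / 2) * inverse (u n) = rate n (sqrt (real n)) (K n)"
      unfolding K_def using elim by (intro rate_canonical[symmetric]) auto
    also have "\<dots> = real n * (sqrt (real n) * K n) powr (- 1 / 2)" by (simp add: rate_def)
    finally have e: "sqrt (real n) * ln (real n) powr (- 1 / 2) * inverse (u n) = real n * (sqrt (real n) * K n) powr (- 1 / 2)" .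
    have "((real (b n) / sqrt (real n)) * (real (k n) / K n)) powr (- 1 / 2)
        = (real (b n) * real (k n)) powr (- 1 / 2) / (sqrt (real n) * K n) powr (- 1 / 2)"
      unfolding times_divide_times_eq by (rule powr_divide)
    then show ?case unfolding e using elim by (simp add: rate_def)
  qed
  ultimately have "(\<lambda>n. rate n (b n) (k n) / (sqrt (real n) * ln (real n) powr (- 1 / 2) * inverse (u n))) \<longlonglongrightarrow> (1 * 1) powr (- 1 / 2)"
    by (rule Lim_transform_eventually)
  then have "(\<lambda>n. rate n (b n) (k n)) \<sim>[at_top] (\<lambda>n. sqrt (real n) * ln (real n) powr (- 1 / 2) * inverse (u n))"
    by (intro asymp_equivI') simp
  with kinf binf i ii iii iv show ?thesis by (simp add: growth_conditions_def)
qed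

text \<open>On the diagonal the kernel is \<open>b\<close> up to 2; off it, the decay estimate
  bounds it independently of \<open>b\<close>. The sine hypothesis keeps away from points that
  differ by a nonzero integer.\<close>

lemma dirichlet_kernel_normalized_limit:
  assumes b: "filterlim b at_top sequentially" and x: "x \<in> {0..1}" "y \<in> {0..1}"
    and distinct: "x \<noteq> y \<Longrightarrow> sin (pi * (x - y)) \<noteq> 0"
  shows "(\<lambda>n. dirichlet_kernel (b n) x y / real (b n)) \<longlonglongrightarrow> (if x = y then 1 else 0)"
proof -
  have bR: "filterlim (\<lambda>n. real (b n)) at_top sequentially"
    using b by (simp add: filterlim_sequentially_iff_filterlim_real)
  have b1: "\<forall>\<^sub>F n in sequentially. real (b n) \<ge> 1"
    using bR unfolding filterlim_at_top by blast
  define C where "C = (if x = y then 2 else 3 / \<bar>sin (pi * (x - y))\<bar>)"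
  have bound: "\<bar>dirichlet_kernel m x y - (if x = y then real m else 0)\<bar> \<le> C" for m
  proof (cases "x = y")
    case True
    then show ?thesis using dirichlet_kernel_diagonal[of m x] by (simp add: C_def)
  next
    case False
    then show ?thesis using dirichlet_kernel_decay[of x y m] distinct by (simp add: C_def field_simps)
  qed
  have "(\<lambda>n. C / real (b n)) \<longlonglongrightarrow> 0"
    by (rule real_tendsto_divide_at_top[OF tendsto_const bR])
  then have "(\<lambda>n. dirichlet_kernel (b n) x y / real (b n) - (if x = y then 1 else 0)) \<longlonglongrightarrow> 0"
  proof (rule Lim_null_comparison[rotated])
    show "\<forall>\<^sub>F n in sequentially. norm (dirichlet_kernel (b n) x y / real (b n) - (if x = y then 1 else 0)) \<le> C / real (b n)"
      using b1
    proof eventually_elim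
      case (elim n)
      have "dirichlet_kernel (b n) x y / real (b n) - (if x = y then 1 else 0)
          = (dirichlet_kernel (b n) x y - (if x = y then real (b n) else 0)) / real (b n)"
        using elim by (simp add: diff_divide_distrib)
      then show ?case using bound[of "b n"] elim by (simp only: real_norm_def abs_divide) (simp add: divide_right_mono)
    qed
  qed
  then show ?thesis by (rule Lim_null[THEN iffD2])
qed

lemma growth_consequences:
  fixes k b :: "nat \<Rightarrow> nat"
  assumes kpos: "\<forall>n\<ge>1. k n > 0" and b: "filterlim b at_top sequentially" and growth: "growth_conditions k b"
  defines "v \<equiv> \<lambda>n. rate n (b n) (k n)"
  shows "\<forall>\<^sub>F n in sequentially. n \<ge> 3 \<and> real (b n) \<ge> 3 \<and> k n \<ge> 1 \<and> ln (real n) \<ge> 1 \<and> ln (real (b n)) \<ge> 1"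
    and "(\<lambda>n. v n * ln (real (b n)) / real (k n)) \<longlonglongrightarrow> 0"
    and "(\<lambda>n. v n / real (b n)) \<longlonglongrightarrow> 0"
    and "(\<lambda>n. real (b n) * ln (real (b n)) / real (k n)) \<longlonglongrightarrow> 0"
    and "(\<lambda>n. real (b n) / real (k n)) \<longlonglongrightarrow> 0"
    and "(\<lambda>n. real (k n) / real n) \<longlonglongrightarrow> 0"
    and "\<forall>\<^sub>F n in sequentially. (v n * real (k n) / real n)\<^sup>2 = real (k n) / real (b n)"
    and "\<forall>\<^sub>F n in sequentially. real n / (real (k n))\<^sup>2 \<le> 1"
    and "a > 0 \<Longrightarrow> \<forall>\<^sub>F n in sequentially. exp (- (a * (real n / real (k n)))) \<le> 1 / real (k n)"
proof -
  note g = growth[unfolded growth_conditions_def, THEN conjunct1]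
    growth[unfolded growth_conditions_def, THEN conjunct2, THEN conjunct1]
    growth[unfolded growth_conditions_def, THEN conjunct2, THEN conjunct2, THEN conjunct1]
    growth[unfolded growth_conditions_def, THEN conjunct2, THEN conjunct2, THEN conjunct2]
  have bR: "filterlim (\<lambda>n. real (b n)) at_top sequentially"
    using b by (simp add: filterlim_sequentially_iff_filterlim_real)
  have e3: "exp 1 \<le> (3::real)" by (rule exp_le)
  have b3: "\<forall>\<^sub>F n in sequentially. real (b n) \<ge> 3" using bR unfolding filterlim_at_top by blast
  have ln3: "ln y \<ge> 1" if "y \<ge> 3" for y :: real
  proof -
    have "exp 1 \<le> y" using e3 that by linarith
    then show ?thesis using that by (subst ln_ge_iff) auto
  qed
  show base: "\<forall>\<^sub>F n in sequentially. n \<ge> 3 \<and> real (b n) \<ge> 3 \<and> k n \<ge> 1 \<and> ln (real n) \<ge> 1 \<and> ln (real (b n)) \<ge> 1"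
    using b3 eventually_ge_at_top[of 3]
  proof eventually_elim
    case (elim n)
    have "n \<ge> 1" using elim by simp
    then have "k n > 0" using kpos by blast
    then show ?case using elim ln3[of "real n"] ln3[of "real (b n)"] by simp
  qed
  have "(\<lambda>n. inverse (real (k n) / (real (b n) * ln (real (b n))))) \<longlonglongrightarrow> 0"
    by (rule tendsto_inverse_0_at_top[OF g(3)])
  then show blk: "(\<lambda>n. real (b n) * ln (real (b n)) / real (k n)) \<longlonglongrightarrow> 0"
    by simp
  show bk: "(\<lambda>n. real (b n) / real (k n)) \<longlonglongrightarrow> 0"
  proof (rule Lim_null_comparison[OF _ blk])
    show "\<forall>\<^sub>F n in sequentially. norm (real (b n) / real (k n)) \<le> real (b n) * ln (real (b n)) / real (k n)"
      using base
    proof eventually_elim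
      case (elim n)
      have "real (b n) * 1 \<le> real (b n) * ln (real (b n))" using elim by (intro mult_left_mono) auto
      then show ?case by (simp add: divide_right_mono)
    qed
  qed
  have kln: "(\<lambda>n. real (k n) * ln (real n) / real n) \<longlonglongrightarrow> 0" by (rule g(1))
  show "(\<lambda>n. real (k n) / real n) \<longlonglongrightarrow> 0"
  proof (rule Lim_null_comparison[OF _ kln])
    show "\<forall>\<^sub>F n in sequentially. norm (real (k n) / real n) \<le> real (k n) * ln (real n) / real n"
      using base
    proof eventually_elim
      case (elim n)
      have "real (k n) * 1 \<le> real (k n) * ln (real n)" using elim by (intro mult_left_mono) auto
      then show ?case by (simp add: divide_right_mono)
    qed
  qed
  have iv: "(\<lambda>n. real n * real (k n) powr (- 1 / 2) * real (b n) powr (- 3 / 2)) \<longlonglongrightarrow> 0" by (rule g(4))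
  \<comment> \<open>Condition (iv) is \<open>v / b\<close> in disguise: split
    \<open>b powr (- 3 / 2)\<close> into \<open>b powr (- 1 / 2)\<close> and
    \<open>1 / b\<close>.\<close>
  have veq: "\<forall>\<^sub>F n in sequentially. real n * real (k n) powr (- 1 / 2) * real (b n) powr (- 3 / 2) = v n / real (b n)"
    using base
  proof eventually_elim
    case (elim n)
    have "real (b n) powr (- 3 / 2) = real (b n) powr (- 1 / 2) * real (b n) powr (- 1)"
      by (simp only: powr_add[symmetric]) simp
    also have "real (b n) powr (- 1) = 1 / real (b n)" using elim by (simp add: powr_minus_divide)
    finally show ?case using elim by (simp add: v_def rate_def powr_mult)
  qed
  show vb: "(\<lambda>n. v n / real (b n)) \<longlonglongrightarrow> 0"
    by (rule Lim_transform_eventually[OF iv veq])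
  \<comment> \<open>The product of (iv) and the inverse of (iii); the factors \<open>b\<close>
    cancel.\<close>
  have "(\<lambda>n. v n / real (b n) * (real (b n) * ln (real (b n)) / real (k n))) \<longlonglongrightarrow> 0 * 0"
    by (intro tendsto_mult vb blk)
  moreover have "\<forall>\<^sub>F n in sequentially. v n / real (b n) * (real (b n) * ln (real (b n)) / real (k n)) = v n * ln (real (b n)) / real (k n)"
    using base by eventually_elim simp
  ultimately have "(\<lambda>n. v n * ln (real (b n)) / real (k n)) \<longlonglongrightarrow> 0 * 0"
    by (rule Lim_transform_eventually)
  then show "(\<lambda>n. v n * ln (real (b n)) / real (k n)) \<longlonglongrightarrow> 0" by simp
  show "\<forall>\<^sub>F n in sequentially. (v n * real (k n) / real n)\<^sup>2 = real (k n) / real (b n)"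
    using base
  proof eventually_elim
    case (elim n)
    have "((real (b n) * real (k n)) powr (- 1 / 2))\<^sup>2 = (real (b n) * real (k n)) powr (- 1)"
      by (simp only: power2_eq_square powr_add[symmetric]) simp
    also have "\<dots> = 1 / (real (b n) * real (k n))" using elim by (simp add: powr_minus_divide)
    finally have sq: "((real (b n) * real (k n)) powr (- 1 / 2))\<^sup>2 = 1 / (real (b n) * real (k n))" .
    have "v n * real (k n) / real n = (real (b n) * real (k n)) powr (- 1 / 2) * real (k n)"
      using elim by (simp add: v_def rate_def)
    then have "(v n * real (k n) / real n)\<^sup>2 = 1 / (real (b n) * real (k n)) * (real (k n))\<^sup>2"
      by (simp only: power_mult_distrib sq)
    then show ?case using elim by (simp add: power2_eq_square)
  qed
  have "\<forall>\<^sub>F n in sequentially. 1 \<le> real (k n) ^ 2 / real n"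
    using g(2) unfolding filterlim_at_top by blast
  with base show "\<forall>\<^sub>F n in sequentially. real n / (real (k n))\<^sup>2 \<le> 1"
    by eventually_elim (simp add: field_simps)
  show "\<forall>\<^sub>F n in sequentially. exp (- (a * (real n / real (k n)))) \<le> 1 / real (k n)" if a: "a > 0"
  proof -
    have "\<forall>\<^sub>F n in sequentially. real (k n) * ln (real n) / real n < min a 1"
      using a by (intro order_tendstoD(2)[OF kln]) auto
    with base show ?thesis
    proof eventually_elim
      case (elim n)
      \<comment> \<open>The first inequality bounds the exponential by \<open>1 / n\<close>; the
        second one gives \<open>k n \<le> n\<close> and hence the bound
        \<open>1 / k n\<close>.\<close>
      have "real (k n) * ln (real n) \<le> a * real n" "real (k n) * ln (real n) \<le> real n"
        using elim by (simp_all add: field_simps)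
      then have "ln (real n) \<le> a * (real n / real (k n))" using elim by (simp add: field_simps)
      then have "exp (- (a * (real n / real (k n)))) \<le> exp (- ln (real n))" by simp
      also have "exp (- ln (real n)) = 1 / real n" using elim by (simp add: exp_minus inverse_eq_divide)
      finally have "exp (- (a * (real n / real (k n)))) \<le> 1 / real n" .
      moreover have "real (k n) * 1 \<le> real (k n) * ln (real n)" using elim by (intro mult_left_mono) auto
      then have "real (k n) \<le> real n" using \<open>real (k n) * ln (real n) \<le> real n\<close> by linarith
      then have "1 / real n \<le> 1 / real (k n)" using elim by (intro divide_left_mono) auto
      ultimately show ?case by linarith
    qed
  qed
qed

lemma C2_bounds:
  fixes f f' f'' :: "real \<Rightarrow> real"
  assumes f': "\<forall>t\<in>{0..1}. (f has_real_derivative f' t) (at t within {0..1})"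
    and f'': "\<forall>t\<in>{0..1}. (f' has_real_derivative f'' t) (at t within {0..1})"
    and cont: "continuous_on {0..1} f''" and inf: "(INF t\<in>{0..1}. f t) > 0"
  obtains m L FM B where "m > 0" "\<And>x. x \<in> {0..1} \<Longrightarrow> m \<le> f x" "\<And>x. x \<in> {0..1} \<Longrightarrow> f x \<le> FM"
    "L \<ge> 0" "\<And>s t. s \<in> {0..1} \<Longrightarrow> t \<in> {0..1} \<Longrightarrow> \<bar>f s - f t\<bar> \<le> L * \<bar>s - t\<bar>"
    "\<And>x. x \<in> {0..1} \<Longrightarrow> \<bar>f'' x\<bar> \<le> B" "continuous_on {0..1} f"
proof -
  have cf: "continuous_on {0..1} f" and cf': "continuous_on {0..1} f'"
    unfolding continuous_on_eq_continuous_within using f' f'' DERIV_continuous by blast+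
  have bdd: "\<exists>B. \<forall>t\<in>{0..1}. \<bar>g t\<bar> \<le> B" if "continuous_on {0..1} g" for g :: "real \<Rightarrow> real"
    using compact_imp_bounded[OF compact_continuous_image[OF that compact_Icc]] by (auto simp: bounded_real)
  obtain FM where FM: "\<forall>t\<in>{0..1}. \<bar>f t\<bar> \<le> FM" using bdd[OF cf] by blast
  obtain L where L: "\<forall>t\<in>{0..1}. \<bar>f' t\<bar> \<le> L" using bdd[OF cf'] by blast
  obtain B where B: "\<forall>t\<in>{0..1}. \<bar>f'' t\<bar> \<le> B" using bdd[OF cont] by blast
  have "bdd_below (f ` {0..1})"
  proof (rule bdd_belowI2)
    fix t :: real assume "t \<in> {0..1}"
    then show "- FM \<le> f t" using FM by fastforce
  qed
  then have low: "(INF t\<in>{0..1}. f t) \<le> f x" if "x \<in> {0..1}" for x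
    using that by (rule cINF_lower)
  have L0: "L \<ge> 0" using L by force
  have lip: "\<bar>f s - f t\<bar> \<le> L * \<bar>s - t\<bar>" if "s \<in> {0..1}" "t \<in> {0..1}" for s t
    using field_differentiable_bound[of "{0..1}" f f' L s t] f' L that by simp
  show ?thesis
  proof (rule that[OF inf low _ L0 lip])
    show "f x \<le> FM" if "x \<in> {0..1}" for x using FM that by fastforce
    show "\<bar>f'' x\<bar> \<le> B" if "x \<in> {0..1}" for x using B that by blast
  qed (use cf in auto)
qed

text \<open>The error terms of \<open>char_bound\<close> vanish, and the sum \<open>Q\<close> of the
  squared weights tends to \<open>(norm t)\<^sup>2\<close>, being close to the quadratic form
  \<open>DD\<close> of kernel values divided by \<open>b\<close>.\<close>

lemma estimator_char_limit:
  fixes M :: "'w measure" and N :: "nat \<Rightarrow> 'w \<Rightarrow> (real \<times> real) multiset" and f f' f'' :: "real \<Rightarrow> real"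
    and x t :: "real^'p" and k b :: "nat \<Rightarrow> nat"
  assumes M: "prob_space M" and c: "c > 0"
    and ppp: "\<forall>n\<ge>1. poisson_point_process M (N n) (intensity f c n)"
    and f': "\<forall>t\<in>{0..1}. (f has_real_derivative f' t) (at t within {0..1})"
    and f'': "\<forall>t\<in>{0..1}. (f' has_real_derivative f'' t) (at t within {0..1})"
    and cont: "continuous_on {0..1} f''" and per: "f 0 = f 1" "f' 0 = f' 1"
    and inf: "(INF t\<in>{0..1}. f t) > 0"
    and x: "\<forall>i. x $ i \<in> {0..1}" and distinct: "\<forall>i j. i \<noteq> j \<longrightarrow> x $ i \<noteq> x $ j" "\<not> (\<exists>i j. x $ i = 0 \<and> x $ j = 1)"
    and kpos: "\<forall>n\<ge>1. k n > 0" and b: "filterlim b at_top sequentially" and growth: "growth_conditions k b"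
  shows "\<And>n. n \<ge> 1 \<Longrightarrow> (\<lambda>\<omega>. \<chi> j. rate n (b n) (k n) * c * (estimator f (N n) (k n) (b n) (x $ j) \<omega> - f (x $ j))) \<in> borel_measurable M"
    and "(\<lambda>n. \<integral>\<omega>. iexp (t \<bullet> (\<chi> j. rate n (b n) (k n) * c * (estimator f (N n) (k n) (b n) (x $ j) \<omega> - f (x $ j)))) \<partial>M)
      \<longlonglongrightarrow> of_real (exp (- (norm t)\<^sup>2 / 2))"
proof -
  obtain m L FM B where m: "m > 0" "\<And>x. x \<in> {0..1} \<Longrightarrow> m \<le> f x" and FM: "\<And>x. x \<in> {0..1} \<Longrightarrow> f x \<le> FM"
    and L: "L \<ge> 0" "\<And>s t. s \<in> {0..1} \<Longrightarrow> t \<in> {0..1} \<Longrightarrow> \<bar>f s - f t\<bar> \<le> L * \<bar>s - t\<bar>"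
    and B: "\<And>x. x \<in> {0..1} \<Longrightarrow> \<bar>f'' x\<bar> \<le> B" and cf: "continuous_on {0..1} f"
    by (rule C2_bounds[OF f' f'' cont inf]) blast
  have SE: "strip_estimation M (N n) f c m L n (k n)" if "n \<ge> 1" for n
  proof (intro strip_estimation.intro M strip_estimation_axioms.intro)
    show "poisson_point_process M (N n) (intensity f c n)" using ppp that by blast
    show "1 \<le> k n" using kpos that by (simp add: Suc_le_eq)
  qed (use cf m L c that in auto)
  show "(\<lambda>\<omega>. \<chi> j. rate n (b n) (k n) * c * (estimator f (N n) (k n) (b n) (x $ j) \<omega> - f (x $ j))) \<in> borel_measurable M"
    if "n \<ge> 1" for n
    using strip_estimation.measurable_estimator[OF SE[OF that]] by (intro vec_measurable) simp
  define v where "v = (\<lambda>n. rate n (b n) (k n))"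
  have v_eq: "rate n (real (b n)) (real (k n)) = v n" for n by (simp add: v_def)
  note cons = growth_consequences[OF kpos b growth, unfolded v_eq]
  define T where "T = (\<Sum>j\<in>UNIV. \<bar>t $ j\<bar>)"
  have T0: "T \<ge> 0" by (simp add: T_def sum_nonneg)
  have FM0: "FM \<ge> 0" using FM[of 0] m(2)[of 0] m(1) by simp
  have B0: "B \<ge> 0" using B[of 0] by simp
  define W where "W = (\<lambda>n r j. integral {(real r - 1) / real (k n) .. real r / real (k n)} (dirichlet_kernel (b n) (x $ j)))"
  define \<rho> where "\<rho> = (\<lambda>n. v n * real (k n) / real n)"
  define \<alpha> where "\<alpha> = (\<lambda>n r. \<rho> n * (\<Sum>j\<in>UNIV. t $ j * W n r j))"
  define \<epsilon> where "\<epsilon> = (\<lambda>n. \<rho> n * (T * (2 * (real (b n) + 1) / real (k n))))"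
  define w where "w = (\<lambda>n. real n * c / real (k n))"
  define E where "E = (\<lambda>n. v n * c * (72 * ln (real (b n)) * (2 * (L / real (k n))\<^sup>2 * w n + FM * exp (- (w n * m)) + L / real (k n)) + 6 * B / real (b n)))"
  define Q where "Q = (\<lambda>n. \<Sum>r=1..k n. (\<alpha> n r)\<^sup>2)"
  define V where "V = (\<lambda>n \<omega>. t \<bullet> (\<chi> j. v n * c * (estimator f (N n) (k n) (b n) (x $ j) \<omega> - f (x $ j))))"
  have v0: "v n \<ge> 0" for n by (simp add: v_def rate_def)
  have \<rho>0: "\<rho> n \<ge> 0" for n using v0 by (simp add: \<rho>_def)
  have fourier: "\<bar>integral {0..1} (\<lambda>t. dirichlet_kernel m y t * f t) - f y\<bar> \<le> 6 * B / real m" if "y \<in> {0..1}" "m \<ge> 2" for m y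
    by (rule dirichlet_kernel_approximation[where f' = f' and f'' = f'']) (use f' f'' cont B per that in auto)
  have main: "\<forall>\<^sub>F n in sequentially. cmod ((\<integral>\<omega>. iexp (V n \<omega>) \<partial>M) - of_real (exp (- Q n / 2)))
      \<le> T * E n + (\<epsilon> n * (25 + 4 / (w n * m)) + 4 / (w n * m) + (\<epsilon> n)\<^sup>2) * Q n"
    using cons(1)
  proof eventually_elim
    case (elim n)
    interpret SE: strip_estimation M "N n" f c m L n "k n" by (rule SE) (use elim in simp)
    have "b n \<ge> 2" using elim by linarith
    from SE.char_bound[of x "b n" FM "6 * B" "v n" t, OF _ this FM fourier[OF _ this] v0] x
    show ?case
      unfolding V_def Q_def \<alpha>_def \<rho>_def W_def E_def \<epsilon>_def w_def T_def SE.w_def SE.cell_int_def by simp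
  qed
  have blk: "(\<lambda>n. real (b n) * ln (real (b n)) / real (k n)) \<longlonglongrightarrow> 0" by (rule cons(4))
  have E0: "E \<longlonglongrightarrow> 0"
  proof (rule Lim_null_comparison)
    show "(\<lambda>n. 72 * c * (2 * L\<^sup>2 * c + FM + L) * (v n * ln (real (b n)) / real (k n)) + 6 * B * c * (v n / real (b n))) \<longlonglongrightarrow> 0"
      using tendsto_add[OF tendsto_mult_left[OF cons(2), of "72 * c * (2 * L\<^sup>2 * c + FM + L)"] tendsto_mult_left[OF cons(3), of "6 * B * c"]]
      by simp
    have cm: "c * m > 0" using c m by simp
    show "\<forall>\<^sub>F n in sequentially. norm (E n) \<le> 72 * c * (2 * L\<^sup>2 * c + FM + L) * (v n * ln (real (b n)) / real (k n)) + 6 * B * c * (v n / real (b n))"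
      using cons(1) cons(8) cons(9)[OF cm]
    proof eventually_elim
      case (elim n)
      have "2 * (L / real (k n))\<^sup>2 * w n = 2 * L\<^sup>2 * c * (real n / (real (k n))\<^sup>2) / real (k n)"
        by (simp add: w_def power2_eq_square)
      also have "\<dots> \<le> 2 * L\<^sup>2 * c * 1 / real (k n)"
        using elim c by (intro divide_right_mono mult_left_mono) auto
      finally have 1: "2 * (L / real (k n))\<^sup>2 * w n \<le> 2 * L\<^sup>2 * c / real (k n)" by simp
      have "exp (- (w n * m)) \<le> 1 / real (k n)" using elim by (simp add: w_def mult_ac)
      then have 2: "FM * exp (- (w n * m)) \<le> FM / real (k n)"
        using FM0 mult_left_mono[of "exp (- (w n * m))" "1 / real (k n)" FM] by simp
      have sum_le: "2 * (L / real (k n))\<^sup>2 * w n + FM * exp (- (w n * m)) + L / real (k n) \<le> (2 * L\<^sup>2 * c + FM + L) / real (k n)"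
        using 1 2 by (simp add: add_divide_distrib)
      have alg: "v n * c * (72 * ln (real (b n)) * (A / real (k n)) + 6 * B / real (b n))
          = 72 * c * A * (v n * ln (real (b n)) / real (k n)) + 6 * B * c * (v n / real (b n))" for A
        by (simp add: distrib_left mult_ac)
      have "E n \<le> v n * c * (72 * ln (real (b n)) * ((2 * L\<^sup>2 * c + FM + L) / real (k n)) + 6 * B / real (b n))"
        unfolding E_def using sum_le v0 c elim by (intro mult_left_mono add_right_mono) auto
      also have "\<dots> = 72 * c * (2 * L\<^sup>2 * c + FM + L) * (v n * ln (real (b n)) / real (k n)) + 6 * B * c * (v n / real (b n))"
        by (rule alg)
      finally have up: "E n \<le> 72 * c * (2 * L\<^sup>2 * c + FM + L) * (v n * ln (real (b n)) / real (k n)) + 6 * B * c * (v n / real (b n))" .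
      have "w n \<ge> 0" using c by (simp add: w_def)
      then have "E n \<ge> 0"
        unfolding E_def using v0 c elim FM0 B0 L(1) by (intro mult_nonneg_nonneg add_nonneg_nonneg divide_nonneg_nonneg) auto
      with up show ?case by simp
    qed
  qed
  have \<eta>0: "(\<lambda>n. 4 / (w n * m)) \<longlonglongrightarrow> 0"
    using tendsto_mult_left[OF cons(6), of "4 / (c * m)"] by (simp add: w_def mult_ac)
  have bk4: "(\<lambda>n. 16 * T\<^sup>2 * (real (b n) / real (k n))) \<longlonglongrightarrow> 0"
    using tendsto_mult_left[OF cons(5), of "16 * T\<^sup>2"] by simp
  have b1: "(real (b n) + 1)\<^sup>2 \<le> 4 * (real (b n))\<^sup>2" if "real (b n) \<ge> 3" for n
  proof -
    have "(real (b n) + 1)\<^sup>2 \<le> (2 * real (b n))\<^sup>2" using that by (intro power_mono) auto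
    then show ?thesis by (simp add: power_mult_distrib)
  qed
  \<comment> \<open>Here \<open>\<rho>^2\<close> is \<open>k / b\<close> and a cell integral of the
    kernel is of order \<open>b / k\<close>, so the largest squared weight is of order
    \<open>b / k\<close>; no single cell dominates.\<close>
  have \<epsilon>2: "(\<lambda>n. (\<epsilon> n)\<^sup>2) \<longlonglongrightarrow> 0"
  proof (rule Lim_null_comparison[OF _ bk4])
    show "\<forall>\<^sub>F n in sequentially. norm ((\<epsilon> n)\<^sup>2) \<le> 16 * T\<^sup>2 * (real (b n) / real (k n))"
      using cons(1) cons(7)
    proof eventually_elim
      case (elim n)
      have "(\<epsilon> n)\<^sup>2 = (\<rho> n)\<^sup>2 * (T\<^sup>2 * (4 * (real (b n) + 1)\<^sup>2 / (real (k n))\<^sup>2))"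
        by (simp only: \<epsilon>_def power_mult_distrib power_divide) simp
      also have "(\<rho> n)\<^sup>2 = real (k n) / real (b n)" using elim by (simp add: \<rho>_def)
      also have "real (k n) / real (b n) * (T\<^sup>2 * (4 * (real (b n) + 1)\<^sup>2 / (real (k n))\<^sup>2))
          \<le> real (k n) / real (b n) * (T\<^sup>2 * (4 * (4 * (real (b n))\<^sup>2) / (real (k n))\<^sup>2))"
        using b1 elim by (intro mult_left_mono divide_right_mono) auto
      also have "\<dots> = 16 * T\<^sup>2 * (real (b n) / real (k n))"
        using elim by (simp add: power2_eq_square)
      finally show ?case by simp
    qed
  qed
  have \<epsilon>0: "\<epsilon> \<longlonglongrightarrow> 0"
  proof -
    have "\<epsilon> n \<ge> 0" for n using \<rho>0 T0 by (simp add: \<epsilon>_def)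
    then have "\<epsilon> = (\<lambda>n. sqrt ((\<epsilon> n)\<^sup>2))" by simp
    moreover have "(\<lambda>n. sqrt ((\<epsilon> n)\<^sup>2)) \<longlonglongrightarrow> 0"
      using tendsto_real_sqrt[OF \<epsilon>2] by simp
    ultimately show ?thesis by simp
  qed
  define DD where "DD = (\<lambda>n. \<Sum>i\<in>UNIV. \<Sum>j\<in>UNIV. t $ i * t $ j * dirichlet_kernel (b n) (x $ i) (x $ j))"
  have DD: "(\<lambda>n. DD n / real (b n)) \<longlonglongrightarrow> (norm t)\<^sup>2"
  proof -
    have "(\<lambda>n. \<Sum>i\<in>UNIV. \<Sum>j\<in>UNIV. t $ i * t $ j * (dirichlet_kernel (b n) (x $ i) (x $ j) / real (b n)))
        \<longlonglongrightarrow> (\<Sum>i\<in>UNIV. \<Sum>j\<in>UNIV. t $ i * t $ j * (if x $ i = x $ j then 1 else 0))"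
    proof (intro tendsto_sum tendsto_mult tendsto_const dirichlet_kernel_normalized_limit b)
      fix i j
      show "x $ i \<in> {0..1}" "x $ j \<in> {0..1}" using x by auto
      \<comment> \<open>Distinct coordinates in \<open>{0..1}\<close> differ by an integer only if
        they are 0 and 1, which the hypothesis excludes.\<close>
      show "sin (pi * (x $ i - x $ j)) \<noteq> 0" if "x $ i \<noteq> x $ j"
        using sin_pi_zero_cases[of "x $ i" "x $ j"] x distinct(2) that by metis
    qed
    moreover have "(\<Sum>i\<in>UNIV. \<Sum>j\<in>UNIV. t $ i * t $ j * (if x $ i = x $ j then 1 else 0)) = (norm t)\<^sup>2"
    proof -
      have "(\<Sum>j\<in>UNIV. t $ i * t $ j * (if x $ i = x $ j then 1 else 0)) = (\<Sum>j\<in>UNIV. if i = j then t $ i * t $ j else 0)" for i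
        using distinct(1) by (intro sum.cong refl) auto
      then show ?thesis by (simp add: norm_vec_def L2_set_def sum_nonneg power2_eq_square)
    qed
    ultimately show ?thesis by (simp add: DD_def sum_divide_distrib)
  qed
  have Qdiff: "(\<lambda>n. Q n - DD n / real (b n)) \<longlonglongrightarrow> 0"
  proof (rule Lim_null_comparison)
    \<comment> \<open>576 is 144 times 4, the latter from
      \<open>(b + 1)^2 \<le> 4 * b^2\<close>.\<close>
    show "(\<lambda>n. T\<^sup>2 * 576 * pi * (real (b n) * ln (real (b n)) / real (k n))) \<longlonglongrightarrow> 0"
      using tendsto_mult_left[OF blk, of "T\<^sup>2 * 576 * pi"] by simp
    show "\<forall>\<^sub>F n in sequentially. norm (Q n - DD n / real (b n)) \<le> T\<^sup>2 * 576 * pi * (real (b n) * ln (real (b n)) / real (k n))"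
      using cons(1) cons(7)
    proof eventually_elim
      case (elim n)
      let ?S = "\<Sum>r=1..k n. (\<Sum>j\<in>UNIV. t $ j * W n r j)\<^sup>2"
      have b2: "b n \<ge> 2" and bpos: "real (b n) > 0" using elim by linarith+
      have "Q n = (\<rho> n)\<^sup>2 * ?S" unfolding Q_def \<alpha>_def power_mult_distrib by (rule sum_distrib_left[symmetric])
      also have "(\<rho> n)\<^sup>2 = real (k n) / real (b n)" using elim by (simp add: \<rho>_def)
      finally have "Q n - DD n / real (b n) = (real (k n) * ?S - DD n) / real (b n)"
        by (simp add: diff_divide_distrib)
      then have "norm (Q n - DD n / real (b n)) = \<bar>real (k n) * ?S - DD n\<bar> / real (b n)"
        by simp
      also have "\<dots> \<le> T\<^sup>2 * (144 * pi * ln (real (b n)) * (real (b n) + 1)\<^sup>2 / real (k n)) / real (b n)"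
        unfolding DD_def W_def T_def using elim x by (intro divide_right_mono weights_square_sum b2) auto
      also have "\<dots> \<le> T\<^sup>2 * (144 * pi * ln (real (b n)) * (4 * (real (b n))\<^sup>2) / real (k n)) / real (b n)"
        using b1 elim by (intro divide_right_mono mult_left_mono) auto
      also have "\<dots> = T\<^sup>2 * 576 * pi * (real (b n) * ln (real (b n)) / real (k n))"
        using bpos by (simp add: power2_eq_square)
      finally show ?case .
    qed
  qed
  have Q: "Q \<longlonglongrightarrow> (norm t)\<^sup>2"
    using tendsto_add[OF Qdiff DD] by simp
  have "(\<lambda>n. T * E n + (\<epsilon> n * (25 + 4 / (w n * m)) + 4 / (w n * m) + (\<epsilon> n)\<^sup>2) * Q n)
      \<longlonglongrightarrow> T * 0 + (0 * (25 + 0) + 0 + 0) * (norm t)\<^sup>2"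
    by (intro tendsto_add tendsto_mult tendsto_const E0 \<epsilon>0 \<eta>0 \<epsilon>2 Q)
  then have "(\<lambda>n. (\<integral>\<omega>. iexp (V n \<omega>) \<partial>M) - of_real (exp (- Q n / 2))) \<longlonglongrightarrow> 0"
    by (intro Lim_null_comparison[OF main]) simp
  moreover have "(\<lambda>n. complex_of_real (exp (- Q n / 2))) \<longlonglongrightarrow> of_real (exp (- (norm t)\<^sup>2 / 2))"
    by (intro tendsto_of_real tendsto_exp tendsto_divide tendsto_minus Q tendsto_const) simp
  ultimately have "(\<lambda>n. (\<integral>\<omega>. iexp (V n \<omega>) \<partial>M) - of_real (exp (- Q n / 2)) + of_real (exp (- Q n / 2))) \<longlonglongrightarrow> 0 + of_real (exp (- (norm t)\<^sup>2 / 2))"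
    by (rule tendsto_add)
  then show "(\<lambda>n. \<integral>\<omega>. iexp (t \<bullet> (\<chi> j. rate n (b n) (k n) * c * (estimator f (N n) (k n) (b n) (x $ j) \<omega> - f (x $ j)))) \<partial>M)
      \<longlonglongrightarrow> of_real (exp (- (norm t)\<^sup>2 / 2))"
    by (simp add: V_def v_def)
qed

text \<open>Measurability is given from \<open>n = 1\<close> on, so the continuity theorem is
  applied to the laws of the shifted sequence and the shift is undone in the limit.\<close>

lemma char_limit_imp_converges_in_distribution:
  fixes V :: "nat \<Rightarrow> 'w \<Rightarrow> real^'p"
  assumes M: "prob_space M" and V: "\<And>n. n \<ge> 1 \<Longrightarrow> V n \<in> borel_measurable M"
    and lim: "\<And>t. (\<lambda>n. \<integral>\<omega>. iexp (t \<bullet> V n \<omega>) \<partial>M) \<longlonglongrightarrow> of_real (exp (- (norm t)\<^sup>2 / 2))"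
  shows "converges_in_distribution M V std_gaussian"
  unfolding converges_in_distribution_def
proof (intro conjI allI impI)
  show "\<forall>\<^sub>F n in sequentially. V n \<in> borel_measurable M"
    using eventually_ge_at_top[of 1] by eventually_elim (rule V)
  fix g :: "real^'p \<Rightarrow> real" assume g: "continuous_on UNIV g \<and> bounded (range g)"
  define \<mu> where "\<mu> = (\<lambda>n. distr M borel (V (Suc n)))"
  have gm: "g \<in> borel_measurable borel" using g by (intro borel_measurable_continuous_onI) simp
  have Vm: "V (Suc n) \<in> borel_measurable M" for n by (rule V) simp
  have mchar: "mchar (\<mu> n) t = (\<integral>\<omega>. iexp (t \<bullet> V (Suc n) \<omega>) \<partial>M)" for n t
    unfolding mchar_def \<mu>_def using Vm by (intro integral_distr) simp_all
  have "(\<lambda>n. \<integral>y. g y \<partial>\<mu> n) \<longlonglongrightarrow> (\<integral>y. g y \<partial>std_gaussian)"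
  proof (rule multivariate_levy_continuity)
    show "prob_space (\<mu> n)" for n
      unfolding \<mu>_def by (rule prob_space.prob_space_distr[OF M Vm])
    show "sets (\<mu> n) = sets borel" for n by (simp add: \<mu>_def)
    show "(\<lambda>n. mchar (\<mu> n) t) \<longlonglongrightarrow> mchar std_gaussian t" for t
      unfolding mchar unfolding mchar_def char_std_gaussian by (rule LIMSEQ_Suc[OF lim])
  qed (use g prob_space_std_gaussian in auto)
  moreover have "(\<integral>y. g y \<partial>\<mu> n) = (\<integral>\<omega>. g (V (Suc n) \<omega>) \<partial>M)" for n
    unfolding \<mu>_def using Vm gm by (rule integral_distr)
  ultimately have "(\<lambda>n. \<integral>\<omega>. g (V (Suc n) \<omega>) \<partial>M) \<longlonglongrightarrow> (\<integral>y. g y \<partial>std_gaussian)" by simp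
  then show "(\<lambda>n. \<integral>\<omega>. g (V n \<omega>) \<partial>M) \<longlonglongrightarrow> (\<integral>z. g z \<partial>std_gaussian)"
    by (rule LIMSEQ_imp_Suc)
qed

text \<open>As \<open>k\<close> and \<open>b\<close> are integers, the suggested choice is read as
  asymptotic equivalence, while the formula for the rate is an exact identity at the real values.
  The bound on the growth of \<open>u\<close> makes its slowness precise: it is what (i) demands of
  this choice.\<close>

theorem corollary3:
  fixes M :: "'w measure"
    and N :: "nat \<Rightarrow> 'w \<Rightarrow> (real \<times> real) multiset"
    and f f' f'' :: "real \<Rightarrow> real"
    and c :: real
    and x :: "real ^ 'p"
  assumes "prob_space M"
    and "c > 0"
    and "\<forall>n\<ge>1. poisson_point_process M (N n) (intensity f c n)"
    and f_nonneg: "\<forall>t\<in>{0..1}. f t \<ge> 0"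
    and f_C2: "\<forall>t\<in>{0..1}. (f has_real_derivative f' t) (at t within {0..1})"
      "\<forall>t\<in>{0..1}. (f' has_real_derivative f'' t) (at t within {0..1})"
      "continuous_on {0..1} f''"
    and f_periodic: "f 0 = f 1" "f' 0 = f' 1"
    and f_inf: "(INF t\<in>{0..1}. f t) > 0"
    and x_range: "\<forall>i. x $ i \<in> {0..1}"
    and x_distinct: "\<forall>i j. i \<noteq> j \<longrightarrow> x $ i \<noteq> x $ j" "\<not> (\<exists>i j. x $ i = 0 \<and> x $ j = 1)"
  shows
    "(\<forall>k b :: nat \<Rightarrow> nat.
        (\<forall>n\<ge>1. k n > 0) \<and> mono_on {1..} k \<and>
        filterlim k at_top sequentially \<and> filterlim b at_top sequentially \<and>
        growth_conditions k b \<longrightarrow>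
        converges_in_distribution M
          (\<lambda>n \<omega>. \<chi> j. rate n (b n) (k n) * c
             * (estimator f (N n) (k n) (b n) (x $ j) \<omega> - f (x $ j)))
          (std_gaussian :: (real ^ 'p) measure))
     \<and>
     (\<forall>u :: nat \<Rightarrow> real.
        filterlim u at_top sequentially \<and>
        (\<lambda>n. ln (real n) ^ 2 * u n ^ 2 / sqrt (real n)) \<longlonglongrightarrow> 0 \<longrightarrow>
        (\<forall>n\<ge>2. u n > 0 \<longrightarrow>
           rate n (sqrt (real n)) (sqrt (real n) * ln (real n) * u n ^ 2)
             = sqrt (real n) * ln (real n) powr (- 1 / 2) * inverse (u n)) \<and>
        (\<forall>k b :: nat \<Rightarrow> nat.
           (\<lambda>n. real (b n)) \<sim>[at_top] (\<lambda>n. sqrt (real n)) \<and>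
           (\<lambda>n. real (k n)) \<sim>[at_top] (\<lambda>n. sqrt (real n) * ln (real n) * u n ^ 2) \<longrightarrow>
           filterlim k at_top sequentially \<and> filterlim b at_top sequentially \<and>
           growth_conditions k b \<and>
           (\<lambda>n. rate n (b n) (k n))
             \<sim>[at_top] (\<lambda>n. sqrt (real n) * ln (real n) powr (- 1 / 2) * inverse (u n))))"
proof (intro conjI allI impI)
  fix k b :: "nat \<Rightarrow> nat"
  assume kb: "(\<forall>n\<ge>1. k n > 0) \<and> mono_on {1..} k \<and> filterlim k at_top sequentially \<and>
    filterlim b at_top sequentially \<and> growth_conditions k b"
  note est = estimator_char_limit[OF assms(1-3) f_C2 f_periodic f_inf x_range x_distinct, of k b]
  show "converges_in_distribution M
      (\<lambda>n \<omega>. \<chi> j. rate n (b n) (k n) * c * (estimator f (N n) (k n) (b n) (x $ j) \<omega> - f (x $ j)))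
      (std_gaussian :: (real ^ 'p) measure)"
    by (rule char_limit_imp_converges_in_distribution[OF assms(1)]) (use est kb in blast)+
next
  fix u :: "nat \<Rightarrow> real" and n :: nat
  assume "2 \<le> n" "0 < u n"
  then show "rate n (sqrt (real n)) (sqrt (real n) * ln (real n) * u n ^ 2)
      = sqrt (real n) * ln (real n) powr (- 1 / 2) * inverse (u n)"
    by (rule rate_canonical)
next
  fix u :: "nat \<Rightarrow> real" and k b :: "nat \<Rightarrow> nat"
  assume u: "filterlim u at_top sequentially \<and> (\<lambda>n. ln (real n) ^ 2 * u n ^ 2 / sqrt (real n)) \<longlonglongrightarrow> 0"
    and kb: "(\<lambda>n. real (b n)) \<sim>[at_top] (\<lambda>n. sqrt (real n)) \<and>
      (\<lambda>n. real (k n)) \<sim>[at_top] (\<lambda>n. sqrt (real n) * ln (real n) * u n ^ 2)"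
  note can = canonical_choice[of u b k] u kb
  show "filterlim k at_top sequentially" "filterlim b at_top sequentially" "growth_conditions k b"
    "(\<lambda>n. rate n (b n) (k n)) \<sim>[at_top] (\<lambda>n. sqrt (real n) * ln (real n) powr (- 1 / 2) * inverse (u n))"
    using can by blast+
qed

end
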